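(* Let $K$ be a field of characteristic different from $2$ and $3$, let $L$ be a Lie algebra over $K$, let $A$ be an associative commutative algebra with unit over $K$, and suppose that one of $L$, $A$ is finite-dimensional. Then $$\operatorname{HomLie}(L\otimes A)\simeq \operatorname{HomLie}(L)\otimes A+\{\varphi\in\operatorname{End}_K(L)\mid [[L,L],\varphi(L)]=0\}\otimes\operatorname{End}_K(A).$$ Each Hom-Lie structure on $L\otimes A$ can be represented as a sum of decomposable Hom-Lie structures of the form $\varphi\otimes\alpha$, where $\varphi\in\operatorname{End}_K(L)$, $\alpha\in\operatorname{End}_K(A)$, of the following two types: (i) $\varphi\in\operatorname{HomLie}(L)$ and $\alpha=\mathrm R_u$ for some $u\in A$; (ii) $[[L,L],\varphi(L)]=0$.
   Context: All tensor products are over $K$. $L\otimes A$ is the current Lie algebra with bracket $[x\otimes a,y\otimes b]=[x,y]\otimes ab$. A Hom-Lie structure on a Lie algebra $L$ is a linear map $\varphi:L\to L$ such that $[[x,y],\varphi(z)]+[[z,x],\varphi(y)]+[[y,z],\varphi(x)]=0$ for all $x,y,z\in L$. $\operatorname{HomLie}(L)$ is the vector space of all Hom-Lie structures on $L$. $\mathrm R_u:A\to A$ is multiplication by $u$. In the displayed isomorphism, the right-hand side is a (not necessarily direct) sum of subspaces of $\operatorname{End}_K(L)\otimes\operatorname{End}_K(A)$, where $A$ is identified with $\{\mathrm R_u\mid u\in A\}\subseteq\operatorname{End}_K(A)$. *)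

theory Defs
  imports "HOL-Algebra.AbelCoset" "Jordan_Normal_Form.Missing_VectorSpace"
begin

text \<open>
  Vector spaces over \<open>K\<close> are the carrier-based ones of the locale \<^locale>\<open>vectorspace\<close>, and unital
  associative commutative algebras those of \<^locale>\<open>algebra\<close>. Linear maps are represented by
  extensional functions, so that equality of maps is equality on the carrier.
\<close>

definition characteristic :: "('k, 'm) ring_scheme \<Rightarrow> nat" where
  "characteristic R =
    (if \<exists>n::nat. n > 0 \<and> [n] \<cdot>\<^bsub>R\<^esub> \<one>\<^bsub>R\<^esub> = \<zero>\<^bsub>R\<^esub>
     then LEAST n::nat. n > 0 \<and> [n] \<cdot>\<^bsub>R\<^esub> \<one>\<^bsub>R\<^esub> = \<zero>\<^bsub>R\<^esub> else 0)"

definition lin_End :: "('k, 'm) ring_scheme \<Rightarrow> ('k, 'v, 'n) module_scheme \<Rightarrow> ('k, 'v \<Rightarrow> 'v) module" where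
  "lin_End K V =
    \<lparr>carrier = module_hom K V V \<inter> extensional (carrier V),
     monoid.mult = compose (carrier V),
     one = (\<lambda>x\<in>carrier V. x),
     zero = (\<lambda>x\<in>carrier V. \<zero>\<^bsub>V\<^esub>),
     add = (\<lambda>f g. \<lambda>x\<in>carrier V. f x \<oplus>\<^bsub>V\<^esub> g x),
     smult = (\<lambda>c f. \<lambda>x\<in>carrier V. c \<odot>\<^bsub>V\<^esub> f x)\<rparr>"

definition free_space :: "('k, 'm) ring_scheme \<Rightarrow> 'x set \<Rightarrow> ('k, 'x \<Rightarrow> 'k) module" where
  "free_space K X =
    (ring.func_space K X)\<lparr>carrier := {f \<in> X \<rightarrow>\<^sub>E carrier K. finite {x \<in> X. f x \<noteq> \<zero>\<^bsub>K\<^esub>}}\<rparr>"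

definition free_gen :: "('k, 'm) ring_scheme \<Rightarrow> 'x set \<Rightarrow> 'x \<Rightarrow> ('x \<Rightarrow> 'k)" where
  "free_gen K X x = (\<lambda>y\<in>X. if y = x then \<one>\<^bsub>K\<^esub> else \<zero>\<^bsub>K\<^esub>)"

text \<open>Only the module structure of the quotient matters: the fields \<open>mult\<close> and \<open>one\<close> of a module
  record are not used by \<^locale>\<open>vectorspace\<close> and are filled with arbitrary values.\<close>

definition quotient_space ::
    "('k, 'm) ring_scheme \<Rightarrow> ('k, 'v, 'n) module_scheme \<Rightarrow> 'v set \<Rightarrow> ('k, 'v set) module" where
  "quotient_space K V N =
    \<lparr>carrier = a_rcosets\<^bsub>V\<^esub> N,
     monoid.mult = (\<lambda>_ _. N),
     one = N,
     zero = N,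
     add = (\<lambda>C D. C <+>\<^bsub>V\<^esub> D),
     smult = (\<lambda>c C. \<Union>x\<in>C. N +>\<^bsub>V\<^esub> (c \<odot>\<^bsub>V\<^esub> x))\<rparr>"

definition tensor_relators ::
    "('k, 'm) ring_scheme \<Rightarrow> ('k, 'v, 'n) module_scheme \<Rightarrow> ('k, 'w, 'o) module_scheme
      \<Rightarrow> ('v \<times> 'w \<Rightarrow> 'k) set" where
  "tensor_relators K V W =
    (let X = carrier V \<times> carrier W; F = free_space K X; \<delta> = free_gen K X in
      {\<delta> (x \<oplus>\<^bsub>V\<^esub> x', y) \<ominus>\<^bsub>F\<^esub> (\<delta> (x, y) \<oplus>\<^bsub>F\<^esub> \<delta> (x', y)) | x x' y.
          x \<in> carrier V \<and> x' \<in> carrier V \<and> y \<in> carrier W}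
      \<union> {\<delta> (x, y \<oplus>\<^bsub>W\<^esub> y') \<ominus>\<^bsub>F\<^esub> (\<delta> (x, y) \<oplus>\<^bsub>F\<^esub> \<delta> (x, y')) | x y y'.
          x \<in> carrier V \<and> y \<in> carrier W \<and> y' \<in> carrier W}
      \<union> {\<delta> (c \<odot>\<^bsub>V\<^esub> x, y) \<ominus>\<^bsub>F\<^esub> (c \<odot>\<^bsub>F\<^esub> \<delta> (x, y)) | c x y.
          c \<in> carrier K \<and> x \<in> carrier V \<and> y \<in> carrier W}
      \<union> {\<delta> (x, c \<odot>\<^bsub>W\<^esub> y) \<ominus>\<^bsub>F\<^esub> (c \<odot>\<^bsub>F\<^esub> \<delta> (x, y)) | c x y.
          c \<in> carrier K \<and> x \<in> carrier V \<and> y \<in> carrier W})"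

definition tensor_kernel ::
    "('k, 'm) ring_scheme \<Rightarrow> ('k, 'v, 'n) module_scheme \<Rightarrow> ('k, 'w, 'o) module_scheme
      \<Rightarrow> ('v \<times> 'w \<Rightarrow> 'k) set" where
  "tensor_kernel K V W =
    LinearCombinations.module.span K (free_space K (carrier V \<times> carrier W)) (tensor_relators K V W)"

definition tensor_space ::
    "('k, 'm) ring_scheme \<Rightarrow> ('k, 'v, 'n) module_scheme \<Rightarrow> ('k, 'w, 'o) module_scheme
      \<Rightarrow> ('k, ('v \<times> 'w \<Rightarrow> 'k) set) module" where
  "tensor_space K V W =
    quotient_space K (free_space K (carrier V \<times> carrier W)) (tensor_kernel K V W)"

definition pure_tensor ::
    "('k, 'm) ring_scheme \<Rightarrow> ('k, 'v, 'n) module_scheme \<Rightarrow> ('k, 'w, 'o) module_scheme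
      \<Rightarrow> 'v \<Rightarrow> 'w \<Rightarrow> ('v \<times> 'w \<Rightarrow> 'k) set" where
  "pure_tensor K V W x y =
    tensor_kernel K V W
      +>\<^bsub>free_space K (carrier V \<times> carrier W)\<^esub> free_gen K (carrier V \<times> carrier W) (x, y)"

text \<open>The linear map \<open>V \<otimes> W \<rightarrow> U\<close> induced by a bilinear map \<open>\<beta>\<close>: the class of
  \<open>\<Sum> c\<^sub>i (x\<^sub>i, y\<^sub>i)\<close> goes to \<open>\<Sum> c\<^sub>i \<beta> x\<^sub>i y\<^sub>i\<close>. For bilinear \<open>\<beta>\<close> the value does not depend on
  the chosen representative.\<close>

definition tensor_lift ::
    "('k, 'm) ring_scheme \<Rightarrow> ('k, 'v, 'n) module_scheme \<Rightarrow> ('k, 'w, 'o) module_scheme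
      \<Rightarrow> ('k, 'u, 'p) module_scheme \<Rightarrow> ('v \<Rightarrow> 'w \<Rightarrow> 'u) \<Rightarrow> ('v \<times> 'w \<Rightarrow> 'k) set \<Rightarrow> 'u" where
  "tensor_lift K V W U \<beta> = (\<lambda>t\<in>carrier (tensor_space K V W).
    let f = (SOME f. f \<in> t) in
    \<Oplus>\<^bsub>U\<^esub> p \<in> {p \<in> carrier V \<times> carrier W. f p \<noteq> \<zero>\<^bsub>K\<^esub>}. f p \<odot>\<^bsub>U\<^esub> \<beta> (fst p) (snd p))"

definition tensor_map ::
    "('k, 'm) ring_scheme \<Rightarrow> ('k, 'v, 'n) module_scheme \<Rightarrow> ('k, 'w, 'o) module_scheme
      \<Rightarrow> ('v \<Rightarrow> 'v) \<Rightarrow> ('w \<Rightarrow> 'w) \<Rightarrow> ('v \<times> 'w \<Rightarrow> 'k) set \<Rightarrow> ('v \<times> 'w \<Rightarrow> 'k) set" where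
  "tensor_map K V W \<phi> \<alpha> =
    tensor_lift K V W (tensor_space K V W) (\<lambda>x y. pure_tensor K V W (\<phi> x) (\<alpha> y))"

text \<open>The canonical map \<open>End V \<otimes> End W \<rightarrow> End (V \<otimes> W)\<close>.\<close>

definition tensor_End_map ::
    "('k, 'm) ring_scheme \<Rightarrow> ('k, 'v, 'n) module_scheme \<Rightarrow> ('k, 'w, 'o) module_scheme
      \<Rightarrow> (('v \<Rightarrow> 'v) \<times> ('w \<Rightarrow> 'w) \<Rightarrow> 'k) set \<Rightarrow> ('v \<times> 'w \<Rightarrow> 'k) set \<Rightarrow> ('v \<times> 'w \<Rightarrow> 'k) set" where
  "tensor_End_map K V W =
    tensor_lift K (lin_End K V) (lin_End K W) (lin_End K (tensor_space K V W)) (tensor_map K V W)"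

text \<open>For subspaces \<open>S\<close> of \<open>V\<close> and \<open>T\<close> of \<open>W\<close>, the subspace \<open>S \<otimes> T\<close> of \<open>V \<otimes> W\<close>, that is, the image
  of the map induced by the two inclusions.\<close>

definition tensor_sub ::
    "('k, 'm) ring_scheme \<Rightarrow> ('k, 'v, 'n) module_scheme \<Rightarrow> ('k, 'w, 'o) module_scheme
      \<Rightarrow> 'v set \<Rightarrow> 'w set \<Rightarrow> ('v \<times> 'w \<Rightarrow> 'k) set set" where
  "tensor_sub K V W S T =
    LinearCombinations.module.span K (tensor_space K V W) {pure_tensor K V W x y | x y. x \<in> S \<and> y \<in> T}"

record ('k, 'l) lie = "('k, 'l) module" +
  bracket :: "'l \<Rightarrow> 'l \<Rightarrow> 'l"

locale lie_algebra = vectorspace K L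
  for K :: "('k, 'm) ring_scheme" and L :: "('k, 'l, 'n) lie_scheme" +
  assumes bracket_closed:
      "\<lbrakk>x \<in> carrier L; y \<in> carrier L\<rbrakk> \<Longrightarrow> bracket L x y \<in> carrier L"
    and bracket_add_left:
      "\<lbrakk>x \<in> carrier L; y \<in> carrier L; z \<in> carrier L\<rbrakk>
        \<Longrightarrow> bracket L (x \<oplus>\<^bsub>L\<^esub> y) z = bracket L x z \<oplus>\<^bsub>L\<^esub> bracket L y z"
    and bracket_add_right:
      "\<lbrakk>x \<in> carrier L; y \<in> carrier L; z \<in> carrier L\<rbrakk>
        \<Longrightarrow> bracket L x (y \<oplus>\<^bsub>L\<^esub> z) = bracket L x y \<oplus>\<^bsub>L\<^esub> bracket L x z"
    and bracket_smult_left: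
      "\<lbrakk>c \<in> carrier K; x \<in> carrier L; y \<in> carrier L\<rbrakk>
        \<Longrightarrow> bracket L (c \<odot>\<^bsub>L\<^esub> x) y = c \<odot>\<^bsub>L\<^esub> bracket L x y"
    and bracket_smult_right:
      "\<lbrakk>c \<in> carrier K; x \<in> carrier L; y \<in> carrier L\<rbrakk>
        \<Longrightarrow> bracket L x (c \<odot>\<^bsub>L\<^esub> y) = c \<odot>\<^bsub>L\<^esub> bracket L x y"
    and bracket_self: "x \<in> carrier L \<Longrightarrow> bracket L x x = \<zero>\<^bsub>L\<^esub>"
    and jacobi:
      "\<lbrakk>x \<in> carrier L; y \<in> carrier L; z \<in> carrier L\<rbrakk>
        \<Longrightarrow> bracket L (bracket L x y) z \<oplus>\<^bsub>L\<^esub> bracket L (bracket L z x) y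
             \<oplus>\<^bsub>L\<^esub> bracket L (bracket L y z) x = \<zero>\<^bsub>L\<^esub>"

definition bracket_span ::
    "('k, 'm) ring_scheme \<Rightarrow> ('k, 'l, 'n) lie_scheme \<Rightarrow> 'l set \<Rightarrow> 'l set \<Rightarrow> 'l set" where
  "bracket_span K L S T = LinearCombinations.module.span K L {bracket L x y | x y. x \<in> S \<and> y \<in> T}"

definition HomLie :: "('k, 'm) ring_scheme \<Rightarrow> ('k, 'l, 'n) lie_scheme \<Rightarrow> ('l \<Rightarrow> 'l) set" where
  "HomLie K L = {\<phi> \<in> carrier (lin_End K L).
    \<forall>x\<in>carrier L. \<forall>y\<in>carrier L. \<forall>z\<in>carrier L.
      bracket L (bracket L x y) (\<phi> z) \<oplus>\<^bsub>L\<^esub> bracket L (bracket L z x) (\<phi> y)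
        \<oplus>\<^bsub>L\<^esub> bracket L (bracket L y z) (\<phi> x) = \<zero>\<^bsub>L\<^esub>}"

definition derived_annihilating ::
    "('k, 'm) ring_scheme \<Rightarrow> ('k, 'l, 'n) lie_scheme \<Rightarrow> ('l \<Rightarrow> 'l) set" where
  "derived_annihilating K L = {\<phi> \<in> carrier (lin_End K L).
    bracket_span K L (bracket_span K L (carrier L) (carrier L)) (\<phi> ` carrier L) = {\<zero>\<^bsub>L\<^esub>}}"

text \<open>The bracket of \<open>L \<otimes> A\<close> is obtained by bilinear extension of
  \<open>[x \<otimes> a, y \<otimes> b] = [x, y] \<otimes> ab\<close> in each argument.\<close>

definition current_lie ::
    "('k, 'm) ring_scheme \<Rightarrow> ('k, 'l, 'n) lie_scheme \<Rightarrow> ('k, 'a, 'o) module_scheme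
      \<Rightarrow> ('k, ('l \<times> 'a \<Rightarrow> 'k) set) lie" where
  "current_lie K L A = module.extend (tensor_space K L A)
    (lie.fields (\<lambda>s t.
      tensor_lift K L A (tensor_space K L A) (\<lambda>x a.
        tensor_lift K L A (tensor_space K L A) (\<lambda>y b.
          pure_tensor K L A (bracket L x y) (a \<otimes>\<^bsub>A\<^esub> b)) t) s))"

definition mult_op :: "('k, 'a, 'o) module_scheme \<Rightarrow> 'a \<Rightarrow> 'a \<Rightarrow> 'a" where
  "mult_op A u = (\<lambda>a\<in>carrier A. a \<otimes>\<^bsub>A\<^esub> u)"

text \<open>The subspace
  \<open>HomLie(L) \<otimes> A + {\<phi> | [[L, L], \<phi>(L)] = 0} \<otimes> End(A)\<close> of \<open>End(L) \<otimes> End(A)\<close>, with \<open>u \<in> A\<close> identified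
  with multiplication by \<open>u\<close>.\<close>

definition HomLie_tensor ::
    "('k, 'm) ring_scheme \<Rightarrow> ('k, 'l, 'n) lie_scheme \<Rightarrow> ('k, 'a, 'o) module_scheme
      \<Rightarrow> (('l \<Rightarrow> 'l) \<times> ('a \<Rightarrow> 'a) \<Rightarrow> 'k) set set" where
  "HomLie_tensor K L A =
    tensor_sub K (lin_End K L) (lin_End K A) (HomLie K L) (mult_op A ` carrier A)
    <+>\<^bsub>tensor_space K (lin_End K L) (lin_End K A)\<^esub>
    tensor_sub K (lin_End K L) (lin_End K A) (derived_annihilating K L) (carrier (lin_End K A))"

end

theory Submission
  imports Defs
begin

text \<open>
  Let \<open>\<Phi>\<close> be a Hom-Lie structure on \<open>L \<otimes> A\<close>. Everything rests on one observation about
  \<open>G(x, y, z; c) = [[x, y] \<otimes> 1, \<Phi>(z \<otimes> c)]\<close>. The Hom-Lie identity at \<open>x \<otimes> 1, y \<otimes> 1, z \<otimes> c\<close> reads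
  \<open>G(x, y, z; c) + c G(z, x, y; 1) + c G(y, z, x; 1) = 0\<close>. For \<open>c = 1\<close> it says that the cyclic sum
  of \<open>G(x, y, z; 1)\<close> vanishes, and multiplying this by \<open>c\<close> and subtracting gives
  \<open>G(x, y, z; c) = c G(x, y, z; 1)\<close>: as far as brackets with \<open>[L, L]\<close> can see, \<open>\<Phi>\<close> is
  \<open>A\<close>-linear (\<open>HomLie_scale\<close>).

  If \<open>L\<close> or \<open>A\<close> is finite-dimensional, \<open>\<Phi>\<close> is a sum of maps \<open>\<phi>\<^sub>i \<otimes> \<alpha>\<^sub>i\<close>, by inserting a basis and
  its dual basis on both sides of \<open>\<Phi>\<close> (\<open>tensor_End_map_surj_left\<close>, \<open>tensor_End_map_surj_right\<close>).
  Put \<open>\<rho>\<^sub>i = R\<^sub>u\<close> with \<open>u = \<alpha>\<^sub>i(1)\<close> and \<open>\<beta>\<^sub>i = \<alpha>\<^sub>i - \<rho>\<^sub>i\<close>. The observation splits the Hom-Lie identity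
  for \<open>\<Phi>\<close> into two linear conditions: \<open>\<Sum> [[x, y], \<phi>\<^sub>i z] \<otimes> \<beta>\<^sub>i(c) = 0\<close>, and
  \<open>\<Sum> D(\<phi>\<^sub>i) \<otimes> \<rho>\<^sub>i(c) = 0\<close> for the cyclic sum \<open>D\<close> whose vanishing defines \<open>HomLie(L)\<close>. If the
  second factors are linearly independent, such a condition can be read off on each first factor
  alone (\<open>independent_maps_coefficients_zero\<close>), and any tensor can be rewritten with an
  independent subfamily of its second factors (\<open>tensor_reduce_independent\<close>). Thus
  \<open>\<Sum> \<phi>\<^sub>i \<otimes> \<rho>\<^sub>i\<close> becomes a sum of structures of type (i) and \<open>\<Sum> \<phi>\<^sub>i \<otimes> \<beta>\<^sub>i\<close> a sum of structures of
  type (ii) (\<open>HomLie_current_decompose\<close>). Conversely maps of both types are Hom-Lie structures, by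
  checking the identity on pure tensors. The same reading off of coefficients shows that
  \<open>End L \<otimes> End A \<rightarrow> End (L \<otimes> A)\<close> is injective (\<open>tensor_End_map_inj\<close>), whence the isomorphism.

  Before this, the tensor product, realised as a quotient of a free space, needs its universal
  property (\<open>tensor_lift_hom\<close>, \<open>tensor_lift_pure\<close>), and points of an arbitrary vector space have to be
  separated by linear functionals (\<open>functional_nonzero_exists\<close>).
\<close>

section \<open>Linear maps\<close>

lemma module_homI:
  assumes "\<And>x. x \<in> carrier V \<Longrightarrow> f x \<in> carrier W"
    and "\<And>x y. \<lbrakk>x \<in> carrier V; y \<in> carrier V\<rbrakk> \<Longrightarrow> f (x \<oplus>\<^bsub>V\<^esub> y) = f x \<oplus>\<^bsub>W\<^esub> f y"
    and "\<And>c x. \<lbrakk>c \<in> carrier K; x \<in> carrier V\<rbrakk> \<Longrightarrow> f (c \<odot>\<^bsub>V\<^esub> x) = c \<odot>\<^bsub>W\<^esub> f x"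
  shows "f \<in> module_hom K V W"
  using assms by (auto simp: module_hom_def)

lemma module_hom_mem: "f \<in> module_hom K V W \<Longrightarrow> x \<in> carrier V \<Longrightarrow> f x \<in> carrier W"
  by (auto simp: module_hom_def)

lemma vectorspace_module: "vectorspace K V \<Longrightarrow> module K V"
  by (simp add: vectorspace_def)

lemma vectorspaceI: "field K \<Longrightarrow> module K V \<Longrightarrow> vectorspace K V"
  by (simp add: vectorspace_def)

lemma module_hom_zero:
  assumes "module K V" "module K W" "f \<in> module_hom K V W"
  shows "f \<zero>\<^bsub>V\<^esub> = \<zero>\<^bsub>W\<^esub>"
proof -
  interpret mod_hom K V W f using assms by (simp add: mod_hom_def mod_hom_axioms_def)
  show ?thesis by (rule f0_is_0)
qed

lemma module_hom_minus:
  assumes "module K V" "module K W" "f \<in> module_hom K V W" "x \<in> carrier V" "y \<in> carrier V"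
  shows "f (x \<ominus>\<^bsub>V\<^esub> y) = f x \<ominus>\<^bsub>W\<^esub> f y"
proof -
  interpret mod_hom K V W f using assms by (simp add: mod_hom_def mod_hom_axioms_def)
  show ?thesis using assms by simp
qed

lemma module_hom_finsum:
  assumes "module K V" "module K W" "f \<in> module_hom K V W" "g \<in> I \<rightarrow> carrier V"
  shows "f (\<Oplus>\<^bsub>V\<^esub>i\<in>I. g i) = (\<Oplus>\<^bsub>W\<^esub>i\<in>I. f (g i))"
  using assms(4)
proof (induction I rule: infinite_finite_induct)
  case (infinite I)
  interpret V: module K V by fact
  interpret W: module K W by fact
  show ?case using infinite module_hom_zero[OF assms(1-3)] by simp
next
  case empty
  interpret V: module K V by fact
  interpret W: module K W by fact
  show ?case using module_hom_zero[OF assms(1-3)] by simp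
next
  case (insert i I)
  interpret V: module K V by fact
  interpret W: module K W by fact
  have g: "g \<in> I \<rightarrow> carrier V" "g i \<in> carrier V" using insert.prems by auto
  have fg: "(\<lambda>i. f (g i)) \<in> I \<rightarrow> carrier W" "f (g i) \<in> carrier W"
    using g module_hom_mem[OF assms(3)] by auto
  have s: "(\<Oplus>\<^bsub>V\<^esub>i\<in>I. g i) \<in> carrier V" using g by (simp add: V.finsum_closed)
  have "f (g i \<oplus>\<^bsub>V\<^esub> (\<Oplus>\<^bsub>V\<^esub>i\<in>I. g i)) = f (g i) \<oplus>\<^bsub>W\<^esub> f (\<Oplus>\<^bsub>V\<^esub>i\<in>I. g i)"
    using module_hom_add[OF assms(3) g(2) s] .
  then show ?case
    using insert g fg by (simp add: V.finsum_insert W.finsum_insert)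
qed

lemma ker_submodule:
  assumes "module K V" "module K W" "f \<in> module_hom K V W"
  shows "submodule K {x \<in> carrier V. f x = \<zero>\<^bsub>W\<^esub>} V"
proof -
  interpret mod_hom K V W f using assms by (simp add: mod_hom_def mod_hom_axioms_def)
  show ?thesis using ker_is_submodule by (simp add: ker_def)
qed

lemma vimage_submodule:
  assumes "module K V" "module K W" "f \<in> module_hom K V W" "submodule K N W"
  shows "submodule K {x \<in> carrier V. f x \<in> N} V"
proof -
  interpret V: module K V by fact
  interpret N: submodule K N W by fact
  show ?thesis
    using assms(3) module_hom_zero[OF assms(1-3)]
    by unfold_locales (auto simp: module_hom_add[OF assms(3)] module_hom_smult[OF assms(3)] module_hom_mem[OF assms(3)])
qed

lemma submodule_finsum_closed:
  assumes "submodule K N V" "g \<in> I \<rightarrow> N"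
  shows "(\<Oplus>\<^bsub>V\<^esub>i\<in>I. g i) \<in> N"
proof -
  interpret N: submodule K N V by fact
  interpret V: module K V by (rule N.module)
  show ?thesis using assms(2)
  proof (induction I rule: infinite_finite_induct)
    case (insert i I)
    then have "g \<in> I \<rightarrow> carrier V" "g i \<in> carrier V" using N.subset by auto
    with insert show ?case by (simp add: V.finsum_insert Pi_def)
  qed auto
qed

lemma lin_End_simps [simp]:
  "carrier (lin_End K V) = module_hom K V V \<inter> extensional (carrier V)"
  "\<zero>\<^bsub>lin_End K V\<^esub> = (\<lambda>x\<in>carrier V. \<zero>\<^bsub>V\<^esub>)"
  "f \<oplus>\<^bsub>lin_End K V\<^esub> g = (\<lambda>x\<in>carrier V. f x \<oplus>\<^bsub>V\<^esub> g x)"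
  "c \<odot>\<^bsub>lin_End K V\<^esub> f = (\<lambda>x\<in>carrier V. c \<odot>\<^bsub>V\<^esub> f x)"
  by (simp_all add: lin_End_def)

lemma lin_End_eqI:
  assumes "f \<in> carrier (lin_End K V)" "g \<in> carrier (lin_End K V)"
    and "\<And>x. x \<in> carrier V \<Longrightarrow> f x = g x"
  shows "f = g"
  using assms by (auto intro: extensionalityI)

lemma lin_End_restrict:
  assumes "module K V" "f \<in> module_hom K V V"
  shows "restrict f (carrier V) \<in> carrier (lin_End K V)"
proof -
  interpret V: module K V by fact
  show ?thesis using assms(2) by (auto simp: module_hom_def)
qed

lemma lin_End_vectorspace:
  assumes "vectorspace K V"
  shows "vectorspace K (lin_End K V)"
proof -
  interpret V: vectorspace K V by fact
  have lin: "f (x \<oplus>\<^bsub>V\<^esub> y) = f x \<oplus>\<^bsub>V\<^esub> f y" "f (c \<odot>\<^bsub>V\<^esub> x) = c \<odot>\<^bsub>V\<^esub> f x"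
    if "f \<in> carrier (lin_End K V)" "x \<in> carrier V" "y \<in> carrier V" "c \<in> carrier K" for f x y c
    using that by (auto simp: module_hom_def)
  have hom: "f x \<in> carrier V" if "f \<in> carrier (lin_End K V)" "x \<in> carrier V" for f x
    using that by (auto simp: module_hom_mem)
  have res: "(\<lambda>x\<in>carrier V. h x) \<in> carrier (lin_End K V)" if "h \<in> module_hom K V V" for h
    using lin_End_restrict[OF V.module_axioms that] .
  show ?thesis
  proof (rule vs_criteria; (intro allI impI ballI; (elim conjE)?)?)
    show "field K" ..
    show "\<zero>\<^bsub>lin_End K V\<^esub> \<in> carrier (lin_End K V)"
      using res[of "\<lambda>_. \<zero>\<^bsub>V\<^esub>"] by (simp add: module_hom_def)
  next
    fix f g assume f: "f \<in> carrier (lin_End K V)" and g: "g \<in> carrier (lin_End K V)"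
    have "(\<lambda>x. f x \<oplus>\<^bsub>V\<^esub> g x) \<in> module_hom K V V"
      using hom[OF f] hom[OF g]
      by (intro module_homI) (simp_all add: lin[OF f _ _ V.R.zero_closed] lin[OF g _ _ V.R.zero_closed] lin(2)[OF f _ V.M.zero_closed] lin(2)[OF g _ V.M.zero_closed] V.smult_r_distr V.M.a_ac)
    from res[OF this] show "f \<oplus>\<^bsub>lin_End K V\<^esub> g \<in> carrier (lin_End K V)" by simp
    show "f \<oplus>\<^bsub>lin_End K V\<^esub> g = g \<oplus>\<^bsub>lin_End K V\<^esub> f"
      using hom[OF f] hom[OF g] by (auto simp: V.M.a_ac)
  next
    fix f assume f: "f \<in> carrier (lin_End K V)"
    have "(\<lambda>x. \<ominus>\<^bsub>V\<^esub> f x) \<in> module_hom K V V"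
      using hom[OF f]
      by (intro module_homI) (simp_all add: lin[OF f _ _ V.R.zero_closed] lin(2)[OF f _ V.M.zero_closed] V.M.minus_add V.smult_r_minus V.M.a_ac)
    from res[OF this]
    show "\<exists>g\<in>carrier (lin_End K V). f \<oplus>\<^bsub>lin_End K V\<^esub> g = \<zero>\<^bsub>lin_End K V\<^esub>"
      using hom[OF f] by (intro bexI[of _ "\<lambda>x\<in>carrier V. \<ominus>\<^bsub>V\<^esub> f x"]) (auto simp: V.M.r_neg)
    show "f \<oplus>\<^bsub>lin_End K V\<^esub> \<zero>\<^bsub>lin_End K V\<^esub> = f"
      using hom[OF f] f by (auto simp: extensional_def)
    show "\<one>\<^bsub>K\<^esub> \<odot>\<^bsub>lin_End K V\<^esub> f = f"
      using hom[OF f] f by (auto simp: extensional_def)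
  next
    fix c f assume c: "c \<in> carrier K" and f: "f \<in> carrier (lin_End K V)"
    have "c \<odot>\<^bsub>V\<^esub> (a \<odot>\<^bsub>V\<^esub> x) = a \<odot>\<^bsub>V\<^esub> (c \<odot>\<^bsub>V\<^esub> x)" if "a \<in> carrier K" "x \<in> carrier V" for a x
      using that c by (metis V.smult_assoc1 V.m_comm)
    then have "(\<lambda>x. c \<odot>\<^bsub>V\<^esub> f x) \<in> module_hom K V V"
      using c hom[OF f]
      by (intro module_homI) (simp_all add: lin[OF f _ _ V.R.zero_closed] lin(2)[OF f _ V.M.zero_closed] V.smult_r_distr)
    from res[OF this] show "c \<odot>\<^bsub>lin_End K V\<^esub> f \<in> carrier (lin_End K V)" by simp
  next
    fix f g h
    assume "f \<in> carrier (lin_End K V)" "g \<in> carrier (lin_End K V)" "h \<in> carrier (lin_End K V)"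
    note fgh = this[THEN hom]
    show "f \<oplus>\<^bsub>lin_End K V\<^esub> g \<oplus>\<^bsub>lin_End K V\<^esub> h = f \<oplus>\<^bsub>lin_End K V\<^esub> (g \<oplus>\<^bsub>lin_End K V\<^esub> h)"
      using fgh by (auto simp: V.M.a_ac)
  next
    fix a b f assume ab: "a \<in> carrier K" "b \<in> carrier K" and f: "f \<in> carrier (lin_End K V)"
    show "(a \<otimes>\<^bsub>K\<^esub> b) \<odot>\<^bsub>lin_End K V\<^esub> f = a \<odot>\<^bsub>lin_End K V\<^esub> (b \<odot>\<^bsub>lin_End K V\<^esub> f)"
      using ab hom[OF f] by (auto simp: V.smult_assoc1)
    show "(a \<oplus>\<^bsub>K\<^esub> b) \<odot>\<^bsub>lin_End K V\<^esub> f = a \<odot>\<^bsub>lin_End K V\<^esub> f \<oplus>\<^bsub>lin_End K V\<^esub> b \<odot>\<^bsub>lin_End K V\<^esub> f"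
      using ab hom[OF f] by (auto simp: V.smult_l_distr)
  next
    fix a f g assume a: "a \<in> carrier K" and f: "f \<in> carrier (lin_End K V)" and g: "g \<in> carrier (lin_End K V)"
    show "a \<odot>\<^bsub>lin_End K V\<^esub> (f \<oplus>\<^bsub>lin_End K V\<^esub> g) = a \<odot>\<^bsub>lin_End K V\<^esub> f \<oplus>\<^bsub>lin_End K V\<^esub> a \<odot>\<^bsub>lin_End K V\<^esub> g"
      using a hom[OF f] hom[OF g] by (auto simp: V.smult_r_distr)
  qed
qed

lemma lin_End_eval_hom:
  assumes "module K V" "x \<in> carrier V"
  shows "(\<lambda>f. f x) \<in> module_hom K (lin_End K V) V"
  using assms by (auto simp: module_hom_def)

lemma lin_End_finsum_apply:
  assumes "vectorspace K V" "f \<in> I \<rightarrow> carrier (lin_End K V)" "x \<in> carrier V"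
  shows "(\<Oplus>\<^bsub>lin_End K V\<^esub>i\<in>I. f i) x = (\<Oplus>\<^bsub>V\<^esub>i\<in>I. f i x)"
  by (rule module_hom_finsum[OF _ _ lin_End_eval_hom])
    (use assms in \<open>auto intro: vectorspace_module lin_End_vectorspace\<close>)

section \<open>Quotient spaces\<close>

lemma submodule_abelian_subgroup:
  assumes "submodule K N V"
  shows "abelian_subgroup N V"
proof -
  interpret N: submodule K N V by fact
  interpret V: module K V by (rule N.module)
  have "\<ominus>\<^bsub>V\<^esub> x \<in> N" if "x \<in> N" for x
    using N.smult_closed[of "\<ominus>\<^bsub>K\<^esub> \<one>\<^bsub>K\<^esub>" x] that N.subset V.smult_minus_1[of x]
      V.R.a_inv_closed[OF V.R.one_closed] by fastforce
  then have "subgroup N (add_monoid V)"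
    using N.subset by (intro V.add.subgroupI) (auto simp: a_inv_def[symmetric] intro: N.zero_closed)
  then show ?thesis
    by (intro abelian_subgroupI3) (auto simp: additive_subgroup_def V.abelian_group_axioms)
qed

context
  fixes K V N
  assumes vsp: "vectorspace K V" and sub: "submodule K N V"
begin

interpretation V: vectorspace K V by (rule vsp)
interpretation N: submodule K N V by (rule sub)
interpretation NS: abelian_subgroup N V by (rule submodule_abelian_subgroup[OF sub])

lemma quotient_carrier: "carrier (quotient_space K V N) = (\<lambda>x. N +>\<^bsub>V\<^esub> x) ` carrier V"
  by (auto simp: quotient_space_def A_RCOSETS_def RCOSETS_def a_r_coset_def)

lemma quotient_add:
  "\<lbrakk>x \<in> carrier V; y \<in> carrier V\<rbrakk> \<Longrightarrow>
    (N +>\<^bsub>V\<^esub> x) \<oplus>\<^bsub>quotient_space K V N\<^esub> (N +>\<^bsub>V\<^esub> y) = N +>\<^bsub>V\<^esub> (x \<oplus>\<^bsub>V\<^esub> y)"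
  by (simp add: quotient_space_def NS.a_rcos_sum)

lemma quotient_eq_iff:
  assumes "x \<in> carrier V" "y \<in> carrier V"
  shows "N +>\<^bsub>V\<^esub> x = N +>\<^bsub>V\<^esub> y \<longleftrightarrow> x \<ominus>\<^bsub>V\<^esub> y \<in> N"
  using assms NS.a_repr_independence' NS.a_repr_independenceD NS.a_rcos_module
  by (metis V.M.minus_eq)

text \<open>Scaling a coset elementwise by \<open>0\<close> collapses it to a point, so the scalar multiple is a union of
  cosets; since \<open>N\<close> is closed under scalars, this union consists of a single coset.\<close>

lemma quotient_smult:
  assumes c: "c \<in> carrier K" and x: "x \<in> carrier V"
  shows "c \<odot>\<^bsub>quotient_space K V N\<^esub> (N +>\<^bsub>V\<^esub> x) = N +>\<^bsub>V\<^esub> (c \<odot>\<^bsub>V\<^esub> x)"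
proof -
  have "N +>\<^bsub>V\<^esub> (c \<odot>\<^bsub>V\<^esub> y) = N +>\<^bsub>V\<^esub> (c \<odot>\<^bsub>V\<^esub> x)" if "y \<in> N +>\<^bsub>V\<^esub> x" for y
  proof -
    have y: "y \<in> carrier V" using that x NS.a_elemrcos_carrier by blast
    have "y \<ominus>\<^bsub>V\<^esub> x \<in> N" using that x y NS.a_rcos_module by (simp add: V.M.minus_eq)
    then have "c \<odot>\<^bsub>V\<^esub> (y \<ominus>\<^bsub>V\<^esub> x) \<in> N" using c by simp
    also have "c \<odot>\<^bsub>V\<^esub> (y \<ominus>\<^bsub>V\<^esub> x) = c \<odot>\<^bsub>V\<^esub> y \<ominus>\<^bsub>V\<^esub> c \<odot>\<^bsub>V\<^esub> x"
      using c x y by (simp add: V.M.minus_eq V.smult_r_distr V.smult_r_minus)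
    finally show ?thesis using c x y by (simp add: quotient_eq_iff)
  qed
  moreover have "x \<in> N +>\<^bsub>V\<^esub> x" using x by (rule NS.a_rcos_self)
  ultimately have "(\<Union>y\<in>N +>\<^bsub>V\<^esub> x. N +>\<^bsub>V\<^esub> (c \<odot>\<^bsub>V\<^esub> y)) = N +>\<^bsub>V\<^esub> (c \<odot>\<^bsub>V\<^esub> x)"
    by (intro SUP_eq_const) blast+
  then show ?thesis by (simp add: quotient_space_def)
qed

lemma quotient_zero: "\<zero>\<^bsub>quotient_space K V N\<^esub> = N +>\<^bsub>V\<^esub> \<zero>\<^bsub>V\<^esub>"
  by (simp add: quotient_space_def NS.a_subset)

lemma quotient_vectorspace: "vectorspace K (quotient_space K V N)"
proof (rule vs_criteria; (intro allI impI ballI; (elim conjE)?)?)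
  let ?Q = "quotient_space K V N"
  show "field K" ..
  fix u assume "u \<in> carrier ?Q"
  then obtain x where x: "x \<in> carrier V" "u = N +>\<^bsub>V\<^esub> x" by (auto simp: quotient_carrier)
  show "\<exists>v\<in>carrier ?Q. u \<oplus>\<^bsub>?Q\<^esub> v = \<zero>\<^bsub>?Q\<^esub>"
    using x by (intro bexI[of _ "N +>\<^bsub>V\<^esub> (\<ominus>\<^bsub>V\<^esub> x)"])
      (auto simp: quotient_carrier quotient_add quotient_zero V.M.r_neg)
qed (auto simp: quotient_carrier quotient_add quotient_smult quotient_zero V.M.a_ac V.smult_assoc1
      V.smult_l_distr V.smult_r_distr V.M.r_neg)+

lemma quotient_proj_hom: "(\<lambda>x. N +>\<^bsub>V\<^esub> x) \<in> module_hom K V (quotient_space K V N)"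
  by (intro module_homI) (auto simp: quotient_carrier quotient_add quotient_smult)

lemma quotient_mem_iff:
  assumes "x \<in> carrier V"
  shows "y \<in> N +>\<^bsub>V\<^esub> x \<longleftrightarrow> y \<in> carrier V \<and> y \<ominus>\<^bsub>V\<^esub> x \<in> N"
  using assms NS.a_elemrcos_carrier NS.a_rcos_module by (metis V.M.minus_eq)

end

section \<open>Free spaces\<close>

context
  fixes K :: "('k, 'm) ring_scheme" and X :: "'x set"
  assumes K: "field K"
begin

interpretation K: field K by (rule K)

lemma free_space_simps [simp]:
  "carrier (free_space K X) = {f \<in> X \<rightarrow>\<^sub>E carrier K. finite {x \<in> X. f x \<noteq> \<zero>\<^bsub>K\<^esub>}}"
  "\<zero>\<^bsub>free_space K X\<^esub> = (\<lambda>x\<in>X. \<zero>\<^bsub>K\<^esub>)"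
  "f \<oplus>\<^bsub>free_space K X\<^esub> g = (\<lambda>x\<in>X. f x \<oplus>\<^bsub>K\<^esub> g x)"
  "c \<odot>\<^bsub>free_space K X\<^esub> f = (\<lambda>x\<in>X. c \<otimes>\<^bsub>K\<^esub> f x)"
  by (simp_all add: free_space_def K.func_space_def)

lemma free_space_vectorspace: "vectorspace K (free_space K X)"
proof -
  interpret F: module K "K.func_space X" by (rule K.func_space_is_module)
  have "submodule K {f \<in> X \<rightarrow>\<^sub>E carrier K. finite {x \<in> X. f x \<noteq> \<zero>\<^bsub>K\<^esub>}} (K.func_space X)"
  proof
    fix f g assume f: "f \<in> {f \<in> X \<rightarrow>\<^sub>E carrier K. finite {x \<in> X. f x \<noteq> \<zero>\<^bsub>K\<^esub>}}"
      and g: "g \<in> {f \<in> X \<rightarrow>\<^sub>E carrier K. finite {x \<in> X. f x \<noteq> \<zero>\<^bsub>K\<^esub>}}"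
    have "{x \<in> X. f x \<oplus>\<^bsub>K\<^esub> g x \<noteq> \<zero>\<^bsub>K\<^esub>} \<subseteq> {x \<in> X. f x \<noteq> \<zero>\<^bsub>K\<^esub>} \<union> {x \<in> X. g x \<noteq> \<zero>\<^bsub>K\<^esub>}"
      by auto
    then have "finite {x \<in> X. f x \<oplus>\<^bsub>K\<^esub> g x \<noteq> \<zero>\<^bsub>K\<^esub>}"
      using f g by (auto dest: finite_subset)
    then show "f \<oplus>\<^bsub>K.func_space X\<^esub> g \<in> {f \<in> X \<rightarrow>\<^sub>E carrier K. finite {x \<in> X. f x \<noteq> \<zero>\<^bsub>K\<^esub>}}"
      using f g by (auto simp: K.func_space_def PiE_mem cong: conj_cong)
  next
    fix c f assume c: "c \<in> carrier K"
      and f: "f \<in> {f \<in> X \<rightarrow>\<^sub>E carrier K. finite {x \<in> X. f x \<noteq> \<zero>\<^bsub>K\<^esub>}}"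
    have "{x \<in> X. c \<otimes>\<^bsub>K\<^esub> f x \<noteq> \<zero>\<^bsub>K\<^esub>} \<subseteq> {x \<in> X. f x \<noteq> \<zero>\<^bsub>K\<^esub>}"
      using c by auto
    then have "finite {x \<in> X. c \<otimes>\<^bsub>K\<^esub> f x \<noteq> \<zero>\<^bsub>K\<^esub>}"
      using f by (auto dest: finite_subset)
    then show "c \<odot>\<^bsub>K.func_space X\<^esub> f \<in> {f \<in> X \<rightarrow>\<^sub>E carrier K. finite {x \<in> X. f x \<noteq> \<zero>\<^bsub>K\<^esub>}}"
      using c f by (auto simp: K.func_space_def PiE_mem cong: conj_cong)
  qed (auto simp: K.func_space_def)
  from F.submodule_is_module[OF this] show ?thesis
    using K by (simp add: vectorspace_def free_space_def)
qed

interpretation F: vectorspace K "free_space K X" by (rule free_space_vectorspace)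

lemma free_gen_mem [simp]: "x \<in> X \<Longrightarrow> free_gen K X x \<in> carrier (free_space K X)"
proof -
  assume "x \<in> X"
  have "{y \<in> X. (if y = x then \<one>\<^bsub>K\<^esub> else \<zero>\<^bsub>K\<^esub>) \<noteq> \<zero>\<^bsub>K\<^esub>} \<subseteq> {x}" by auto
  then have "finite {y \<in> X. (if y = x then \<one>\<^bsub>K\<^esub> else \<zero>\<^bsub>K\<^esub>) \<noteq> \<zero>\<^bsub>K\<^esub>}"
    by (rule finite_subset) simp
  then show ?thesis by (simp add: free_gen_def cong: conj_cong)
qed

text \<open>Functions of finite support are the linear combinations of the generators; peeling off one point
  of the support at a time shows that the generators span.\<close>

lemma free_space_induct:
  assumes N: "submodule K N (free_space K X)" and gen: "\<And>x. x \<in> X \<Longrightarrow> free_gen K X x \<in> N"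
    and f: "f \<in> carrier (free_space K X)"
  shows "f \<in> N"
proof -
  interpret N: submodule K N "free_space K X" by (rule N)
  have "\<forall>f. f \<in> carrier (free_space K X) \<longrightarrow> {x \<in> X. f x \<noteq> \<zero>\<^bsub>K\<^esub>} = S \<longrightarrow> f \<in> N" if "finite S" for S
    using that
  proof (induction S rule: finite_induct)
    case empty
    show ?case
    proof (intro allI impI)
      fix f assume "f \<in> carrier (free_space K X)" "{x \<in> X. f x \<noteq> \<zero>\<^bsub>K\<^esub>} = {}"
      then have "f = \<zero>\<^bsub>free_space K X\<^esub>" by (auto intro!: extensionalityI[of _ X] simp: PiE_def)
      then show "f \<in> N" by (metis N.zero_closed)
    qed
  next
    case (insert s S)
    show ?case
    proof (intro allI impI)
      fix f assume f: "f \<in> carrier (free_space K X)" and supp: "{x \<in> X. f x \<noteq> \<zero>\<^bsub>K\<^esub>} = insert s S"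
      have s: "s \<in> X" using supp by auto
      define g where "g = (\<lambda>x\<in>X. if x = s then \<zero>\<^bsub>K\<^esub> else f x)"
      have supp_g: "{x \<in> X. g x \<noteq> \<zero>\<^bsub>K\<^esub>} = S" using supp insert.hyps by (auto simp: g_def)
      moreover have g: "g \<in> carrier (free_space K X)"
        using f supp_g[symmetric] insert.hyps(1) by (auto simp: g_def PiE_mem)
      ultimately have "g \<in> N" using insert.IH by blast
      moreover have fs: "f s \<in> carrier K" using f s by auto
      then have "f s \<odot>\<^bsub>free_space K X\<^esub> free_gen K X s \<in> N"
        using gen[OF s] N.smult_closed by blast
      ultimately have "g \<oplus>\<^bsub>free_space K X\<^esub> (f s \<odot>\<^bsub>free_space K X\<^esub> free_gen K X s) \<in> N"
        by (rule N.m_closed)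
      also have "g \<oplus>\<^bsub>free_space K X\<^esub> (f s \<odot>\<^bsub>free_space K X\<^esub> free_gen K X s) = f"
      proof (rule extensionalityI[of _ X])
        fix x assume "x \<in> X"
        moreover from this have "f x \<in> carrier K" using f by auto
        ultimately show "(g \<oplus>\<^bsub>free_space K X\<^esub> (f s \<odot>\<^bsub>free_space K X\<^esub> free_gen K X s)) x = f x"
          using f s fs by (auto simp: g_def free_gen_def)
      qed (use f in \<open>auto simp: PiE_def\<close>)
      finally show "f \<in> N" .
    qed
  qed
  then show ?thesis using f by auto
qed

end

text \<open>The linear extension of \<open>\<beta>\<close> from the generators to the free space. It is the sum that
  \<^const>\<open>tensor_lift\<close> evaluates on a representative.\<close>

definition free_lift where
  "free_lift K X U \<beta> f = (\<Oplus>\<^bsub>U\<^esub>p \<in> {p \<in> X. f p \<noteq> \<zero>\<^bsub>K\<^esub>}. f p \<odot>\<^bsub>U\<^esub> \<beta> p)"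

context
  fixes K :: "('k, 'm) ring_scheme" and U :: "('k, 'u, 'n) module_scheme"
    and X :: "'x set" and \<beta> :: "'x \<Rightarrow> 'u"
  assumes U: "vectorspace K U" and \<beta>: "\<beta> \<in> X \<rightarrow> carrier U"
begin

interpretation U: vectorspace K U by (rule U)

text \<open>Additivity compares sums over three different supports; they can be added only over a common
  finite index set.\<close>

lemma free_lift_superset:
  assumes f: "f \<in> X \<rightarrow> carrier K" and S: "finite S" "{p \<in> X. f p \<noteq> \<zero>\<^bsub>K\<^esub>} \<subseteq> S" "S \<subseteq> X"
  shows "free_lift K X U \<beta> f = (\<Oplus>\<^bsub>U\<^esub>p\<in>S. f p \<odot>\<^bsub>U\<^esub> \<beta> p)"
proof -
  have *: "f p \<odot>\<^bsub>U\<^esub> \<beta> p \<in> carrier U" if "p \<in> X" for p using f \<beta> that by auto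
  have "(\<Oplus>\<^bsub>U\<^esub>p\<in>S. f p \<odot>\<^bsub>U\<^esub> \<beta> p) =
     (\<Oplus>\<^bsub>U\<^esub>p\<in>S. if p \<in> {p \<in> X. f p \<noteq> \<zero>\<^bsub>K\<^esub>} then f p \<odot>\<^bsub>U\<^esub> \<beta> p else \<zero>\<^bsub>U\<^esub>)"
    using S \<beta> f by (intro U.M.finsum_cong') (auto simp: subset_iff Pi_iff)
  also have "\<dots> = free_lift K X U \<beta> f"
    unfolding free_lift_def using S * by (intro U.M.extend_sum) auto
  finally show ?thesis by simp
qed

lemma free_lift_hom: "free_lift K X U \<beta> \<in> module_hom K (free_space K X) U"
proof (rule module_homI)
  note fs = free_space_simps[OF U.field_axioms]
  show "free_lift K X U \<beta> f \<in> carrier U" if "f \<in> carrier (free_space K X)" for f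
    unfolding free_lift_def using that \<beta> by (intro U.M.finsum_closed) (auto simp: fs PiE_mem)
  fix f g assume f: "f \<in> carrier (free_space K X)" and g: "g \<in> carrier (free_space K X)"
  let ?S = "{p \<in> X. f p \<noteq> \<zero>\<^bsub>K\<^esub>} \<union> {p \<in> X. g p \<noteq> \<zero>\<^bsub>K\<^esub>}"
  have S: "finite ?S" "?S \<subseteq> X" using f g by (auto simp: fs)
  have fin: "f p \<in> carrier K" "g p \<in> carrier K" "\<beta> p \<in> carrier U" if "p \<in> X" for p
    using that f g \<beta> by (auto simp: fs PiE_mem)
  have "free_lift K X U \<beta> (f \<oplus>\<^bsub>free_space K X\<^esub> g) = (\<Oplus>\<^bsub>U\<^esub>p\<in>?S. (f \<oplus>\<^bsub>free_space K X\<^esub> g) p \<odot>\<^bsub>U\<^esub> \<beta> p)"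
    using S fin by (intro free_lift_superset) (auto simp: fs)
  also have "\<dots> = (\<Oplus>\<^bsub>U\<^esub>p\<in>?S. f p \<odot>\<^bsub>U\<^esub> \<beta> p \<oplus>\<^bsub>U\<^esub> g p \<odot>\<^bsub>U\<^esub> \<beta> p)"
    using S fin by (intro U.M.finsum_cong') (auto simp: fs U.smult_l_distr)
  also have "\<dots> = (\<Oplus>\<^bsub>U\<^esub>p\<in>?S. f p \<odot>\<^bsub>U\<^esub> \<beta> p) \<oplus>\<^bsub>U\<^esub> (\<Oplus>\<^bsub>U\<^esub>p\<in>?S. g p \<odot>\<^bsub>U\<^esub> \<beta> p)"
    using S fin by (intro U.M.finsum_addf) auto
  also have "(\<Oplus>\<^bsub>U\<^esub>p\<in>?S. f p \<odot>\<^bsub>U\<^esub> \<beta> p) = free_lift K X U \<beta> f"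
    using S fin by (intro free_lift_superset[symmetric]) auto
  also have "(\<Oplus>\<^bsub>U\<^esub>p\<in>?S. g p \<odot>\<^bsub>U\<^esub> \<beta> p) = free_lift K X U \<beta> g"
    using S fin by (intro free_lift_superset[symmetric]) auto
  finally show "free_lift K X U \<beta> (f \<oplus>\<^bsub>free_space K X\<^esub> g) = free_lift K X U \<beta> f \<oplus>\<^bsub>U\<^esub> free_lift K X U \<beta> g" .
next
  note fs = free_space_simps[OF U.field_axioms]
  fix c f assume c: "c \<in> carrier K" and f: "f \<in> carrier (free_space K X)"
  let ?S = "{p \<in> X. f p \<noteq> \<zero>\<^bsub>K\<^esub>}"
  have S: "finite ?S" "?S \<subseteq> X" using f by (auto simp: fs)
  have fin: "f p \<in> carrier K" "\<beta> p \<in> carrier U" if "p \<in> X" for p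
    using that f \<beta> by (auto simp: fs PiE_mem)
  have "free_lift K X U \<beta> (c \<odot>\<^bsub>free_space K X\<^esub> f) = (\<Oplus>\<^bsub>U\<^esub>p\<in>?S. (c \<odot>\<^bsub>free_space K X\<^esub> f) p \<odot>\<^bsub>U\<^esub> \<beta> p)"
    using S fin c by (intro free_lift_superset) (auto simp: fs)
  also have "\<dots> = (\<Oplus>\<^bsub>U\<^esub>p\<in>?S. c \<odot>\<^bsub>U\<^esub> (f p \<odot>\<^bsub>U\<^esub> \<beta> p))"
    using S fin c by (intro U.M.finsum_cong') (auto simp: fs U.smult_assoc1)
  also have "\<dots> = c \<odot>\<^bsub>U\<^esub> free_lift K X U \<beta> f"
    unfolding free_lift_def using S fin c by (intro U.finsum_smult[symmetric]) auto
  finally show "free_lift K X U \<beta> (c \<odot>\<^bsub>free_space K X\<^esub> f) = c \<odot>\<^bsub>U\<^esub> free_lift K X U \<beta> f" .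
qed

lemma free_lift_gen:
  assumes x: "x \<in> X"
  shows "free_lift K X U \<beta> (free_gen K X x) = \<beta> x"
proof -
  have \<beta>x: "\<beta> x \<in> carrier U" using \<beta> x by auto
  have "free_lift K X U \<beta> (free_gen K X x) = (\<Oplus>\<^bsub>U\<^esub>p\<in>{x}. free_gen K X x p \<odot>\<^bsub>U\<^esub> \<beta> p)"
    using x by (intro free_lift_superset) (auto simp: free_gen_def)
  also have "\<dots> = \<beta> x"
    using x \<beta>x by (simp add: free_gen_def)
  finally show ?thesis .
qed

end

section \<open>The tensor product\<close>

definition bilinear ::
  "('k, 'm) ring_scheme \<Rightarrow> ('k, 'v, 'n) module_scheme \<Rightarrow> ('k, 'w, 'o) module_scheme
    \<Rightarrow> ('k, 'u, 'p) module_scheme \<Rightarrow> ('v \<Rightarrow> 'w \<Rightarrow> 'u) \<Rightarrow> bool" where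
  "bilinear K V W U \<beta> \<longleftrightarrow>
    (\<forall>x\<in>carrier V. \<beta> x \<in> module_hom K W U) \<and> (\<forall>y\<in>carrier W. (\<lambda>x. \<beta> x y) \<in> module_hom K V U)"

lemma bilinearI:
  assumes "\<And>x. x \<in> carrier V \<Longrightarrow> \<beta> x \<in> module_hom K W U"
    and "\<And>y. y \<in> carrier W \<Longrightarrow> (\<lambda>x. \<beta> x y) \<in> module_hom K V U"
  shows "bilinear K V W U \<beta>"
  using assms by (simp add: bilinear_def)

lemma bilinear_right: "bilinear K V W U \<beta> \<Longrightarrow> x \<in> carrier V \<Longrightarrow> \<beta> x \<in> module_hom K W U"
  and bilinear_left: "bilinear K V W U \<beta> \<Longrightarrow> y \<in> carrier W \<Longrightarrow> (\<lambda>x. \<beta> x y) \<in> module_hom K V U"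
  by (simp_all add: bilinear_def)

lemma bilinear_mem:
  "bilinear K V W U \<beta> \<Longrightarrow> x \<in> carrier V \<Longrightarrow> y \<in> carrier W \<Longrightarrow> \<beta> x y \<in> carrier U"
  by (meson bilinear_right module_hom_mem)

locale tensor_pair = V: vectorspace K V + W: vectorspace K W
  for K :: "('k, 'm) ring_scheme" and V :: "('k, 'v, 'n) module_scheme"
    and W :: "('k, 'w, 'o) module_scheme"
begin

text \<open>\<open>V \<otimes> W\<close> is the quotient \<open>T = F / N\<close> of the free space \<open>F\<close> on \<open>X = V \<times> W\<close> by the span \<open>N\<close> of the
  bilinearity relators.\<close>

abbreviation X where "X \<equiv> carrier V \<times> carrier W"
abbreviation F where "F \<equiv> free_space K X"
abbreviation N where "N \<equiv> tensor_kernel K V W"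
abbreviation T where "T \<equiv> tensor_space K V W"
abbreviation pure (infixl \<open>\<otimes>\<^sub>p\<close> 75) where "x \<otimes>\<^sub>p y \<equiv> pure_tensor K V W x y"

sublocale F: vectorspace K F by (rule free_space_vectorspace) (rule V.field_axioms)

lemma gen_mem: "\<lbrakk>x \<in> carrier V; y \<in> carrier W\<rbrakk> \<Longrightarrow> free_gen K X (x, y) \<in> carrier F"
  by (rule free_gen_mem) (auto intro: V.field_axioms)

lemma relators_subset: "tensor_relators K V W \<subseteq> carrier F"
  unfolding tensor_relators_def Let_def
  by (intro Un_least subsetI; elim CollectE exE conjE; hypsubst;
      intro F.M.minus_closed F.M.a_closed F.smult_closed gen_mem) simp_all

lemma kernel_submodule: "submodule K N F"
  unfolding tensor_kernel_def by (rule F.span_is_submodule) (rule relators_subset)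

lemma relator_in_kernel: "r \<in> tensor_relators K V W \<Longrightarrow> r \<in> N"
  unfolding tensor_kernel_def using F.in_own_span[OF relators_subset] by blast

sublocale T: vectorspace K T
  unfolding tensor_space_def by (rule quotient_vectorspace[OF F.vectorspace_axioms kernel_submodule])

lemmas coset_add = quotient_add[OF F.vectorspace_axioms kernel_submodule, folded tensor_space_def]
lemmas coset_smult = quotient_smult[OF F.vectorspace_axioms kernel_submodule, folded tensor_space_def]
lemmas coset_eq = quotient_eq_iff[OF F.vectorspace_axioms kernel_submodule]
lemmas coset_carrier = quotient_carrier[OF F.vectorspace_axioms kernel_submodule, folded tensor_space_def]
lemmas coset_mem = quotient_mem_iff[OF F.vectorspace_axioms kernel_submodule]
lemmas coset_proj = quotient_proj_hom[OF F.vectorspace_axioms kernel_submodule, folded tensor_space_def]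

lemma pure_mem [simp]: "\<lbrakk>x \<in> carrier V; y \<in> carrier W\<rbrakk> \<Longrightarrow> x \<otimes>\<^sub>p y \<in> carrier T"
  unfolding coset_carrier pure_tensor_def by (rule imageI) (rule gen_mem)

lemma pure_add_left:
  assumes "x \<in> carrier V" "x' \<in> carrier V" "y \<in> carrier W"
  shows "(x \<oplus>\<^bsub>V\<^esub> x') \<otimes>\<^sub>p y = x \<otimes>\<^sub>p y \<oplus>\<^bsub>T\<^esub> x' \<otimes>\<^sub>p y"
proof -
  have "free_gen K X (x \<oplus>\<^bsub>V\<^esub> x', y) \<ominus>\<^bsub>F\<^esub> (free_gen K X (x, y) \<oplus>\<^bsub>F\<^esub> free_gen K X (x', y)) \<in> N"
    by (rule relator_in_kernel) (use assms in \<open>unfold tensor_relators_def Let_def, blast\<close>)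
  then show ?thesis
    unfolding pure_tensor_def using assms gen_mem by (simp only: coset_add coset_eq V.M.a_closed F.M.a_closed)
qed

lemma pure_add_right:
  assumes "x \<in> carrier V" "y \<in> carrier W" "y' \<in> carrier W"
  shows "x \<otimes>\<^sub>p (y \<oplus>\<^bsub>W\<^esub> y') = x \<otimes>\<^sub>p y \<oplus>\<^bsub>T\<^esub> x \<otimes>\<^sub>p y'"
proof -
  have "free_gen K X (x, y \<oplus>\<^bsub>W\<^esub> y') \<ominus>\<^bsub>F\<^esub> (free_gen K X (x, y) \<oplus>\<^bsub>F\<^esub> free_gen K X (x, y')) \<in> N"
    by (rule relator_in_kernel) (use assms in \<open>unfold tensor_relators_def Let_def, blast\<close>)
  then show ?thesis
    unfolding pure_tensor_def using assms gen_mem by (simp only: coset_add coset_eq W.M.a_closed F.M.a_closed)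
qed

lemma pure_smult_left:
  assumes "c \<in> carrier K" "x \<in> carrier V" "y \<in> carrier W"
  shows "(c \<odot>\<^bsub>V\<^esub> x) \<otimes>\<^sub>p y = c \<odot>\<^bsub>T\<^esub> (x \<otimes>\<^sub>p y)"
proof -
  have "free_gen K X (c \<odot>\<^bsub>V\<^esub> x, y) \<ominus>\<^bsub>F\<^esub> (c \<odot>\<^bsub>F\<^esub> free_gen K X (x, y)) \<in> N"
    by (rule relator_in_kernel) (use assms in \<open>unfold tensor_relators_def Let_def, blast\<close>)
  then show ?thesis
    unfolding pure_tensor_def using assms gen_mem
    by (simp only: coset_smult coset_eq V.smult_closed F.smult_closed)
qed

lemma pure_smult_right:
  assumes "c \<in> carrier K" "x \<in> carrier V" "y \<in> carrier W"
  shows "x \<otimes>\<^sub>p (c \<odot>\<^bsub>W\<^esub> y) = c \<odot>\<^bsub>T\<^esub> (x \<otimes>\<^sub>p y)"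
proof -
  have "free_gen K X (x, c \<odot>\<^bsub>W\<^esub> y) \<ominus>\<^bsub>F\<^esub> (c \<odot>\<^bsub>F\<^esub> free_gen K X (x, y)) \<in> N"
    by (rule relator_in_kernel) (use assms in \<open>unfold tensor_relators_def Let_def, blast\<close>)
  then show ?thesis
    unfolding pure_tensor_def using assms gen_mem
    by (simp only: coset_smult coset_eq W.smult_closed F.smult_closed)
qed

lemma pure_bilinear: "bilinear K V W T (\<otimes>\<^sub>p)"
  by (intro bilinearI module_homI)
    (simp_all add: pure_add_left pure_add_right pure_smult_left pure_smult_right)

text \<open>The preimage of a subspace of \<open>T\<close> in \<open>F\<close> is a subspace; it contains all generators as soon as
  the given one contains all pure tensors.\<close>

lemma tensor_generated:
  assumes M: "submodule K M T" and pure: "\<And>x y. \<lbrakk>x \<in> carrier V; y \<in> carrier W\<rbrakk> \<Longrightarrow> x \<otimes>\<^sub>p y \<in> M"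
    and t: "t \<in> carrier T"
  shows "t \<in> M"
proof -
  obtain f where f: "f \<in> carrier F" "t = N +>\<^bsub>F\<^esub> f" using t unfolding coset_carrier by blast
  have "submodule K {f \<in> carrier F. N +>\<^bsub>F\<^esub> f \<in> M} F"
    by (rule vimage_submodule[OF F.module_axioms T.module_axioms coset_proj M])
  moreover have "free_gen K X p \<in> {f \<in> carrier F. N +>\<^bsub>F\<^esub> f \<in> M}" if "p \<in> X" for p
    using that gen_mem pure unfolding pure_tensor_def by blast
  ultimately have "f \<in> {f \<in> carrier F. N +>\<^bsub>F\<^esub> f \<in> M}"
    by (rule free_space_induct[OF V.field_axioms _ _ f(1)])
  then show ?thesis using f by simp
qed

lemma tensor_hom_eqI:
  assumes U: "module K U" and f: "f \<in> module_hom K T U" and g: "g \<in> module_hom K T U"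
    and eq: "\<And>x y. \<lbrakk>x \<in> carrier V; y \<in> carrier W\<rbrakk> \<Longrightarrow> f (x \<otimes>\<^sub>p y) = g (x \<otimes>\<^sub>p y)"
    and t: "t \<in> carrier T"
  shows "f t = g t"
proof -
  interpret U: module K U by (rule U)
  have "submodule K {t \<in> carrier T. f t = g t} T"
    by unfold_locales
      (auto simp: module_hom_add[OF f] module_hom_add[OF g] module_hom_smult[OF f] module_hom_smult[OF g]
        module_hom_zero[OF T.module_axioms U f] module_hom_zero[OF T.module_axioms U g])
  from tensor_generated[OF this _ t] eq show ?thesis by auto
qed

subsection \<open>The universal property\<close>

context
  fixes U :: "('k, 'u, 'q) module_scheme" and \<beta> :: "'v \<Rightarrow> 'w \<Rightarrow> 'u"
  assumes U: "vectorspace K U" and \<beta>: "bilinear K V W U \<beta>"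
begin

interpretation U: vectorspace K U by (rule U)

lemma uncurry_mem: "(\<lambda>p. \<beta> (fst p) (snd p)) \<in> X \<rightarrow> carrier U"
  using bilinear_mem[OF \<beta>] by auto

lemmas lift_hom = free_lift_hom[OF U uncurry_mem]
lemmas lift_gen = free_lift_gen[OF U uncurry_mem]

text \<open>Bilinearity of \<open>\<beta>\<close> says precisely that each relator is sent to zero, and the kernel of a linear map
  is a subspace.\<close>

lemma free_lift_kernel:
  assumes "r \<in> N"
  shows "free_lift K X U (\<lambda>p. \<beta> (fst p) (snd p)) r = \<zero>\<^bsub>U\<^esub>"
proof -
  let ?h = "free_lift K X U (\<lambda>p. \<beta> (fst p) (snd p))"
  note h = module_hom_minus[OF F.module_axioms U.module_axioms lift_hom]
    module_hom_add[OF lift_hom] module_hom_smult[OF lift_hom] lift_gen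
  note b = module_hom_add[OF bilinear_right[OF \<beta>]] module_hom_add[OF bilinear_left[OF \<beta>]]
    module_hom_smult[OF bilinear_right[OF \<beta>]] module_hom_smult[OF bilinear_left[OF \<beta>]] bilinear_mem[OF \<beta>]
  have "submodule K {f \<in> carrier F. ?h f = \<zero>\<^bsub>U\<^esub>} F"
    by (rule ker_submodule[OF F.module_axioms U.module_axioms lift_hom])
  moreover have "tensor_relators K V W \<subseteq> {f \<in> carrier F. ?h f = \<zero>\<^bsub>U\<^esub>}"
  proof
    fix r assume r: "r \<in> tensor_relators K V W"
    then have "r \<in> carrier F" using relators_subset by blast
    moreover have "?h r = \<zero>\<^bsub>U\<^esub>"
      using r unfolding tensor_relators_def Let_def
      by (elim UnE CollectE exE conjE)
        (simp_all del: free_space_simps add: gen_mem h b U.M.minus_other_side)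
    ultimately show "r \<in> {f \<in> carrier F. ?h f = \<zero>\<^bsub>U\<^esub>}" by blast
  qed
  ultimately have "N \<subseteq> {f \<in> carrier F. ?h f = \<zero>\<^bsub>U\<^esub>}"
    unfolding tensor_kernel_def by (intro F.span_is_subset)
  then show ?thesis using assms by auto
qed

text \<open>The representative picked by the choice operator differs from \<open>f\<close> by an element of \<open>N\<close>, which
  \<open>free_lift_kernel\<close> makes invisible.\<close>

lemma tensor_lift_coset:
  assumes f: "f \<in> carrier F"
  shows "tensor_lift K V W U \<beta> (N +>\<^bsub>F\<^esub> f) = free_lift K X U (\<lambda>p. \<beta> (fst p) (snd p)) f"
proof -
  let ?h = "free_lift K X U (\<lambda>p. \<beta> (fst p) (snd p))"
  define g where "g = (SOME g. g \<in> N +>\<^bsub>F\<^esub> f)"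
  have "f \<in> N +>\<^bsub>F\<^esub> f"
    unfolding coset_mem[OF f] using f F.M.r_neg[OF f] submodule.zero_closed[OF kernel_submodule]
    by (simp add: F.M.minus_eq del: free_space_simps)
  then have "g \<in> N +>\<^bsub>F\<^esub> f" unfolding g_def by (rule someI[of "\<lambda>g. g \<in> _"])
  then have g: "g \<in> carrier F" "g \<ominus>\<^bsub>F\<^esub> f \<in> N" unfolding coset_mem[OF f] by auto
  have "?h g \<ominus>\<^bsub>U\<^esub> ?h f = \<zero>\<^bsub>U\<^esub>"
    using free_lift_kernel[OF g(2)] module_hom_minus[OF F.module_axioms U.module_axioms lift_hom g(1) f] by simp
  then have "?h g = ?h f"
    using module_hom_mem[OF lift_hom] f g(1) U.M.minus_other_side by blast
  moreover have "N +>\<^bsub>F\<^esub> f \<in> carrier T" using f unfolding coset_carrier by blast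
  ultimately show ?thesis
    by (simp add: tensor_lift_def Let_def g_def[symmetric] free_lift_def)
qed

lemma tensor_lift_hom: "tensor_lift K V W U \<beta> \<in> module_hom K T U"
proof (rule module_homI)
  fix s assume "s \<in> carrier T"
  then obtain f where f: "f \<in> carrier F" "s = N +>\<^bsub>F\<^esub> f" unfolding coset_carrier by blast
  show "tensor_lift K V W U \<beta> s \<in> carrier U"
    unfolding f(2) tensor_lift_coset[OF f(1)] by (rule module_hom_mem[OF lift_hom f(1)])
  fix c assume c: "c \<in> carrier K"
  show "tensor_lift K V W U \<beta> (c \<odot>\<^bsub>T\<^esub> s) = c \<odot>\<^bsub>U\<^esub> tensor_lift K V W U \<beta> s"
    using c f by (simp del: free_space_simps add: coset_smult tensor_lift_coset module_hom_smult[OF lift_hom])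
next
  fix s t assume "s \<in> carrier T" "t \<in> carrier T"
  then obtain f g where f: "f \<in> carrier F" "s = N +>\<^bsub>F\<^esub> f" and g: "g \<in> carrier F" "t = N +>\<^bsub>F\<^esub> g"
    unfolding coset_carrier by blast
  show "tensor_lift K V W U \<beta> (s \<oplus>\<^bsub>T\<^esub> t) = tensor_lift K V W U \<beta> s \<oplus>\<^bsub>U\<^esub> tensor_lift K V W U \<beta> t"
    using f g by (simp del: free_space_simps add: coset_add tensor_lift_coset module_hom_add[OF lift_hom])
qed

lemma tensor_lift_pure [simp]:
  assumes "x \<in> carrier V" "y \<in> carrier W"
  shows "tensor_lift K V W U \<beta> (x \<otimes>\<^sub>p y) = \<beta> x y"
  unfolding pure_tensor_def using assms by (simp add: tensor_lift_coset gen_mem lift_gen del: free_space_simps)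

end

lemma tensor_lift_ext: "tensor_lift K V W U \<beta> \<in> extensional (carrier T)"
  by (simp add: tensor_lift_def)

end

section \<open>Finite sums\<close>

text \<open>Sums indexed by an initial segment of the naturals, with repetitions allowed: unlike linear
  combinations over a set, they keep one summand for each decomposable term of a representation.\<close>

definition finite_sums :: "('u, 'n) ring_scheme \<Rightarrow> 'u set \<Rightarrow> 'u set" where
  "finite_sums U S = {\<Oplus>\<^bsub>U\<^esub>i\<in>{..<n}. s i | (n::nat) s. \<forall>i<n. s i \<in> S}"

context
  fixes K :: "('k, 'm) ring_scheme" and U :: "('k, 'u, 'n) module_scheme" and S :: "'u set"
  assumes U: "module K U" and S: "S \<subseteq> carrier U"
begin

interpretation U: module K U by (rule U)

lemma finite_sums_snoc:
  assumes a: "a \<in> finite_sums U S" and x: "x \<in> S"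
  shows "a \<oplus>\<^bsub>U\<^esub> x \<in> finite_sums U S"
proof -
  obtain n :: nat and s where s: "\<forall>i<n. s i \<in> S" "a = (\<Oplus>\<^bsub>U\<^esub>i\<in>{..<n}. s i)"
    using a by (auto simp: finite_sums_def)
  let ?s = "s(n := x)"
  have sc: "s i \<in> carrier U" if "i < n" for i using s that S by auto
  have xc: "x \<in> carrier U" using x S by auto
  have "(\<Oplus>\<^bsub>U\<^esub>i\<in>{..<Suc n}. ?s i) = x \<oplus>\<^bsub>U\<^esub> (\<Oplus>\<^bsub>U\<^esub>i\<in>{..<n}. ?s i)"
    unfolding lessThan_Suc using sc xc by (subst U.M.finsum_insert) auto
  also have "(\<Oplus>\<^bsub>U\<^esub>i\<in>{..<n}. ?s i) = a"
    unfolding s(2) using sc by (intro U.M.finsum_cong') auto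
  also have "x \<oplus>\<^bsub>U\<^esub> a = a \<oplus>\<^bsub>U\<^esub> x"
    using xc sc unfolding s(2) by (intro U.M.a_comm U.M.finsum_closed) auto
  finally have "a \<oplus>\<^bsub>U\<^esub> x = (\<Oplus>\<^bsub>U\<^esub>i\<in>{..<Suc n}. ?s i)" ..
  moreover have "\<forall>i<Suc n. ?s i \<in> S" using s(1) x by auto
  ultimately show ?thesis unfolding finite_sums_def by blast
qed

lemma finite_sums_closed: "a \<in> finite_sums U S \<Longrightarrow> a \<in> carrier U"
  using S by (force simp: finite_sums_def intro!: U.M.finsum_closed)

lemma finite_sums_zero: "\<zero>\<^bsub>U\<^esub> \<in> finite_sums U S"
  unfolding finite_sums_def by (rule CollectI, rule exI[of _ 0]) simp

lemma finite_sums_incl: "x \<in> S \<Longrightarrow> x \<in> finite_sums U S"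
  using finite_sums_snoc[OF finite_sums_zero, of x] S by auto

lemma finite_sums_add:
  assumes a: "a \<in> finite_sums U S" and b: "b \<in> finite_sums U S"
  shows "a \<oplus>\<^bsub>U\<^esub> b \<in> finite_sums U S"
proof -
  obtain n :: nat and s where s: "\<forall>i<n. s i \<in> S" "b = (\<Oplus>\<^bsub>U\<^esub>i\<in>{..<n}. s i)"
    using b by (auto simp: finite_sums_def)
  have ac: "a \<in> carrier U" using a by (rule finite_sums_closed)
  have "a \<oplus>\<^bsub>U\<^esub> (\<Oplus>\<^bsub>U\<^esub>i\<in>{..<n}. s i) \<in> finite_sums U S" using s(1)
  proof (induction n)
    case 0
    then show ?case using a ac by simp
  next
    case (Suc n)
    have sc: "s i \<in> carrier U" if "i \<le> n" for i using Suc.prems that S by auto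
    let ?t = "\<Oplus>\<^bsub>U\<^esub>i\<in>{..<n}. s i"
    have t: "?t \<in> carrier U" using sc by (intro U.M.finsum_closed) auto
    have "(\<Oplus>\<^bsub>U\<^esub>i\<in>{..<Suc n}. s i) = s n \<oplus>\<^bsub>U\<^esub> ?t"
      unfolding lessThan_Suc using sc by (subst U.M.finsum_insert) auto
    then have "a \<oplus>\<^bsub>U\<^esub> (\<Oplus>\<^bsub>U\<^esub>i\<in>{..<Suc n}. s i) = a \<oplus>\<^bsub>U\<^esub> ?t \<oplus>\<^bsub>U\<^esub> s n"
      using ac t sc[of n] by (simp add: U.M.a_ac)
    moreover have "a \<oplus>\<^bsub>U\<^esub> ?t \<oplus>\<^bsub>U\<^esub> s n \<in> finite_sums U S"
      by (rule finite_sums_snoc) (use Suc in auto)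
    ultimately show ?case by simp
  qed
  then show ?thesis by (simp add: s(2))
qed

lemma finite_sums_finsum:
  assumes "g \<in> I \<rightarrow> S"
  shows "(\<Oplus>\<^bsub>U\<^esub>i\<in>I. g i) \<in> finite_sums U S"
  using assms
proof (induction I rule: infinite_finite_induct)
  case (insert i I)
  then have "g \<in> I \<rightarrow> carrier U" "g i \<in> carrier U" using S by auto
  with insert show ?case by (auto simp: U.M.finsum_insert finite_sums_add finite_sums_incl)
qed (auto simp: finite_sums_zero)

text \<open>When \<open>S\<close> is closed under scalars, the coefficients of a linear combination are absorbed into its
  vectors.\<close>

lemma span_subset_finite_sums:
  assumes smult: "\<And>c x. \<lbrakk>c \<in> carrier K; x \<in> S\<rbrakk> \<Longrightarrow> c \<odot>\<^bsub>U\<^esub> x \<in> S"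
  shows "U.span S \<subseteq> finite_sums U S"
proof
  fix x assume "x \<in> U.span S"
  then obtain a A where A: "A \<subseteq> S" "a \<in> A \<rightarrow> carrier K" "x = U.lincomb a A"
    by (auto simp: U.span_def)
  have "(\<lambda>v. a v \<odot>\<^bsub>U\<^esub> v) \<in> A \<rightarrow> S" using A smult by auto
  then show "x \<in> finite_sums U S" unfolding A(3) U.lincomb_def by (rule finite_sums_finsum)
qed

end

section \<open>Linear functionals\<close>

text \<open>Functionals take values in the ring \<open>K\<close> itself, which carries no module structure in the sense of
  \<^const>\<open>module_hom\<close>.\<close>

definition functional :: "('k, 'm) ring_scheme \<Rightarrow> ('k, 'v, 'n) module_scheme \<Rightarrow> ('v \<Rightarrow> 'k) \<Rightarrow> bool" where
  "functional K V g \<longleftrightarrow> g \<in> carrier V \<rightarrow> carrier K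
    \<and> (\<forall>x\<in>carrier V. \<forall>y\<in>carrier V. g (x \<oplus>\<^bsub>V\<^esub> y) = g x \<oplus>\<^bsub>K\<^esub> g y)
    \<and> (\<forall>c\<in>carrier K. \<forall>x\<in>carrier V. g (c \<odot>\<^bsub>V\<^esub> x) = c \<otimes>\<^bsub>K\<^esub> g x)"

lemma functional_simps:
  assumes "functional K V g"
  shows "x \<in> carrier V \<Longrightarrow> g x \<in> carrier K"
    and "\<lbrakk>x \<in> carrier V; y \<in> carrier V\<rbrakk> \<Longrightarrow> g (x \<oplus>\<^bsub>V\<^esub> y) = g x \<oplus>\<^bsub>K\<^esub> g y"
    and "\<lbrakk>c \<in> carrier K; x \<in> carrier V\<rbrakk> \<Longrightarrow> g (c \<odot>\<^bsub>V\<^esub> x) = c \<otimes>\<^bsub>K\<^esub> g x"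
  using assms by (auto simp: functional_def)

context vectorspace
begin

text \<open>Zorn's lemma applies because the union of a chain of subspaces avoiding \<open>w\<close> is a subspace
  avoiding \<open>w\<close>.\<close>

lemma exists_maximal_submodule_avoiding:
  assumes w: "w \<noteq> \<zero>\<^bsub>V\<^esub>"
  shows "\<exists>M. submodule K M V \<and> w \<notin> M \<and> (\<forall>M'. submodule K M' V \<longrightarrow> w \<notin> M' \<longrightarrow> M \<subseteq> M' \<longrightarrow> M' = M)"
proof -
  let ?A = "{M. submodule K M V \<and> w \<notin> M}"
  have "submodule K {\<zero>\<^bsub>V\<^esub>} V" by unfold_locales auto
  then have "?A \<noteq> {}" using w by blast
  moreover have "\<Union>C \<in> ?A" if C: "C \<noteq> {}" "subset.chain ?A C" for C
  proof -
    have sub: "submodule K M V" "w \<notin> M" if "M \<in> C" for M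
      using C(2) that by (auto simp: subset_chain_def)
    have tot: "M \<subseteq> M' \<or> M' \<subseteq> M" if "M \<in> C" "M' \<in> C" for M M'
      using C(2) that by (simp add: subset_chain_def)
    have "submodule K (\<Union>C) V"
    proof (rule nested_union_vs[of C "\<lambda>M. M"])
      fix M M' assume M: "M \<in> C" "M' \<in> C"
      from tot[OF M] show "\<exists>k. k \<in> C \<and> M \<subseteq> k \<and> M' \<subseteq> k"
        by (elim disjE; intro exI[of _ "if M \<subseteq> M' then M' else M"]) (use M in auto)
    qed (use C(1) sub in simp_all)
    moreover have "w \<notin> \<Union>C" using sub by blast
    ultimately show ?thesis by blast
  qed
  ultimately obtain M where "M \<in> ?A" "\<forall>M'\<in>?A. M \<subseteq> M' \<longrightarrow> M' = M"
    using subset_Zorn_nonempty[of ?A] by blast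
  then show ?thesis by blast
qed

lemma add_line_submodule:
  assumes M: "submodule K M V" and v: "v \<in> carrier V"
  shows "submodule K {m \<oplus>\<^bsub>V\<^esub> a \<odot>\<^bsub>V\<^esub> v | m a. m \<in> M \<and> a \<in> carrier K} V"
proof -
  interpret M: submodule K M V by (rule M)
  have Mc: "m \<in> carrier V" if "m \<in> M" for m using that M.subset by auto
  show ?thesis
  proof
    show "{m \<oplus>\<^bsub>V\<^esub> a \<odot>\<^bsub>V\<^esub> v | m a. m \<in> M \<and> a \<in> carrier K} \<subseteq> carrier V" using Mc v by auto
    have "\<zero>\<^bsub>V\<^esub> = \<zero>\<^bsub>V\<^esub> \<oplus>\<^bsub>V\<^esub> \<zero>\<^bsub>K\<^esub> \<odot>\<^bsub>V\<^esub> v" using v by simp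
    then show "\<zero>\<^bsub>V\<^esub> \<in> {m \<oplus>\<^bsub>V\<^esub> a \<odot>\<^bsub>V\<^esub> v | m a. m \<in> M \<and> a \<in> carrier K}" 
      using M.zero_closed R.zero_closed by blast
  next
    fix x y assume "x \<in> {m \<oplus>\<^bsub>V\<^esub> a \<odot>\<^bsub>V\<^esub> v | m a. m \<in> M \<and> a \<in> carrier K}"
      "y \<in> {m \<oplus>\<^bsub>V\<^esub> a \<odot>\<^bsub>V\<^esub> v | m a. m \<in> M \<and> a \<in> carrier K}"
    then obtain m a m' a' where ma: "m \<in> M" "a \<in> carrier K" "m' \<in> M" "a' \<in> carrier K"
      "x = m \<oplus>\<^bsub>V\<^esub> a \<odot>\<^bsub>V\<^esub> v" "y = m' \<oplus>\<^bsub>V\<^esub> a' \<odot>\<^bsub>V\<^esub> v" by blast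
    then have "x \<oplus>\<^bsub>V\<^esub> y = (m \<oplus>\<^bsub>V\<^esub> m') \<oplus>\<^bsub>V\<^esub> (a \<oplus>\<^bsub>K\<^esub> a') \<odot>\<^bsub>V\<^esub> v"
      using Mc v by (simp add: smult_l_distr M.a_ac)
    then show "x \<oplus>\<^bsub>V\<^esub> y \<in> {m \<oplus>\<^bsub>V\<^esub> a \<odot>\<^bsub>V\<^esub> v | m a. m \<in> M \<and> a \<in> carrier K}"
      using ma M.m_closed R.a_closed by blast
  next
    fix c x assume c: "c \<in> carrier K" and "x \<in> {m \<oplus>\<^bsub>V\<^esub> a \<odot>\<^bsub>V\<^esub> v | m a. m \<in> M \<and> a \<in> carrier K}"
    then obtain m a where ma: "m \<in> M" "a \<in> carrier K" "x = m \<oplus>\<^bsub>V\<^esub> a \<odot>\<^bsub>V\<^esub> v" by blast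
    then have "c \<odot>\<^bsub>V\<^esub> x = c \<odot>\<^bsub>V\<^esub> m \<oplus>\<^bsub>V\<^esub> (c \<otimes>\<^bsub>K\<^esub> a) \<odot>\<^bsub>V\<^esub> v"
      using Mc v c by (simp add: smult_r_distr smult_assoc1)
    then show "c \<odot>\<^bsub>V\<^esub> x \<in> {m \<oplus>\<^bsub>V\<^esub> a \<odot>\<^bsub>V\<^esub> v | m a. m \<in> M \<and> a \<in> carrier K}"
      using ma c M.smult_closed R.m_closed by blast
  qed
qed

text \<open>A maximal subspace avoiding \<open>w\<close> is a complement of the line \<open>K w\<close>; the coordinate along that
  line is the functional.\<close>

lemma functional_nonzero_exists:
  assumes w: "w \<in> carrier V" "w \<noteq> \<zero>\<^bsub>V\<^esub>"
  shows "\<exists>g. functional K V g \<and> g w \<noteq> \<zero>\<^bsub>K\<^esub>"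
proof -
  obtain M where M: "submodule K M V" "w \<notin> M"
    and max: "\<And>M'. \<lbrakk>submodule K M' V; w \<notin> M'; M \<subseteq> M'\<rbrakk> \<Longrightarrow> M' = M"
    using exists_maximal_submodule_avoiding[OF w(2)] by blast
  interpret M: submodule K M V by (rule M)
  have Mc: "m \<in> carrier V" if "m \<in> M" for m using that M.subset by auto
  have neg: "\<ominus>\<^bsub>V\<^esub> m \<in> M" if "m \<in> M" for m
    using smult_minus_1[OF Mc[OF that]] M.smult_closed[OF _ that, of "\<ominus>\<^bsub>K\<^esub> \<one>\<^bsub>K\<^esub>"] by simp
  \<comment> \<open>For \<open>v\<close> outside \<open>M\<close>, maximality puts \<open>w\<close> into \<open>M + K v\<close>; solve that equation for \<open>v\<close>.\<close>
  have ex: "\<exists>c m. c \<in> carrier K \<and> m \<in> M \<and> v = m \<oplus>\<^bsub>V\<^esub> c \<odot>\<^bsub>V\<^esub> w" if v: "v \<in> carrier V" for v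
  proof (cases "v \<in> M")
    case True
    then have "v = v \<oplus>\<^bsub>V\<^esub> \<zero>\<^bsub>K\<^esub> \<odot>\<^bsub>V\<^esub> w" using w v by simp
    then show ?thesis using True R.zero_closed by blast
  next
    case False
    let ?M' = "{m \<oplus>\<^bsub>V\<^esub> a \<odot>\<^bsub>V\<^esub> v | m a. m \<in> M \<and> a \<in> carrier K}"
    have "M \<subseteq> ?M'"
    proof
      fix m assume m: "m \<in> M"
      then have "m = m \<oplus>\<^bsub>V\<^esub> \<zero>\<^bsub>K\<^esub> \<odot>\<^bsub>V\<^esub> v" using v Mc by simp
      then show "m \<in> ?M'" using m R.zero_closed by blast
    qed
    moreover have "v = \<zero>\<^bsub>V\<^esub> \<oplus>\<^bsub>V\<^esub> \<one>\<^bsub>K\<^esub> \<odot>\<^bsub>V\<^esub> v" using v by simp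
    then have "v \<in> ?M'" using M.zero_closed R.one_closed by blast
    ultimately have "w \<in> ?M'" using max[OF add_line_submodule[OF M(1) v]] False by blast
    then obtain m a where ma: "m \<in> M" "a \<in> carrier K" "w = m \<oplus>\<^bsub>V\<^esub> a \<odot>\<^bsub>V\<^esub> v" by blast
    have a: "a \<noteq> \<zero>\<^bsub>K\<^esub>" using ma M(2) v Mc by auto
    then have ia: "inv\<^bsub>K\<^esub> a \<in> carrier K" using ma by simp
    have "a \<odot>\<^bsub>V\<^esub> v = \<ominus>\<^bsub>V\<^esub> m \<oplus>\<^bsub>V\<^esub> w"
      using ma(2,3) v Mc[OF ma(1)] by (simp add: M.a_assoc[symmetric] M.l_neg)
    then have "v = inv\<^bsub>K\<^esub> a \<odot>\<^bsub>V\<^esub> (\<ominus>\<^bsub>V\<^esub> m \<oplus>\<^bsub>V\<^esub> w)"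
      using mult_inverse[OF ma(2) v _ a] by blast
    then have "v = inv\<^bsub>K\<^esub> a \<odot>\<^bsub>V\<^esub> (\<ominus>\<^bsub>V\<^esub> m) \<oplus>\<^bsub>V\<^esub> inv\<^bsub>K\<^esub> a \<odot>\<^bsub>V\<^esub> w"
      using ia w Mc[OF ma(1)] by (simp add: smult_r_distr)
    then show ?thesis using ia M.smult_closed[OF ia neg[OF ma(1)]] by blast
  qed
  \<comment> \<open>Two decompositions with different coefficients would put a multiple of \<open>w\<close> into \<open>M\<close>.\<close>
  have uniq: "c = c'" if eq: "m \<oplus>\<^bsub>V\<^esub> c \<odot>\<^bsub>V\<^esub> w = m' \<oplus>\<^bsub>V\<^esub> c' \<odot>\<^bsub>V\<^esub> w"
    and c: "c \<in> carrier K" "c' \<in> carrier K" and m: "m \<in> M" "m' \<in> M" for c c' m m'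
  proof (rule ccontr)
    assume ne: "c \<noteq> c'"
    let ?d = "c \<ominus>\<^bsub>K\<^esub> c'"
    have d: "?d \<in> carrier K" "?d \<noteq> \<zero>\<^bsub>K\<^esub>" using c ne R.minus_other_side by auto
    have "?d \<odot>\<^bsub>V\<^esub> w = \<ominus>\<^bsub>V\<^esub> m \<oplus>\<^bsub>V\<^esub> (m \<oplus>\<^bsub>V\<^esub> c \<odot>\<^bsub>V\<^esub> w) \<oplus>\<^bsub>V\<^esub> \<ominus>\<^bsub>V\<^esub> (c' \<odot>\<^bsub>V\<^esub> w)"
      using c w Mc[OF m(1)] by (simp add: R.minus_eq smult_l_distr smult_l_minus M.a_assoc[symmetric] M.l_neg)
    also have "\<dots> = \<ominus>\<^bsub>V\<^esub> m \<oplus>\<^bsub>V\<^esub> m'"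
      unfolding eq using c w Mc[OF m(1)] Mc[OF m(2)] by (simp add: M.a_assoc M.r_neg)
    finally have "?d \<odot>\<^bsub>V\<^esub> w = \<ominus>\<^bsub>V\<^esub> m \<oplus>\<^bsub>V\<^esub> m'" .
    then have "w = inv\<^bsub>K\<^esub> ?d \<odot>\<^bsub>V\<^esub> (\<ominus>\<^bsub>V\<^esub> m \<oplus>\<^bsub>V\<^esub> m')"
      using mult_inverse[OF d(1) w(1) _ d(2)] by blast
    moreover have "inv\<^bsub>K\<^esub> ?d \<odot>\<^bsub>V\<^esub> (\<ominus>\<^bsub>V\<^esub> m \<oplus>\<^bsub>V\<^esub> m') \<in> M"
      using d neg[OF m(1)] m by simp
    ultimately show False using M(2) by simp
  qed
  define g where "g v = (THE c. c \<in> carrier K \<and> (\<exists>m\<in>M. v = m \<oplus>\<^bsub>V\<^esub> c \<odot>\<^bsub>V\<^esub> w))" for v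
  have g_eq: "g (m \<oplus>\<^bsub>V\<^esub> c \<odot>\<^bsub>V\<^esub> w) = c" if "c \<in> carrier K" "m \<in> M" for c m
    unfolding g_def
  proof (rule the_equality)
    show "c \<in> carrier K \<and> (\<exists>m'\<in>M. m \<oplus>\<^bsub>V\<^esub> c \<odot>\<^bsub>V\<^esub> w = m' \<oplus>\<^bsub>V\<^esub> c \<odot>\<^bsub>V\<^esub> w)" using that by blast
  qed (use that uniq in blast)
  have "functional K V g" unfolding functional_def
  proof (intro conjI ballI funcsetI)
    fix x assume x: "x \<in> carrier V"
    then obtain c m where cm: "c \<in> carrier K" "m \<in> M" "x = m \<oplus>\<^bsub>V\<^esub> c \<odot>\<^bsub>V\<^esub> w" using ex by blast
    show "g x \<in> carrier K" unfolding cm(3) using cm g_eq by simp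
    fix y assume y: "y \<in> carrier V"
    then obtain c' m' where cm': "c' \<in> carrier K" "m' \<in> M" "y = m' \<oplus>\<^bsub>V\<^esub> c' \<odot>\<^bsub>V\<^esub> w" using ex by blast
    have "x \<oplus>\<^bsub>V\<^esub> y = (m \<oplus>\<^bsub>V\<^esub> m') \<oplus>\<^bsub>V\<^esub> (c \<oplus>\<^bsub>K\<^esub> c') \<odot>\<^bsub>V\<^esub> w"
      unfolding cm(3) cm'(3) using cm cm' Mc w by (simp add: smult_l_distr M.a_ac)
    then have "g (x \<oplus>\<^bsub>V\<^esub> y) = c \<oplus>\<^bsub>K\<^esub> c'" using g_eq[of "c \<oplus>\<^bsub>K\<^esub> c'" "m \<oplus>\<^bsub>V\<^esub> m'"] cm cm' by simp
    then show "g (x \<oplus>\<^bsub>V\<^esub> y) = g x \<oplus>\<^bsub>K\<^esub> g y" unfolding cm(3) cm'(3) using g_eq cm cm' by simp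
  next
    fix a x assume a: "a \<in> carrier K" and x: "x \<in> carrier V"
    then obtain c m where cm: "c \<in> carrier K" "m \<in> M" "x = m \<oplus>\<^bsub>V\<^esub> c \<odot>\<^bsub>V\<^esub> w" using ex by blast
    have "a \<odot>\<^bsub>V\<^esub> x = a \<odot>\<^bsub>V\<^esub> m \<oplus>\<^bsub>V\<^esub> (a \<otimes>\<^bsub>K\<^esub> c) \<odot>\<^bsub>V\<^esub> w"
      unfolding cm(3) using cm Mc w a by (simp add: smult_r_distr smult_assoc1)
    then have "g (a \<odot>\<^bsub>V\<^esub> x) = a \<otimes>\<^bsub>K\<^esub> c" using g_eq[of "a \<otimes>\<^bsub>K\<^esub> c" "a \<odot>\<^bsub>V\<^esub> m"] cm a by simp
    then show "g (a \<odot>\<^bsub>V\<^esub> x) = a \<otimes>\<^bsub>K\<^esub> g x" unfolding cm(3) using g_eq cm by simp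
  qed
  moreover have "g w = \<one>\<^bsub>K\<^esub>" using g_eq[of "\<one>\<^bsub>K\<^esub>" "\<zero>\<^bsub>V\<^esub>"] w by simp
  ultimately show ?thesis by (intro exI[of _ g]) simp
qed

text \<open>Coordinates with respect to a finite basis are unique, and uniqueness makes them linear.\<close>

lemma finite_dual_basis_exists:
  assumes "fin_dim"
  shows "\<exists>B g. finite B \<and> B \<subseteq> carrier V \<and> (\<forall>b\<in>B. functional K V (g b))
    \<and> (\<forall>v\<in>carrier V. (\<Oplus>\<^bsub>V\<^esub>b\<in>B. g b v \<odot>\<^bsub>V\<^esub> b) = v)"
proof -
  obtain B where B: "finite B" "basis B" using finite_basis_exists[OF assms] by blast
  have Bc: "B \<subseteq> carrier V" using B(2) by (simp add: basis_def)
  have uex: "\<exists>!a. a \<in> B \<rightarrow>\<^sub>E carrier K \<and> lincomb a B = v" if "v \<in> carrier V" for v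
    using basis_criterion[OF B(1) Bc] B(2) that by blast
  define co where "co v = (THE a. a \<in> B \<rightarrow>\<^sub>E carrier K \<and> lincomb a B = v)" for v
  have co: "co v \<in> B \<rightarrow>\<^sub>E carrier K" "lincomb (co v) B = v" if "v \<in> carrier V" for v
    using theI'[OF uex[OF that]] unfolding co_def by auto
  have co_eq: "co v b = a b" if "a \<in> B \<rightarrow> carrier K" "lincomb a B = v" "b \<in> B" for v a b
  proof -
    have v: "v \<in> carrier V" using that Bc by auto
    have "lincomb (restrict a B) B = lincomb a B" using that Bc by (intro lincomb_cong) auto
    then have "co v = restrict a B"
      unfolding co_def using that by (intro the1_equality[OF uex[OF v]]) auto
    then show ?thesis using that by simp
  qed
  have "functional K V (\<lambda>v. co v b)" if b: "b \<in> B" for b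
    unfolding functional_def
  proof (intro conjI ballI funcsetI)
    fix x assume x: "x \<in> carrier V"
    show "co x b \<in> carrier K" using co(1)[OF x] b by auto
    fix y assume y: "y \<in> carrier V"
    have "co x \<in> B \<rightarrow> carrier K" "co y \<in> B \<rightarrow> carrier K" using co(1)[OF x] co(1)[OF y] by auto
    then show "co (x \<oplus>\<^bsub>V\<^esub> y) b = co x b \<oplus>\<^bsub>K\<^esub> co y b"
      using co(2)[OF x] co(2)[OF y] b Bc B(1)
      by (intro co_eq[of "\<lambda>b. co x b \<oplus>\<^bsub>K\<^esub> co y b"]) (auto simp: lincomb_sum)
  next
    fix c x assume c: "c \<in> carrier K" and x: "x \<in> carrier V"
    have "co x \<in> B \<rightarrow> carrier K" using co(1)[OF x] by auto
    then show "co (c \<odot>\<^bsub>V\<^esub> x) b = c \<otimes>\<^bsub>K\<^esub> co x b"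
      using co[OF x] b Bc B(1) c
      by (intro co_eq[of "\<lambda>b. c \<otimes>\<^bsub>K\<^esub> co x b"]) (auto simp: lincomb_smult)
  qed
  moreover have "(\<Oplus>\<^bsub>V\<^esub>b\<in>B. co v b \<odot>\<^bsub>V\<^esub> b) = v" if "v \<in> carrier V" for v
    using co(2)[OF that] by (simp add: lincomb_def)
  ultimately show ?thesis using B(1) Bc by (intro exI[of _ B] exI[of _ "\<lambda>b v. co v b"]) auto
qed

end

lemma functional_smult_hom:
  assumes "module K V" "functional K W g" "x \<in> carrier V"
  shows "(\<lambda>y. g y \<odot>\<^bsub>V\<^esub> x) \<in> module_hom K W V"
proof -
  interpret V: module K V by fact
  show ?thesis using assms(3)
    by (intro module_homI) (simp_all add: functional_simps[OF assms(2)] V.smult_l_distr V.smult_assoc1)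
qed

lemma smult_hom:
  assumes "module K V" "c \<in> carrier K"
  shows "(\<lambda>x. c \<odot>\<^bsub>V\<^esub> x) \<in> module_hom K V V"
proof -
  interpret V: module K V by fact
  have "c \<odot>\<^bsub>V\<^esub> (a \<odot>\<^bsub>V\<^esub> x) = a \<odot>\<^bsub>V\<^esub> (c \<odot>\<^bsub>V\<^esub> x)" if "a \<in> carrier K" "x \<in> carrier V" for a x
    using that assms(2) by (metis V.smult_assoc1 V.m_comm)
  then show ?thesis using assms(2)
    by (intro module_homI) (simp_all add: V.smult_r_distr)
qed

lemma finsum_hom:
  assumes W: "module K W" and V: "module K V"
    and f: "\<And>i. i \<in> I \<Longrightarrow> f i \<in> module_hom K V W"
  shows "(\<lambda>x. \<Oplus>\<^bsub>W\<^esub>i\<in>I. f i x) \<in> module_hom K V W"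
proof -
  interpret V: module K V by (rule V)
  interpret W: module K W by (rule W)
  have fc: "f i x \<in> carrier W" if "i \<in> I" "x \<in> carrier V" for i x
    using module_hom_mem[OF f] that by blast
  show ?thesis
  proof (rule module_homI)
    fix x y assume x: "x \<in> carrier V" and y: "y \<in> carrier V"
    have "(\<Oplus>\<^bsub>W\<^esub>i\<in>I. f i (x \<oplus>\<^bsub>V\<^esub> y)) = (\<Oplus>\<^bsub>W\<^esub>i\<in>I. f i x \<oplus>\<^bsub>W\<^esub> f i y)"
      using x y fc by (intro W.M.finsum_cong') (auto simp: module_hom_add[OF f])
    then show "(\<Oplus>\<^bsub>W\<^esub>i\<in>I. f i (x \<oplus>\<^bsub>V\<^esub> y)) = (\<Oplus>\<^bsub>W\<^esub>i\<in>I. f i x) \<oplus>\<^bsub>W\<^esub> (\<Oplus>\<^bsub>W\<^esub>i\<in>I. f i y)"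
      using x y fc by (simp add: W.M.finsum_addf)
  next
    fix c x assume c: "c \<in> carrier K" and x: "x \<in> carrier V"
    have "(\<Oplus>\<^bsub>W\<^esub>i\<in>I. f i (c \<odot>\<^bsub>V\<^esub> x)) = (\<Oplus>\<^bsub>W\<^esub>i\<in>I. c \<odot>\<^bsub>W\<^esub> f i x)"
      using x c fc by (intro W.M.finsum_cong') (auto simp: module_hom_smult[OF f])
    then show "(\<Oplus>\<^bsub>W\<^esub>i\<in>I. f i (c \<odot>\<^bsub>V\<^esub> x)) = c \<odot>\<^bsub>W\<^esub> (\<Oplus>\<^bsub>W\<^esub>i\<in>I. f i x)"
      using x c fc by (simp add: W.finsum_smult)
  qed (use fc in \<open>auto intro!: W.M.finsum_closed\<close>)
qed

section \<open>Independent representations of tensors\<close>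

text \<open>Independence of a family rather than of a set: a vector that occurs at two indices counts as a
  dependence.\<close>

definition independent_family ::
  "('k, 'm) ring_scheme \<Rightarrow> ('k, 'v, 'n) module_scheme \<Rightarrow> 'i set \<Rightarrow> ('i \<Rightarrow> 'v) \<Rightarrow> bool" where
  "independent_family K V I w \<longleftrightarrow>
    (\<forall>c \<in> I \<rightarrow> carrier K. (\<Oplus>\<^bsub>V\<^esub>i\<in>I. c i \<odot>\<^bsub>V\<^esub> w i) = \<zero>\<^bsub>V\<^esub> \<longrightarrow> (\<forall>i\<in>I. c i = \<zero>\<^bsub>K\<^esub>))"

lemma (in vectorspace) dependent_family_isolate:
  assumes I: "finite I" and w: "w \<in> I \<rightarrow> carrier V" and dep: "\<not> independent_family K V I w"
  shows "\<exists>j\<in>I. \<exists>d\<in>I \<rightarrow> carrier K. w j = (\<Oplus>\<^bsub>V\<^esub>i\<in>I - {j}. d i \<odot>\<^bsub>V\<^esub> w i)"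
proof -
  obtain c j where c: "c \<in> I \<rightarrow> carrier K" "(\<Oplus>\<^bsub>V\<^esub>i\<in>I. c i \<odot>\<^bsub>V\<^esub> w i) = \<zero>\<^bsub>V\<^esub>"
    and j: "j \<in> I" "c j \<noteq> \<zero>\<^bsub>K\<^esub>"
    using dep by (auto simp: independent_family_def)
  have cj: "c j \<in> carrier K" "inv\<^bsub>K\<^esub> (c j) \<in> carrier K" and wj: "w j \<in> carrier V"
    using c j w by auto
  let ?S = "\<Oplus>\<^bsub>V\<^esub>i\<in>I - {j}. c i \<odot>\<^bsub>V\<^esub> w i"
  have cw: "c i \<odot>\<^bsub>V\<^esub> w i \<in> carrier V" if "i \<in> I" for i using that c w by auto
  have S: "?S \<in> carrier V" using cw by (intro M.finsum_closed) auto
  have "(\<Oplus>\<^bsub>V\<^esub>i\<in>insert j (I - {j}). c i \<odot>\<^bsub>V\<^esub> w i) = c j \<odot>\<^bsub>V\<^esub> w j \<oplus>\<^bsub>V\<^esub> ?S"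
    using I cw j by (intro M.finsum_insert) auto
  then have "c j \<odot>\<^bsub>V\<^esub> w j \<oplus>\<^bsub>V\<^esub> ?S = \<zero>\<^bsub>V\<^esub>" using j c(2) by (simp add: insert_absorb)
  then have "c j \<odot>\<^bsub>V\<^esub> w j = \<ominus>\<^bsub>V\<^esub> ?S"
    using S cw[OF j(1)] by (metis M.minus_equality)
  then have "w j = inv\<^bsub>K\<^esub> (c j) \<odot>\<^bsub>V\<^esub> (\<ominus>\<^bsub>V\<^esub> ?S)"
    using mult_inverse[OF cj(1) wj _ j(2)] by blast
  also have "\<dots> = (\<ominus>\<^bsub>K\<^esub> (inv\<^bsub>K\<^esub> (c j))) \<odot>\<^bsub>V\<^esub> ?S"
    using cj S by (simp add: smult_l_minus smult_r_minus)
  also have "\<dots> = (\<Oplus>\<^bsub>V\<^esub>i\<in>I - {j}. (\<ominus>\<^bsub>K\<^esub> (inv\<^bsub>K\<^esub> (c j))) \<odot>\<^bsub>V\<^esub> (c i \<odot>\<^bsub>V\<^esub> w i))"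
    using cj cw by (intro finsum_smult) auto
  also have "\<dots> = (\<Oplus>\<^bsub>V\<^esub>i\<in>I - {j}. ((\<ominus>\<^bsub>K\<^esub> (inv\<^bsub>K\<^esub> (c j))) \<otimes>\<^bsub>K\<^esub> c i) \<odot>\<^bsub>V\<^esub> w i)"
    using cj c w by (intro M.finsum_cong') (auto simp: smult_assoc1 Pi_iff)
  finally have "w j = (\<Oplus>\<^bsub>V\<^esub>i\<in>I - {j}. ((\<ominus>\<^bsub>K\<^esub> (inv\<^bsub>K\<^esub> (c j))) \<otimes>\<^bsub>K\<^esub> c i) \<odot>\<^bsub>V\<^esub> w i)" .
  moreover have "(\<lambda>i. (\<ominus>\<^bsub>K\<^esub> (inv\<^bsub>K\<^esub> (c j))) \<otimes>\<^bsub>K\<^esub> c i) \<in> I \<rightarrow> carrier K" using c cj by auto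
  ultimately show ?thesis using j(1) by (intro bexI[of _ j] bexI[of _ "\<lambda>i. (\<ominus>\<^bsub>K\<^esub> (inv\<^bsub>K\<^esub> (c j))) \<otimes>\<^bsub>K\<^esub> c i"])
qed

context tensor_pair
begin

text \<open>If \<open>w\<^sub>j\<close> is a combination of the other \<open>w\<^sub>i\<close>, bilinearity distributes \<open>v\<^sub>j \<otimes> w\<^sub>j\<close> over the other terms,
  which changes only their first factors; repeat until the remaining \<open>w\<^sub>i\<close> are independent. The second
  factors that survive are among the original ones, so any property they had is kept.\<close>

lemma tensor_reduce_independent:
  assumes "finite I" "v \<in> I \<rightarrow> carrier V" "w \<in> I \<rightarrow> carrier W"
  shows "\<exists>J v'. J \<subseteq> I \<and> v' \<in> J \<rightarrow> carrier V \<and> independent_family K W J w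
    \<and> (\<Oplus>\<^bsub>T\<^esub>i\<in>I. v i \<otimes>\<^sub>p w i) = (\<Oplus>\<^bsub>T\<^esub>i\<in>J. v' i \<otimes>\<^sub>p w i)"
  using assms
proof (induction I arbitrary: v rule: finite_psubset_induct)
  case (psubset I)
  show ?case
  proof (cases "independent_family K W I w")
    case True
    then show ?thesis using psubset.prems by blast
  next
    case False
    then obtain j d where j: "j \<in> I" and d: "d \<in> I \<rightarrow> carrier K"
      and wj: "w j = (\<Oplus>\<^bsub>W\<^esub>i\<in>I - {j}. d i \<odot>\<^bsub>W\<^esub> w i)"
      using W.dependent_family_isolate[OF psubset.hyps psubset.prems(2)] by blast
    have mem: "v i \<in> carrier V" "w i \<in> carrier W" "d i \<in> carrier K" if "i \<in> I" for i
      using that psubset.prems d by auto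
    let ?v = "\<lambda>i. v i \<oplus>\<^bsub>V\<^esub> d i \<odot>\<^bsub>V\<^esub> v j"
    have "v j \<otimes>\<^sub>p w j = (\<Oplus>\<^bsub>T\<^esub>i\<in>I - {j}. v j \<otimes>\<^sub>p (d i \<odot>\<^bsub>W\<^esub> w i))"
      unfolding wj using mem j
      by (intro module_hom_finsum[OF W.module_axioms T.module_axioms bilinear_right[OF pure_bilinear]]) auto
    also have "\<dots> = (\<Oplus>\<^bsub>T\<^esub>i\<in>I - {j}. (d i \<odot>\<^bsub>V\<^esub> v j) \<otimes>\<^sub>p w i)"
      using mem j by (intro T.M.finsum_cong') (auto simp: pure_smult_left pure_smult_right)
    finally have vj: "v j \<otimes>\<^sub>p w j = (\<Oplus>\<^bsub>T\<^esub>i\<in>I - {j}. (d i \<odot>\<^bsub>V\<^esub> v j) \<otimes>\<^sub>p w i)" .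
    have "(\<Oplus>\<^bsub>T\<^esub>i\<in>I. v i \<otimes>\<^sub>p w i) = (\<Oplus>\<^bsub>T\<^esub>i\<in>insert j (I - {j}). v i \<otimes>\<^sub>p w i)"
      using j by (simp add: insert_absorb)
    also have "\<dots> = v j \<otimes>\<^sub>p w j \<oplus>\<^bsub>T\<^esub> (\<Oplus>\<^bsub>T\<^esub>i\<in>I - {j}. v i \<otimes>\<^sub>p w i)"
      using mem j psubset.hyps by (intro T.M.finsum_insert) auto
    also have "\<dots> = (\<Oplus>\<^bsub>T\<^esub>i\<in>I - {j}. (d i \<odot>\<^bsub>V\<^esub> v j) \<otimes>\<^sub>p w i \<oplus>\<^bsub>T\<^esub> v i \<otimes>\<^sub>p w i)"
      unfolding vj using mem j by (intro T.M.finsum_addf[symmetric]) auto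
    also have "\<dots> = (\<Oplus>\<^bsub>T\<^esub>i\<in>I - {j}. ?v i \<otimes>\<^sub>p w i)"
      using mem j by (intro T.M.finsum_cong') (auto simp: pure_add_left T.M.a_comm)
    finally have eq: "(\<Oplus>\<^bsub>T\<^esub>i\<in>I. v i \<otimes>\<^sub>p w i) = (\<Oplus>\<^bsub>T\<^esub>i\<in>I - {j}. ?v i \<otimes>\<^sub>p w i)" .
    have "\<exists>J v'. J \<subseteq> I - {j} \<and> v' \<in> J \<rightarrow> carrier V \<and> independent_family K W J w
      \<and> (\<Oplus>\<^bsub>T\<^esub>i\<in>I - {j}. ?v i \<otimes>\<^sub>p w i) = (\<Oplus>\<^bsub>T\<^esub>i\<in>J. v' i \<otimes>\<^sub>p w i)"
      using mem j by (intro psubset.IH) auto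
    then show ?thesis unfolding eq by blast
  qed
qed

text \<open>The pure tensors are closed under scalars, so their finite sums exhaust their span.\<close>

lemma tensor_sum_of_pure:
  assumes "t \<in> carrier T"
  shows "\<exists>(n::nat) v w. v \<in> {..<n} \<rightarrow> carrier V \<and> w \<in> {..<n} \<rightarrow> carrier W
    \<and> t = (\<Oplus>\<^bsub>T\<^esub>i\<in>{..<n}. v i \<otimes>\<^sub>p w i)"
proof -
  let ?P = "{x \<otimes>\<^sub>p y | x y. x \<in> carrier V \<and> y \<in> carrier W}"
  have P: "?P \<subseteq> carrier T" by auto
  have "c \<odot>\<^bsub>T\<^esub> t \<in> ?P" if c: "c \<in> carrier K" and t: "t \<in> ?P" for c t
  proof -
    obtain x y where "x \<in> carrier V" "y \<in> carrier W" "t = x \<otimes>\<^sub>p y" using t by blast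
    then have "c \<odot>\<^bsub>T\<^esub> t = (c \<odot>\<^bsub>V\<^esub> x) \<otimes>\<^sub>p y" "c \<odot>\<^bsub>V\<^esub> x \<in> carrier V" "y \<in> carrier W"
      using c by (simp_all add: pure_smult_left)
    then show ?thesis by blast
  qed
  then have span: "T.span ?P \<subseteq> finite_sums T ?P"
    by (rule span_subset_finite_sums[OF T.module_axioms P])
  have "t \<in> T.span ?P"
  proof (rule tensor_generated[OF T.span_is_submodule[OF P] _ assms])
    fix x y assume "x \<in> carrier V" "y \<in> carrier W"
    then have "x \<otimes>\<^sub>p y \<in> ?P" by blast
    then show "x \<otimes>\<^sub>p y \<in> T.span ?P" using T.in_own_span[OF P] by blast
  qed
  with span obtain n :: nat and s where s: "\<forall>i<n. s i \<in> ?P" "t = (\<Oplus>\<^bsub>T\<^esub>i\<in>{..<n}. s i)"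
    by (auto simp: finite_sums_def)
  then have "\<forall>i. \<exists>x y. i < n \<longrightarrow> x \<in> carrier V \<and> y \<in> carrier W \<and> s i = x \<otimes>\<^sub>p y" by blast
  then obtain v w where vw: "\<And>i. i < n \<Longrightarrow> v i \<in> carrier V \<and> w i \<in> carrier W \<and> s i = v i \<otimes>\<^sub>p w i"
    by metis
  then have "t = (\<Oplus>\<^bsub>T\<^esub>i\<in>{..<n}. v i \<otimes>\<^sub>p w i)"
    unfolding s(2) by (intro T.M.finsum_cong') auto
  with vw show ?thesis by (intro exI[of _ n] exI[of _ v] exI[of _ w]) auto
qed

section \<open>Tensor products of linear maps\<close>

lemma lin_apply: "\<phi> \<in> carrier (lin_End K V) \<Longrightarrow> x \<in> carrier V \<Longrightarrow> \<phi> x \<in> carrier V"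
  and lin_apply': "\<alpha> \<in> carrier (lin_End K W) \<Longrightarrow> y \<in> carrier W \<Longrightarrow> \<alpha> y \<in> carrier W"
  by (auto simp: module_hom_mem)

lemma tensor_map_bilinear:
  assumes "\<phi> \<in> carrier (lin_End K V)" "\<alpha> \<in> carrier (lin_End K W)"
  shows "bilinear K V W T (\<lambda>x y. \<phi> x \<otimes>\<^sub>p \<alpha> y)"
proof -
  have f: "\<phi> \<in> module_hom K V V" "\<alpha> \<in> module_hom K W W" using assms by auto
  show ?thesis
    by (intro bilinearI module_homI)
      (simp_all add: module_hom_mem[OF f(1)] module_hom_mem[OF f(2)] module_hom_add[OF f(1)] module_hom_add[OF f(2)] module_hom_smult[OF f(1)]
        module_hom_smult[OF f(2)] pure_add_left pure_add_right pure_smult_left pure_smult_right)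
qed

lemma tensor_map_mem [simp]:
  assumes "\<phi> \<in> carrier (lin_End K V)" "\<alpha> \<in> carrier (lin_End K W)"
  shows "tensor_map K V W \<phi> \<alpha> \<in> carrier (lin_End K T)"
  using tensor_lift_hom[OF T.vectorspace_axioms tensor_map_bilinear[OF assms]] tensor_lift_ext
  by (simp add: tensor_map_def)

lemma tensor_map_pure [simp]:
  assumes "\<phi> \<in> carrier (lin_End K V)" "\<alpha> \<in> carrier (lin_End K W)" "x \<in> carrier V" "y \<in> carrier W"
  shows "tensor_map K V W \<phi> \<alpha> (x \<otimes>\<^sub>p y) = \<phi> x \<otimes>\<^sub>p \<alpha> y"
  using tensor_lift_pure[OF T.vectorspace_axioms tensor_map_bilinear[OF assms(1,2)] assms(3,4)]
  by (simp add: tensor_map_def)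

text \<open>The form in which identities between endomorphisms of \<open>V \<otimes> W\<close> are proved below.\<close>

lemma lin_End_tensor_eqI:
  assumes "\<Phi> \<in> carrier (lin_End K T)" "\<Psi> \<in> carrier (lin_End K T)"
    and "\<And>x y. \<lbrakk>x \<in> carrier V; y \<in> carrier W\<rbrakk> \<Longrightarrow> \<Phi> (x \<otimes>\<^sub>p y) = \<Psi> (x \<otimes>\<^sub>p y)"
  shows "\<Phi> = \<Psi>"
proof (rule lin_End_eqI[OF assms(1,2)])
  have hom: "\<Phi> \<in> module_hom K T T" "\<Psi> \<in> module_hom K T T" using assms(1,2) by simp_all
  show "\<Phi> t = \<Psi> t" if "t \<in> carrier T" for t
    by (rule tensor_hom_eqI[OF T.module_axioms hom assms(3) that])
qed

sublocale EV: vectorspace K "lin_End K V" by (rule lin_End_vectorspace) (rule V.vectorspace_axioms)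
sublocale EW: vectorspace K "lin_End K W" by (rule lin_End_vectorspace) (rule W.vectorspace_axioms)
sublocale ET: vectorspace K "lin_End K T" by (rule lin_End_vectorspace) (rule T.vectorspace_axioms)

lemma End_pair: "tensor_pair K (lin_End K V) (lin_End K W)"
  by unfold_locales

lemma tensor_map_End_bilinear:
  "bilinear K (lin_End K V) (lin_End K W) (lin_End K T) (tensor_map K V W)"
proof (intro bilinearI module_homI)
  fix \<phi> \<alpha> \<beta> assume f: "\<phi> \<in> carrier (lin_End K V)" "\<alpha> \<in> carrier (lin_End K W)" "\<beta> \<in> carrier (lin_End K W)"
  show "tensor_map K V W \<phi> (\<alpha> \<oplus>\<^bsub>lin_End K W\<^esub> \<beta>)
      = tensor_map K V W \<phi> \<alpha> \<oplus>\<^bsub>lin_End K T\<^esub> tensor_map K V W \<phi> \<beta>"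
  proof (rule lin_End_tensor_eqI)
    fix x y assume xy: "x \<in> carrier V" "y \<in> carrier W"
    show "tensor_map K V W \<phi> (\<alpha> \<oplus>\<^bsub>lin_End K W\<^esub> \<beta>) (x \<otimes>\<^sub>p y)
      = (tensor_map K V W \<phi> \<alpha> \<oplus>\<^bsub>lin_End K T\<^esub> tensor_map K V W \<phi> \<beta>) (x \<otimes>\<^sub>p y)"
      unfolding tensor_map_pure[OF f(1) EW.M.a_closed[OF f(2,3)] xy]
      using f xy by (simp add: pure_add_right lin_apply[OF f(1)] lin_apply'[OF f(2)] lin_apply'[OF f(3)] del: lin_End_simps(1))
  qed (use f in \<open>simp_all del: lin_End_simps\<close>)
next
  fix \<phi> \<alpha> c assume f: "\<phi> \<in> carrier (lin_End K V)" "c \<in> carrier K" "\<alpha> \<in> carrier (lin_End K W)"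
  show "tensor_map K V W \<phi> (c \<odot>\<^bsub>lin_End K W\<^esub> \<alpha>) = c \<odot>\<^bsub>lin_End K T\<^esub> tensor_map K V W \<phi> \<alpha>"
  proof (rule lin_End_tensor_eqI)
    fix x y assume xy: "x \<in> carrier V" "y \<in> carrier W"
    show "tensor_map K V W \<phi> (c \<odot>\<^bsub>lin_End K W\<^esub> \<alpha>) (x \<otimes>\<^sub>p y)
      = (c \<odot>\<^bsub>lin_End K T\<^esub> tensor_map K V W \<phi> \<alpha>) (x \<otimes>\<^sub>p y)"
      unfolding tensor_map_pure[OF f(1) EW.smult_closed[OF f(2,3)] xy]
      using f xy by (simp add: pure_smult_right lin_apply[OF f(1)] lin_apply'[OF f(3)] del: lin_End_simps(1))
  qed (use f in \<open>simp_all del: lin_End_simps\<close>)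
next
  fix \<phi> \<psi> \<alpha> assume f: "\<alpha> \<in> carrier (lin_End K W)" "\<phi> \<in> carrier (lin_End K V)" "\<psi> \<in> carrier (lin_End K V)"
  show "tensor_map K V W (\<phi> \<oplus>\<^bsub>lin_End K V\<^esub> \<psi>) \<alpha>
      = tensor_map K V W \<phi> \<alpha> \<oplus>\<^bsub>lin_End K T\<^esub> tensor_map K V W \<psi> \<alpha>"
  proof (rule lin_End_tensor_eqI)
    fix x y assume xy: "x \<in> carrier V" "y \<in> carrier W"
    show "tensor_map K V W (\<phi> \<oplus>\<^bsub>lin_End K V\<^esub> \<psi>) \<alpha> (x \<otimes>\<^sub>p y)
      = (tensor_map K V W \<phi> \<alpha> \<oplus>\<^bsub>lin_End K T\<^esub> tensor_map K V W \<psi> \<alpha>) (x \<otimes>\<^sub>p y)"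
      unfolding tensor_map_pure[OF EV.M.a_closed[OF f(2,3)] f(1) xy]
      using f xy by (simp add: pure_add_left lin_apply'[OF f(1)] lin_apply[OF f(2)] lin_apply[OF f(3)] del: lin_End_simps(1))
  qed (use f in \<open>simp_all del: lin_End_simps\<close>)
next
  fix \<phi> \<alpha> c assume f: "\<alpha> \<in> carrier (lin_End K W)" "c \<in> carrier K" "\<phi> \<in> carrier (lin_End K V)"
  show "tensor_map K V W (c \<odot>\<^bsub>lin_End K V\<^esub> \<phi>) \<alpha> = c \<odot>\<^bsub>lin_End K T\<^esub> tensor_map K V W \<phi> \<alpha>"
  proof (rule lin_End_tensor_eqI)
    fix x y assume xy: "x \<in> carrier V" "y \<in> carrier W"
    show "tensor_map K V W (c \<odot>\<^bsub>lin_End K V\<^esub> \<phi>) \<alpha> (x \<otimes>\<^sub>p y)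
      = (c \<odot>\<^bsub>lin_End K T\<^esub> tensor_map K V W \<phi> \<alpha>) (x \<otimes>\<^sub>p y)"
      unfolding tensor_map_pure[OF EV.smult_closed[OF f(2,3)] f(1) xy]
      using f xy by (simp add: pure_smult_left lin_apply'[OF f(1)] lin_apply[OF f(3)] del: lin_End_simps(1))
  qed (use f in \<open>simp_all del: lin_End_simps\<close>)
qed (simp_all del: lin_End_simps)

abbreviation TE where "TE \<equiv> tensor_space K (lin_End K V) (lin_End K W)"
abbreviation pure_End (infixl \<open>\<otimes>\<^sub>E\<close> 75) where "\<phi> \<otimes>\<^sub>E \<alpha> \<equiv> pure_tensor K (lin_End K V) (lin_End K W) \<phi> \<alpha>"

lemma tensor_End_map_hom: "tensor_End_map K V W \<in> module_hom K TE (lin_End K T)"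
  unfolding tensor_End_map_def
  by (rule tensor_pair.tensor_lift_hom[OF End_pair ET.vectorspace_axioms tensor_map_End_bilinear])

lemma tensor_End_map_pure [simp]:
  "\<lbrakk>\<phi> \<in> carrier (lin_End K V); \<alpha> \<in> carrier (lin_End K W)\<rbrakk>
    \<Longrightarrow> tensor_End_map K V W (\<phi> \<otimes>\<^sub>E \<alpha>) = tensor_map K V W \<phi> \<alpha>"
  unfolding tensor_End_map_def
  by (rule tensor_pair.tensor_lift_pure[OF End_pair ET.vectorspace_axioms tensor_map_End_bilinear])

lemma TE_vectorspace: "vectorspace K TE"
proof -
  interpret E: tensor_pair K "lin_End K V" "lin_End K W" by (rule End_pair)
  show ?thesis by (rule E.T.vectorspace_axioms)
qed

section \<open>The canonical map \<open>End V \<otimes> End W \<rightarrow> End (V \<otimes> W)\<close>\<close>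

abbreviation contract_right :: "('w \<Rightarrow> 'k) \<Rightarrow> ('v \<times> 'w \<Rightarrow> 'k) set \<Rightarrow> 'v" where
  "contract_right g \<equiv> tensor_lift K V W V (\<lambda>x y. g y \<odot>\<^bsub>V\<^esub> x)"

abbreviation contract_left :: "('v \<Rightarrow> 'k) \<Rightarrow> ('v \<times> 'w \<Rightarrow> 'k) set \<Rightarrow> 'w" where
  "contract_left g \<equiv> tensor_lift K V W W (\<lambda>x y. g x \<odot>\<^bsub>W\<^esub> y)"

lemma contract_right:
  assumes g: "functional K W g"
  shows "contract_right g \<in> module_hom K T V"
    and "\<lbrakk>x \<in> carrier V; y \<in> carrier W\<rbrakk> \<Longrightarrow> contract_right g (x \<otimes>\<^sub>p y) = g y \<odot>\<^bsub>V\<^esub> x"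
proof -
  have b: "bilinear K V W V (\<lambda>x y. g y \<odot>\<^bsub>V\<^esub> x)"
    by (intro bilinearI functional_smult_hom[OF V.module_axioms g] smult_hom[OF V.module_axioms]
        functional_simps(1)[OF g])
  show "contract_right g \<in> module_hom K T V"
    by (rule tensor_lift_hom[OF V.vectorspace_axioms b])
  show "\<lbrakk>x \<in> carrier V; y \<in> carrier W\<rbrakk> \<Longrightarrow> contract_right g (x \<otimes>\<^sub>p y) = g y \<odot>\<^bsub>V\<^esub> x"
    by (rule tensor_lift_pure[OF V.vectorspace_axioms b])
qed

lemma contract_left:
  assumes g: "functional K V g"
  shows "contract_left g \<in> module_hom K T W"
    and "\<lbrakk>x \<in> carrier V; y \<in> carrier W\<rbrakk> \<Longrightarrow> contract_left g (x \<otimes>\<^sub>p y) = g x \<odot>\<^bsub>W\<^esub> y"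
proof -
  have b: "bilinear K V W W (\<lambda>x y. g x \<odot>\<^bsub>W\<^esub> y)"
    by (intro bilinearI functional_smult_hom[OF W.module_axioms g] smult_hom[OF W.module_axioms]
        functional_simps(1)[OF g])
  show "contract_left g \<in> module_hom K T W"
    by (rule tensor_lift_hom[OF W.vectorspace_axioms b])
  show "\<lbrakk>x \<in> carrier V; y \<in> carrier W\<rbrakk> \<Longrightarrow> contract_left g (x \<otimes>\<^sub>p y) = g x \<odot>\<^bsub>W\<^esub> y"
    by (rule tensor_lift_pure[OF W.vectorspace_axioms b])
qed

text \<open>Contracting the first factor with a functional \<open>g\<close> turns the hypothesis into
  \<open>\<Sum> g(v\<^sub>i) \<alpha>\<^sub>i = 0\<close> in \<open>End W\<close>, so \<open>g(v\<^sub>j) = 0\<close> by independence; functionals separate points.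
  The independence is that of the maps \<open>\<alpha>\<^sub>i\<close>; their values at a single \<open>y\<close> may well be dependent.\<close>

lemma independent_maps_coefficients_zero:
  assumes ind: "independent_family K (lin_End K W) J \<alpha>"
    and \<alpha>: "\<alpha> \<in> J \<rightarrow> carrier (lin_End K W)" and v: "v \<in> J \<rightarrow> carrier V"
    and zero: "\<And>y. y \<in> carrier W \<Longrightarrow> (\<Oplus>\<^bsub>T\<^esub>i\<in>J. v i \<otimes>\<^sub>p \<alpha> i y) = \<zero>\<^bsub>T\<^esub>"
    and j: "j \<in> J"
  shows "v j = \<zero>\<^bsub>V\<^esub>"
proof (rule ccontr)
  assume "v j \<noteq> \<zero>\<^bsub>V\<^esub>"
  moreover have vj: "v j \<in> carrier V" using v j by auto
  ultimately obtain g where g: "functional K V g" "g (v j) \<noteq> \<zero>\<^bsub>K\<^esub>"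
    using V.functional_nonzero_exists by blast
  have vi: "v i \<in> carrier V" "\<alpha> i \<in> carrier (lin_End K W)" if "i \<in> J" for i
    using that v \<alpha> by auto
  note \<alpha>y = lin_apply'[OF vi(2)] and gv = functional_simps(1)[OF g(1) vi(1)]
  have smv: "g (v i) \<odot>\<^bsub>lin_End K W\<^esub> \<alpha> i \<in> carrier (lin_End K W)" if "i \<in> J" for i
    using gv[OF that] vi(2)[OF that] by (rule EW.smult_closed)
  have "(\<Oplus>\<^bsub>lin_End K W\<^esub>i\<in>J. g (v i) \<odot>\<^bsub>lin_End K W\<^esub> \<alpha> i) = \<zero>\<^bsub>lin_End K W\<^esub>"
  proof (rule lin_End_eqI)
    show "(\<Oplus>\<^bsub>lin_End K W\<^esub>i\<in>J. g (v i) \<odot>\<^bsub>lin_End K W\<^esub> \<alpha> i) \<in> carrier (lin_End K W)"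
      using smv by (intro EW.M.finsum_closed) blast
    fix y assume y: "y \<in> carrier W"
    have "(\<Oplus>\<^bsub>lin_End K W\<^esub>i\<in>J. g (v i) \<odot>\<^bsub>lin_End K W\<^esub> \<alpha> i) y
        = (\<Oplus>\<^bsub>W\<^esub>i\<in>J. (g (v i) \<odot>\<^bsub>lin_End K W\<^esub> \<alpha> i) y)"
      using smv y by (intro lin_End_finsum_apply[OF W.vectorspace_axioms]) blast+
    also have "\<dots> = (\<Oplus>\<^bsub>W\<^esub>i\<in>J. contract_left g (v i \<otimes>\<^sub>p \<alpha> i y))"
      using vi(1) gv \<alpha>y y
      by (intro W.M.finsum_cong') (simp_all add: contract_left(2)[OF g(1)] Pi_iff del: lin_End_simps(1))
    also have "\<dots> = contract_left g (\<Oplus>\<^bsub>T\<^esub>i\<in>J. v i \<otimes>\<^sub>p \<alpha> i y)"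
      using vi(1) \<alpha>y y
      by (intro module_hom_finsum[OF T.module_axioms W.module_axioms contract_left(1)[OF g(1)], symmetric])
        (simp add: Pi_iff del: lin_End_simps(1))
    also have "\<dots> = \<zero>\<^bsub>W\<^esub>"
      unfolding zero[OF y] by (rule module_hom_zero[OF T.module_axioms W.module_axioms contract_left(1)[OF g(1)]])
    finally show "(\<Oplus>\<^bsub>lin_End K W\<^esub>i\<in>J. g (v i) \<odot>\<^bsub>lin_End K W\<^esub> \<alpha> i) y = \<zero>\<^bsub>lin_End K W\<^esub> y"
      using y by simp
  qed (rule EW.M.zero_closed)
  moreover have "(\<lambda>i. g (v i)) \<in> J \<rightarrow> carrier K" using gv by blast
  ultimately have "g (v j) = \<zero>\<^bsub>K\<^esub>"
    using ind[unfolded independent_family_def, rule_format, of "\<lambda>i. g (v i)" j] j by blast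
  then show False using g(2) by contradiction
qed

lemma TE_independent_representation:
  assumes "t \<in> carrier TE"
  shows "\<exists>(J::nat set) \<phi> \<alpha>. finite J \<and> \<phi> \<in> J \<rightarrow> carrier (lin_End K V) \<and> \<alpha> \<in> J \<rightarrow> carrier (lin_End K W)
    \<and> independent_family K (lin_End K W) J \<alpha> \<and> t = (\<Oplus>\<^bsub>TE\<^esub>i\<in>J. \<phi> i \<otimes>\<^sub>E \<alpha> i)"
proof -
  interpret E: tensor_pair K "lin_End K V" "lin_End K W" by (rule End_pair)
  obtain n :: nat and \<phi> \<alpha> where r: "\<phi> \<in> {..<n} \<rightarrow> carrier (lin_End K V)" "\<alpha> \<in> {..<n} \<rightarrow> carrier (lin_End K W)"
    "t = (\<Oplus>\<^bsub>TE\<^esub>i\<in>{..<n}. \<phi> i \<otimes>\<^sub>E \<alpha> i)"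
    using E.tensor_sum_of_pure[OF assms] by blast
  obtain J \<psi> where J: "J \<subseteq> {..<n}" "\<psi> \<in> J \<rightarrow> carrier (lin_End K V)"
    "independent_family K (lin_End K W) J \<alpha>"
    "(\<Oplus>\<^bsub>TE\<^esub>i\<in>{..<n}. \<phi> i \<otimes>\<^sub>E \<alpha> i) = (\<Oplus>\<^bsub>TE\<^esub>i\<in>J. \<psi> i \<otimes>\<^sub>E \<alpha> i)"
    using E.tensor_reduce_independent[OF finite_lessThan r(1,2)] by blast
  moreover have "finite J" using J(1) finite_subset by blast
  moreover have "\<alpha> \<in> J \<rightarrow> carrier (lin_End K W)" using r(2) J(1) by blast
  ultimately show ?thesis unfolding r(3) by (intro exI[of _ J] exI[of _ \<psi>] exI[of _ \<alpha>] conjI)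
qed

lemma tensor_End_map_finsum:
  assumes "\<phi> \<in> I \<rightarrow> carrier (lin_End K V)" "\<alpha> \<in> I \<rightarrow> carrier (lin_End K W)"
  shows "tensor_End_map K V W (\<Oplus>\<^bsub>TE\<^esub>i\<in>I. \<phi> i \<otimes>\<^sub>E \<alpha> i) = (\<Oplus>\<^bsub>lin_End K T\<^esub>i\<in>I. tensor_map K V W (\<phi> i) (\<alpha> i))"
proof -
  interpret E: tensor_pair K "lin_End K V" "lin_End K W" by (rule End_pair)
  have "tensor_End_map K V W (\<Oplus>\<^bsub>TE\<^esub>i\<in>I. \<phi> i \<otimes>\<^sub>E \<alpha> i)
      = (\<Oplus>\<^bsub>lin_End K T\<^esub>i\<in>I. tensor_End_map K V W (\<phi> i \<otimes>\<^sub>E \<alpha> i))"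
    using assms by (intro module_hom_finsum[OF E.T.module_axioms ET.module_axioms tensor_End_map_hom])
      (simp add: Pi_iff del: lin_End_simps)
  also have "\<dots> = (\<Oplus>\<^bsub>lin_End K T\<^esub>i\<in>I. tensor_map K V W (\<phi> i) (\<alpha> i))"
    using assms by (intro ET.M.finsum_cong') (simp_all add: Pi_iff del: lin_End_simps)
  finally show ?thesis .
qed

lemma tensor_map_finsum_pure:
  assumes "\<phi> \<in> I \<rightarrow> carrier (lin_End K V)" "\<alpha> \<in> I \<rightarrow> carrier (lin_End K W)" "x \<in> carrier V" "y \<in> carrier W"
  shows "(\<Oplus>\<^bsub>lin_End K T\<^esub>i\<in>I. tensor_map K V W (\<phi> i) (\<alpha> i)) (x \<otimes>\<^sub>p y) = (\<Oplus>\<^bsub>T\<^esub>i\<in>I. \<phi> i x \<otimes>\<^sub>p \<alpha> i y)"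
proof -
  have m: "\<phi> i \<in> carrier (lin_End K V)" "\<alpha> i \<in> carrier (lin_End K W)" if "i \<in> I" for i
    using assms that by blast+
  have "(\<Oplus>\<^bsub>lin_End K T\<^esub>i\<in>I. tensor_map K V W (\<phi> i) (\<alpha> i)) (x \<otimes>\<^sub>p y)
      = (\<Oplus>\<^bsub>T\<^esub>i\<in>I. tensor_map K V W (\<phi> i) (\<alpha> i) (x \<otimes>\<^sub>p y))"
    using assms m by (intro lin_End_finsum_apply[OF T.vectorspace_axioms]) (simp_all add: Pi_iff del: lin_End_simps)
  also have "\<dots> = (\<Oplus>\<^bsub>T\<^esub>i\<in>I. \<phi> i x \<otimes>\<^sub>p \<alpha> i y)"
    using assms(3,4) m lin_apply[OF m(1)] lin_apply'[OF m(2)]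
    by (intro T.M.finsum_cong') (simp_all add: Pi_iff del: lin_End_simps)
  finally show ?thesis .
qed

text \<open>For a representation \<open>\<Sum> \<phi>\<^sub>i \<otimes> \<alpha>\<^sub>i\<close> with independent \<open>\<alpha>\<^sub>i\<close>, evaluating at \<open>x \<otimes> y\<close> for all \<open>y\<close> forces
  \<open>\<phi>\<^sub>i(x) = 0\<close> for every \<open>x\<close>.\<close>

lemma tensor_End_map_inj: "inj_on (tensor_End_map K V W) (carrier TE)"
proof -
  interpret E: tensor_pair K "lin_End K V" "lin_End K W" by (rule End_pair)
  note hom = tensor_End_map_hom
  have ker: "t = \<zero>\<^bsub>TE\<^esub>" if t: "t \<in> carrier TE" and 0: "tensor_End_map K V W t = \<zero>\<^bsub>lin_End K T\<^esub>" for t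
  proof -
    obtain J :: "nat set" and \<phi> \<alpha> where r: "finite J" "\<phi> \<in> J \<rightarrow> carrier (lin_End K V)"
      "\<alpha> \<in> J \<rightarrow> carrier (lin_End K W)" "independent_family K (lin_End K W) J \<alpha>"
      "t = (\<Oplus>\<^bsub>TE\<^esub>i\<in>J. \<phi> i \<otimes>\<^sub>E \<alpha> i)"
      using TE_independent_representation[OF t] by blast
    have "\<phi> j = \<zero>\<^bsub>lin_End K V\<^esub>" if j: "j \<in> J" for j
    proof (rule lin_End_eqI)
      show "\<phi> j \<in> carrier (lin_End K V)" using r(2) j by blast
      fix x assume x: "x \<in> carrier V"
      have "\<phi> j x = \<zero>\<^bsub>V\<^esub>"
      proof (rule independent_maps_coefficients_zero[OF r(4,3) _ _ j])
        show "(\<lambda>i. \<phi> i x) \<in> J \<rightarrow> carrier V" using r(2) lin_apply x by blast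
        fix y assume y: "y \<in> carrier W"
        show "(\<Oplus>\<^bsub>T\<^esub>i\<in>J. \<phi> i x \<otimes>\<^sub>p \<alpha> i y) = \<zero>\<^bsub>T\<^esub>"
          using 0 x y unfolding r(5) tensor_End_map_finsum[OF r(2,3)] tensor_map_finsum_pure[OF r(2,3) x y, symmetric]
          by simp
      qed
      then show "\<phi> j x = \<zero>\<^bsub>lin_End K V\<^esub> x" using x by simp
    qed (rule EV.M.zero_closed)
    note zero = this
    have "\<phi> i \<otimes>\<^sub>E \<alpha> i = \<zero>\<^bsub>TE\<^esub>"
      if "i \<in> J" for i
    proof -
      have \<alpha>: "\<alpha> i \<in> carrier (lin_End K W)" using that r(3) by blast
      show ?thesis unfolding zero[OF that]
        by (rule module_hom_zero[OF EV.module_axioms E.T.module_axioms bilinear_left[OF E.pure_bilinear \<alpha>]])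
    qed
    then show ?thesis unfolding r(5) by (rule E.T.M.finsum_all0)
  qed
  show ?thesis
  proof (rule inj_onI)
    fix s t assume s: "s \<in> carrier TE" and t: "t \<in> carrier TE"
      and eq: "tensor_End_map K V W s = tensor_End_map K V W t"
    have "tensor_End_map K V W (s \<ominus>\<^bsub>TE\<^esub> t) = tensor_End_map K V W t \<ominus>\<^bsub>lin_End K T\<^esub> tensor_End_map K V W t"
      using module_hom_minus[OF E.T.module_axioms ET.module_axioms hom s t] eq by simp
    also have "\<dots> = \<zero>\<^bsub>lin_End K T\<^esub>"
      using module_hom_mem[OF hom t] ET.M.minus_other_side by blast
    finally have "s \<ominus>\<^bsub>TE\<^esub> t = \<zero>\<^bsub>TE\<^esub>" using s t by (intro ker E.T.M.minus_closed)
    then show "s = t" using s t by (simp add: E.T.M.minus_other_side)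
  qed
qed

lemma tensor_End_map_image_submodule:
  "submodule K (tensor_End_map K V W ` carrier TE) (lin_End K T)"
proof -
  interpret E: tensor_pair K "lin_End K V" "lin_End K W" by (rule End_pair)
  interpret mod_hom K TE "lin_End K T" "tensor_End_map K V W"
    using tensor_End_map_hom E.T.module_axioms ET.module_axioms by (simp add: mod_hom_def mod_hom_axioms_def)
  show ?thesis using im_is_submodule by (simp add: im_def)
qed

lemma tensor_map_in_image:
  assumes "\<phi> \<in> carrier (lin_End K V)" "\<alpha> \<in> carrier (lin_End K W)"
  shows "tensor_map K V W \<phi> \<alpha> \<in> tensor_End_map K V W ` carrier TE"
proof -
  interpret E: tensor_pair K "lin_End K V" "lin_End K W" by (rule End_pair)
  show ?thesis using tensor_End_map_pure[OF assms] E.pure_mem[OF assms] by (metis imageI)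
qed

text \<open>With a basis \<open>B\<close> of \<open>W\<close> and dual basis \<open>g\<close>, the identity of \<open>W\<close> is the sum of the rank one maps
  \<open>y \<mapsto> g\<^sub>b(y) b\<close>. Inserting it before and after \<open>\<Phi>\<close> writes \<open>\<Phi>\<close> as a double sum over \<open>b', b \<in> B\<close> of
  \<open>\<phi> b' b \<otimes> \<alpha> b' b\<close>, where \<open>\<alpha> b' b\<close> is the rank one map taking \<open>b'\<close> to \<open>b\<close> and \<open>\<phi> b' b\<close> is the
  corresponding matrix entry of \<open>\<Phi>\<close>, an endomorphism of \<open>V\<close>.\<close>

lemma tensor_End_map_surj_right:
  assumes "W.fin_dim" and \<Phi>: "\<Phi> \<in> carrier (lin_End K T)"
  shows "\<Phi> \<in> tensor_End_map K V W ` carrier TE"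
proof -
  have \<Phi>h: "\<Phi> \<in> module_hom K T T" using \<Phi> by simp
  obtain B g where B: "finite B" "B \<subseteq> carrier W" and g: "\<And>b. b \<in> B \<Longrightarrow> functional K W (g b)"
    and dual: "\<And>y. y \<in> carrier W \<Longrightarrow> (\<Oplus>\<^bsub>W\<^esub>b\<in>B. g b y \<odot>\<^bsub>W\<^esub> b) = y"
    using W.finite_dual_basis_exists[OF assms(1)] by blast
  have Bc: "b \<in> carrier W" if "b \<in> B" for b using that B by blast
  define \<phi> where "\<phi> b' b = (\<lambda>x\<in>carrier V. contract_right (g b) (\<Phi> (x \<otimes>\<^sub>p b')))" for b' b
  define \<alpha> where "\<alpha> b' b = (\<lambda>y\<in>carrier W. g b' y \<odot>\<^bsub>W\<^esub> b)" for b' b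
  have \<phi>: "\<phi> b' b \<in> carrier (lin_End K V)" if b: "b' \<in> B" "b \<in> B" for b' b
    unfolding \<phi>_def
  proof (rule lin_End_restrict[OF V.module_axioms], rule module_homI)
    note h = contract_right(1)[OF g[OF b(2)]]
    show "contract_right (g b) (\<Phi> (x \<otimes>\<^sub>p b')) \<in> carrier V" if "x \<in> carrier V" for x
      using that Bc[OF b(1)] by (intro module_hom_mem[OF h] module_hom_mem[OF \<Phi>h] pure_mem)
    show "contract_right (g b) (\<Phi> ((x \<oplus>\<^bsub>V\<^esub> y) \<otimes>\<^sub>p b'))
      = contract_right (g b) (\<Phi> (x \<otimes>\<^sub>p b')) \<oplus>\<^bsub>V\<^esub> contract_right (g b) (\<Phi> (y \<otimes>\<^sub>p b'))"
      if "x \<in> carrier V" "y \<in> carrier V" for x y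
      using that Bc[OF b(1)]
      by (simp add: pure_add_left module_hom_add[OF \<Phi>h] module_hom_add[OF h] module_hom_mem[OF \<Phi>h])
    show "contract_right (g b) (\<Phi> ((c \<odot>\<^bsub>V\<^esub> x) \<otimes>\<^sub>p b')) = c \<odot>\<^bsub>V\<^esub> contract_right (g b) (\<Phi> (x \<otimes>\<^sub>p b'))"
      if "c \<in> carrier K" "x \<in> carrier V" for c x
      using that Bc[OF b(1)]
      by (simp add: pure_smult_left module_hom_smult[OF \<Phi>h] module_hom_smult[OF h] module_hom_mem[OF \<Phi>h])
  qed
  have \<alpha>: "\<alpha> b' b \<in> carrier (lin_End K W)" if b: "b' \<in> B" "b \<in> B" for b' b
    unfolding \<alpha>_def
    by (rule lin_End_restrict[OF W.module_axioms functional_smult_hom[OF W.module_axioms g[OF b(1)] Bc[OF b(2)]]])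
  have expand: "(\<Oplus>\<^bsub>T\<^esub>b\<in>B. contract_right (g b) t \<otimes>\<^sub>p b) = t" if t: "t \<in> carrier T" for t
  proof (rule tensor_hom_eqI[OF T.module_axioms _ _ _ t])
    have "(\<lambda>t. contract_right (g b) t \<otimes>\<^sub>p b) \<in> module_hom K T T" if b: "b \<in> B" for b
    proof -
      note h = contract_right(1)[OF g[OF b]]
      show ?thesis using Bc[OF b]
        by (intro module_homI) (simp_all add: module_hom_mem[OF h] module_hom_add[OF h] module_hom_smult[OF h]
          pure_add_left pure_smult_left)
    qed
    then show "(\<lambda>t. \<Oplus>\<^bsub>T\<^esub>b\<in>B. contract_right (g b) t \<otimes>\<^sub>p b) \<in> module_hom K T T"
      by (rule finsum_hom[OF T.module_axioms T.module_axioms])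
    show "(\<lambda>t. t) \<in> module_hom K T T" by (rule module_homI) auto
    fix x y assume x: "x \<in> carrier V" and y: "y \<in> carrier W"
    have gy: "g b y \<in> carrier K" if "b \<in> B" for b using functional_simps(1)[OF g[OF that] y] .
    have "(\<Oplus>\<^bsub>T\<^esub>b\<in>B. contract_right (g b) (x \<otimes>\<^sub>p y) \<otimes>\<^sub>p b) = (\<Oplus>\<^bsub>T\<^esub>b\<in>B. x \<otimes>\<^sub>p (g b y \<odot>\<^bsub>W\<^esub> b))"
      using x y Bc gy
      by (intro T.M.finsum_cong') (simp_all add: contract_right(2)[OF g] pure_smult_left pure_smult_right Pi_iff)
    also have "\<dots> = x \<otimes>\<^sub>p (\<Oplus>\<^bsub>W\<^esub>b\<in>B. g b y \<odot>\<^bsub>W\<^esub> b)"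
      using Bc gy by (intro module_hom_finsum[OF W.module_axioms T.module_axioms bilinear_right[OF pure_bilinear x], symmetric]) auto
    finally show "(\<Oplus>\<^bsub>T\<^esub>b\<in>B. contract_right (g b) (x \<otimes>\<^sub>p y) \<otimes>\<^sub>p b) = x \<otimes>\<^sub>p y"
      unfolding dual[OF y] .
  qed
  let ?S = "\<Oplus>\<^bsub>lin_End K T\<^esub>b'\<in>B. \<Oplus>\<^bsub>lin_End K T\<^esub>b\<in>B. tensor_map K V W (\<phi> b' b) (\<alpha> b' b)"
  have tm: "tensor_map K V W (\<phi> b' b) (\<alpha> b' b) \<in> carrier (lin_End K T)" if "b' \<in> B" "b \<in> B" for b' b
    using tensor_map_mem[OF \<phi>[OF that] \<alpha>[OF that]] .
  then have inner: "(\<Oplus>\<^bsub>lin_End K T\<^esub>b\<in>B. tensor_map K V W (\<phi> b' b) (\<alpha> b' b)) \<in> carrier (lin_End K T)" if "b' \<in> B" for b'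
    using that by (intro ET.M.finsum_closed) blast
  have "?S = \<Phi>"
  proof (rule lin_End_tensor_eqI[OF _ \<Phi>])
    show "?S \<in> carrier (lin_End K T)" using inner by (intro ET.M.finsum_closed) blast
    fix x y assume x: "x \<in> carrier V" and y: "y \<in> carrier W"
    have gy: "g b y \<in> carrier K" if "b \<in> B" for b using functional_simps(1)[OF g[OF that] y] .
    have \<Phi>x: "\<Phi> (x \<otimes>\<^sub>p b) \<in> carrier T" if "b \<in> B" for b
      using module_hom_mem[OF \<Phi>h pure_mem[OF x Bc[OF that]]] .
    have inner_eq: "(\<Oplus>\<^bsub>lin_End K T\<^esub>b\<in>B. tensor_map K V W (\<phi> b' b) (\<alpha> b' b)) (x \<otimes>\<^sub>p y) = \<Phi> (x \<otimes>\<^sub>p (g b' y \<odot>\<^bsub>W\<^esub> b'))"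
      if b': "b' \<in> B" for b'
    proof -
      have cr: "contract_right (g b) (\<Phi> (x \<otimes>\<^sub>p b')) \<in> carrier V" if "b \<in> B" for b
        using module_hom_mem[OF contract_right(1)[OF g[OF that]] \<Phi>x[OF b']] .
      have "(\<Oplus>\<^bsub>lin_End K T\<^esub>b\<in>B. tensor_map K V W (\<phi> b' b) (\<alpha> b' b)) (x \<otimes>\<^sub>p y)
          = (\<Oplus>\<^bsub>T\<^esub>b\<in>B. \<phi> b' b x \<otimes>\<^sub>p \<alpha> b' b y)"
        using \<phi>[OF b'] \<alpha>[OF b'] by (intro tensor_map_finsum_pure[OF _ _ x y]) blast+
      also have "\<dots> = (\<Oplus>\<^bsub>T\<^esub>b\<in>B. g b' y \<odot>\<^bsub>T\<^esub> (contract_right (g b) (\<Phi> (x \<otimes>\<^sub>p b')) \<otimes>\<^sub>p b))"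
        using x y gy[OF b'] Bc cr
        by (intro T.M.finsum_cong') (simp_all add: \<phi>_def \<alpha>_def pure_smult_right Pi_iff)
      also have "\<dots> = g b' y \<odot>\<^bsub>T\<^esub> (\<Oplus>\<^bsub>T\<^esub>b\<in>B. contract_right (g b) (\<Phi> (x \<otimes>\<^sub>p b')) \<otimes>\<^sub>p b)"
        using gy[OF b'] Bc cr by (intro T.finsum_smult[symmetric]) (simp_all add: Pi_iff)
      also have "\<dots> = g b' y \<odot>\<^bsub>T\<^esub> \<Phi> (x \<otimes>\<^sub>p b')" unfolding expand[OF \<Phi>x[OF b']] ..
      also have "\<dots> = \<Phi> (x \<otimes>\<^sub>p (g b' y \<odot>\<^bsub>W\<^esub> b'))"
        using x Bc[OF b'] gy[OF b'] by (simp add: pure_smult_right module_hom_smult[OF \<Phi>h])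
      finally show ?thesis .
    qed
    have mem2: "g b y \<odot>\<^bsub>W\<^esub> b \<in> carrier W" if "b \<in> B" for b using that gy Bc by blast
    have "?S (x \<otimes>\<^sub>p y) = (\<Oplus>\<^bsub>T\<^esub>b'\<in>B. (\<Oplus>\<^bsub>lin_End K T\<^esub>b\<in>B. tensor_map K V W (\<phi> b' b) (\<alpha> b' b)) (x \<otimes>\<^sub>p y))"
      using inner x y by (intro lin_End_finsum_apply[OF T.vectorspace_axioms] pure_mem) blast+
    also have "\<dots> = (\<Oplus>\<^bsub>T\<^esub>b'\<in>B. \<Phi> (x \<otimes>\<^sub>p (g b' y \<odot>\<^bsub>W\<^esub> b')))"
      using inner_eq module_hom_mem[OF \<Phi>h pure_mem[OF x mem2]] by (intro T.M.finsum_cong') (simp_all add: Pi_iff)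
    also have "\<dots> = \<Phi> (\<Oplus>\<^bsub>T\<^esub>b'\<in>B. x \<otimes>\<^sub>p (g b' y \<odot>\<^bsub>W\<^esub> b'))"
      using pure_mem[OF x mem2] by (intro module_hom_finsum[OF T.module_axioms T.module_axioms \<Phi>h, symmetric]) blast
    also have "(\<Oplus>\<^bsub>T\<^esub>b'\<in>B. x \<otimes>\<^sub>p (g b' y \<odot>\<^bsub>W\<^esub> b')) = x \<otimes>\<^sub>p (\<Oplus>\<^bsub>W\<^esub>b'\<in>B. g b' y \<odot>\<^bsub>W\<^esub> b')"
      using mem2 by (intro module_hom_finsum[OF W.module_axioms T.module_axioms bilinear_right[OF pure_bilinear x], symmetric]) blast
    finally show "?S (x \<otimes>\<^sub>p y) = \<Phi> (x \<otimes>\<^sub>p y)" unfolding dual[OF y] .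
  qed
  moreover have "?S \<in> tensor_End_map K V W ` carrier TE"
    using tensor_map_in_image[OF \<phi> \<alpha>]
    by (intro submodule_finsum_closed[OF tensor_End_map_image_submodule] funcsetI) blast
  ultimately show ?thesis by simp
qed

text \<open>The mirror image: the matrix of \<open>\<Phi>\<close> with respect to a basis of \<open>V\<close> has entries in \<open>End W\<close>.\<close>

lemma tensor_End_map_surj_left:
  assumes "V.fin_dim" and \<Phi>: "\<Phi> \<in> carrier (lin_End K T)"
  shows "\<Phi> \<in> tensor_End_map K V W ` carrier TE"
proof -
  have \<Phi>h: "\<Phi> \<in> module_hom K T T" using \<Phi> by simp
  obtain B g where B: "finite B" "B \<subseteq> carrier V" and g: "\<And>b. b \<in> B \<Longrightarrow> functional K V (g b)"
    and dual: "\<And>x. x \<in> carrier V \<Longrightarrow> (\<Oplus>\<^bsub>V\<^esub>b\<in>B. g b x \<odot>\<^bsub>V\<^esub> b) = x"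
    using V.finite_dual_basis_exists[OF assms(1)] by blast
  have Bc: "b \<in> carrier V" if "b \<in> B" for b using that B by blast
  define \<alpha> where "\<alpha> b' b = (\<lambda>y\<in>carrier W. contract_left (g b) (\<Phi> (b' \<otimes>\<^sub>p y)))" for b' b
  define \<phi> where "\<phi> b' b = (\<lambda>x\<in>carrier V. g b' x \<odot>\<^bsub>V\<^esub> b)" for b' b
  have \<alpha>: "\<alpha> b' b \<in> carrier (lin_End K W)" if b: "b' \<in> B" "b \<in> B" for b' b
    unfolding \<alpha>_def
  proof (rule lin_End_restrict[OF W.module_axioms], rule module_homI)
    note h = contract_left(1)[OF g[OF b(2)]]
    show "contract_left (g b) (\<Phi> (b' \<otimes>\<^sub>p y)) \<in> carrier W" if "y \<in> carrier W" for y
      using that Bc[OF b(1)] by (intro module_hom_mem[OF h] module_hom_mem[OF \<Phi>h] pure_mem)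
    show "contract_left (g b) (\<Phi> (b' \<otimes>\<^sub>p (x \<oplus>\<^bsub>W\<^esub> y)))
      = contract_left (g b) (\<Phi> (b' \<otimes>\<^sub>p x)) \<oplus>\<^bsub>W\<^esub> contract_left (g b) (\<Phi> (b' \<otimes>\<^sub>p y))"
      if "x \<in> carrier W" "y \<in> carrier W" for x y
      using that Bc[OF b(1)]
      by (simp add: pure_add_right module_hom_add[OF \<Phi>h] module_hom_add[OF h] module_hom_mem[OF \<Phi>h])
    show "contract_left (g b) (\<Phi> (b' \<otimes>\<^sub>p (c \<odot>\<^bsub>W\<^esub> y))) = c \<odot>\<^bsub>W\<^esub> contract_left (g b) (\<Phi> (b' \<otimes>\<^sub>p y))"
      if "c \<in> carrier K" "y \<in> carrier W" for c y
      using that Bc[OF b(1)]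
      by (simp add: pure_smult_right module_hom_smult[OF \<Phi>h] module_hom_smult[OF h] module_hom_mem[OF \<Phi>h])
  qed
  have \<phi>: "\<phi> b' b \<in> carrier (lin_End K V)" if b: "b' \<in> B" "b \<in> B" for b' b
    unfolding \<phi>_def
    by (rule lin_End_restrict[OF V.module_axioms functional_smult_hom[OF V.module_axioms g[OF b(1)] Bc[OF b(2)]]])
  have expand: "(\<Oplus>\<^bsub>T\<^esub>b\<in>B. b \<otimes>\<^sub>p contract_left (g b) t) = t" if t: "t \<in> carrier T" for t
  proof (rule tensor_hom_eqI[OF T.module_axioms _ _ _ t])
    have "(\<lambda>t. b \<otimes>\<^sub>p contract_left (g b) t) \<in> module_hom K T T" if b: "b \<in> B" for b
    proof -
      note h = contract_left(1)[OF g[OF b]]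
      show ?thesis using Bc[OF b]
        by (intro module_homI) (simp_all add: module_hom_mem[OF h] module_hom_add[OF h] module_hom_smult[OF h]
          pure_add_right pure_smult_right)
    qed
    then show "(\<lambda>t. \<Oplus>\<^bsub>T\<^esub>b\<in>B. b \<otimes>\<^sub>p contract_left (g b) t) \<in> module_hom K T T"
      by (rule finsum_hom[OF T.module_axioms T.module_axioms])
    show "(\<lambda>t. t) \<in> module_hom K T T" by (rule module_homI) auto
    fix x y assume x: "x \<in> carrier V" and y: "y \<in> carrier W"
    have gx: "g b x \<in> carrier K" if "b \<in> B" for b using functional_simps(1)[OF g[OF that] x] .
    have "(\<Oplus>\<^bsub>T\<^esub>b\<in>B. b \<otimes>\<^sub>p contract_left (g b) (x \<otimes>\<^sub>p y)) = (\<Oplus>\<^bsub>T\<^esub>b\<in>B. (g b x \<odot>\<^bsub>V\<^esub> b) \<otimes>\<^sub>p y)"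
      using x y Bc gx
      by (intro T.M.finsum_cong') (simp_all add: contract_left(2)[OF g] pure_smult_left pure_smult_right Pi_iff)
    also have "\<dots> = (\<Oplus>\<^bsub>V\<^esub>b\<in>B. g b x \<odot>\<^bsub>V\<^esub> b) \<otimes>\<^sub>p y"
      using Bc gx by (intro module_hom_finsum[OF V.module_axioms T.module_axioms bilinear_left[OF pure_bilinear y], symmetric]) auto
    finally show "(\<Oplus>\<^bsub>T\<^esub>b\<in>B. b \<otimes>\<^sub>p contract_left (g b) (x \<otimes>\<^sub>p y)) = x \<otimes>\<^sub>p y"
      unfolding dual[OF x] .
  qed
  let ?S = "\<Oplus>\<^bsub>lin_End K T\<^esub>b'\<in>B. \<Oplus>\<^bsub>lin_End K T\<^esub>b\<in>B. tensor_map K V W (\<phi> b' b) (\<alpha> b' b)"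
  have tm: "tensor_map K V W (\<phi> b' b) (\<alpha> b' b) \<in> carrier (lin_End K T)" if "b' \<in> B" "b \<in> B" for b' b
    using tensor_map_mem[OF \<phi>[OF that] \<alpha>[OF that]] .
  then have inner: "(\<Oplus>\<^bsub>lin_End K T\<^esub>b\<in>B. tensor_map K V W (\<phi> b' b) (\<alpha> b' b)) \<in> carrier (lin_End K T)" if "b' \<in> B" for b'
    using that by (intro ET.M.finsum_closed) blast
  have "?S = \<Phi>"
  proof (rule lin_End_tensor_eqI[OF _ \<Phi>])
    show "?S \<in> carrier (lin_End K T)" using inner by (intro ET.M.finsum_closed) blast
    fix x y assume x: "x \<in> carrier V" and y: "y \<in> carrier W"
    have gx: "g b x \<in> carrier K" if "b \<in> B" for b using functional_simps(1)[OF g[OF that] x] .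
    have \<Phi>x: "\<Phi> (b \<otimes>\<^sub>p y) \<in> carrier T" if "b \<in> B" for b
      using module_hom_mem[OF \<Phi>h pure_mem[OF Bc[OF that] y]] .
    have inner_eq: "(\<Oplus>\<^bsub>lin_End K T\<^esub>b\<in>B. tensor_map K V W (\<phi> b' b) (\<alpha> b' b)) (x \<otimes>\<^sub>p y) = \<Phi> ((g b' x \<odot>\<^bsub>V\<^esub> b') \<otimes>\<^sub>p y)"
      if b': "b' \<in> B" for b'
    proof -
      have cl: "contract_left (g b) (\<Phi> (b' \<otimes>\<^sub>p y)) \<in> carrier W" if "b \<in> B" for b
        using module_hom_mem[OF contract_left(1)[OF g[OF that]] \<Phi>x[OF b']] .
      have "(\<Oplus>\<^bsub>lin_End K T\<^esub>b\<in>B. tensor_map K V W (\<phi> b' b) (\<alpha> b' b)) (x \<otimes>\<^sub>p y)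
          = (\<Oplus>\<^bsub>T\<^esub>b\<in>B. \<phi> b' b x \<otimes>\<^sub>p \<alpha> b' b y)"
        using \<phi>[OF b'] \<alpha>[OF b'] by (intro tensor_map_finsum_pure[OF _ _ x y]) blast+
      also have "\<dots> = (\<Oplus>\<^bsub>T\<^esub>b\<in>B. g b' x \<odot>\<^bsub>T\<^esub> (b \<otimes>\<^sub>p contract_left (g b) (\<Phi> (b' \<otimes>\<^sub>p y))))"
        using x y gx[OF b'] Bc cl
        by (intro T.M.finsum_cong') (simp_all add: \<phi>_def \<alpha>_def pure_smult_left Pi_iff)
      also have "\<dots> = g b' x \<odot>\<^bsub>T\<^esub> (\<Oplus>\<^bsub>T\<^esub>b\<in>B. b \<otimes>\<^sub>p contract_left (g b) (\<Phi> (b' \<otimes>\<^sub>p y)))"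
        using gx[OF b'] Bc cl by (intro T.finsum_smult[symmetric]) (simp_all add: Pi_iff)
      also have "\<dots> = g b' x \<odot>\<^bsub>T\<^esub> \<Phi> (b' \<otimes>\<^sub>p y)" unfolding expand[OF \<Phi>x[OF b']] ..
      also have "\<dots> = \<Phi> ((g b' x \<odot>\<^bsub>V\<^esub> b') \<otimes>\<^sub>p y)"
        using y Bc[OF b'] gx[OF b'] by (simp add: pure_smult_left module_hom_smult[OF \<Phi>h])
      finally show ?thesis .
    qed
    have mem2: "g b x \<odot>\<^bsub>V\<^esub> b \<in> carrier V" if "b \<in> B" for b using that gx Bc by blast
    have "?S (x \<otimes>\<^sub>p y) = (\<Oplus>\<^bsub>T\<^esub>b'\<in>B. (\<Oplus>\<^bsub>lin_End K T\<^esub>b\<in>B. tensor_map K V W (\<phi> b' b) (\<alpha> b' b)) (x \<otimes>\<^sub>p y))"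
      using inner x y by (intro lin_End_finsum_apply[OF T.vectorspace_axioms] pure_mem) blast+
    also have "\<dots> = (\<Oplus>\<^bsub>T\<^esub>b'\<in>B. \<Phi> ((g b' x \<odot>\<^bsub>V\<^esub> b') \<otimes>\<^sub>p y))"
      using inner_eq module_hom_mem[OF \<Phi>h pure_mem[OF mem2 y]] by (intro T.M.finsum_cong') (simp_all add: Pi_iff)
    also have "\<dots> = \<Phi> (\<Oplus>\<^bsub>T\<^esub>b'\<in>B. (g b' x \<odot>\<^bsub>V\<^esub> b') \<otimes>\<^sub>p y)"
      using pure_mem[OF mem2 y] by (intro module_hom_finsum[OF T.module_axioms T.module_axioms \<Phi>h, symmetric]) blast
    also have "(\<Oplus>\<^bsub>T\<^esub>b'\<in>B. (g b' x \<odot>\<^bsub>V\<^esub> b') \<otimes>\<^sub>p y) = (\<Oplus>\<^bsub>V\<^esub>b'\<in>B. g b' x \<odot>\<^bsub>V\<^esub> b') \<otimes>\<^sub>p y"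
      using mem2 by (intro module_hom_finsum[OF V.module_axioms T.module_axioms bilinear_left[OF pure_bilinear y], symmetric]) blast
    finally show "?S (x \<otimes>\<^sub>p y) = \<Phi> (x \<otimes>\<^sub>p y)" unfolding dual[OF x] .
  qed
  moreover have "?S \<in> tensor_End_map K V W ` carrier TE"
    using tensor_map_in_image[OF \<phi> \<alpha>]
    by (intro submodule_finsum_closed[OF tensor_End_map_image_submodule] funcsetI) blast
  ultimately show ?thesis by simp
qed

text \<open>The kernel of \<open>h \<otimes> id\<close> is \<open>ker h \<otimes> End W\<close>, for all \<open>h \<in> H\<close> at once: on a representation with independent
  second factors each \<open>h\<close> has to kill every first factor. The hypothesis is tested pointwise in
  \<open>y\<close> and does not depend on the representation, because \<open>\<phi> \<otimes> \<alpha> \<mapsto> h(\<phi>) \<otimes> \<alpha>(y)\<close> is well defined on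
  \<open>End V \<otimes> End W\<close>.\<close>

lemma TE_reduce_kernel:
  assumes H: "\<And>h. h \<in> H \<Longrightarrow> h \<in> module_hom K (lin_End K V) V"
    and I: "finite (I :: 'i set)" "\<phi> \<in> I \<rightarrow> carrier (lin_End K V)" "\<alpha> \<in> I \<rightarrow> carrier (lin_End K W)"
    and zero: "\<And>h y. \<lbrakk>h \<in> H; y \<in> carrier W\<rbrakk> \<Longrightarrow> (\<Oplus>\<^bsub>T\<^esub>i\<in>I. h (\<phi> i) \<otimes>\<^sub>p \<alpha> i y) = \<zero>\<^bsub>T\<^esub>"
  shows "\<exists>J \<psi>. J \<subseteq> I \<and> \<psi> \<in> J \<rightarrow> carrier (lin_End K V) \<and> (\<forall>j\<in>J. \<forall>h\<in>H. h (\<psi> j) = \<zero>\<^bsub>V\<^esub>)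
    \<and> (\<Oplus>\<^bsub>TE\<^esub>i\<in>I. \<phi> i \<otimes>\<^sub>E \<alpha> i) = (\<Oplus>\<^bsub>TE\<^esub>i\<in>J. \<psi> i \<otimes>\<^sub>E \<alpha> i)"
proof -
  interpret E: tensor_pair K "lin_End K V" "lin_End K W" by (rule End_pair)
  obtain J \<psi> where J: "J \<subseteq> I" "\<psi> \<in> J \<rightarrow> carrier (lin_End K V)" "independent_family K (lin_End K W) J \<alpha>"
    "(\<Oplus>\<^bsub>TE\<^esub>i\<in>I. \<phi> i \<otimes>\<^sub>E \<alpha> i) = (\<Oplus>\<^bsub>TE\<^esub>i\<in>J. \<psi> i \<otimes>\<^sub>E \<alpha> i)"
    using E.tensor_reduce_independent[OF I] by blast
  have \<alpha>J: "\<alpha> \<in> J \<rightarrow> carrier (lin_End K W)" using I(3) J(1) by blast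
  have "h (\<psi> j) = \<zero>\<^bsub>V\<^esub>" if j: "j \<in> J" and h: "h \<in> H" for j h
  proof (rule independent_maps_coefficients_zero[OF J(3) \<alpha>J _ _ j])
    note hm = module_hom_mem[OF H[OF h]]
    show "(\<lambda>i. h (\<psi> i)) \<in> J \<rightarrow> carrier V" using J(2) hm by blast
    fix y assume y: "y \<in> carrier W"
    \<comment> \<open>The map \<open>\<phi> \<otimes> \<alpha> \<mapsto> h(\<phi>) \<otimes> \<alpha>(y)\<close> carries the hypothesis from one representation to the other.\<close>
    let ?e = "tensor_lift K (lin_End K V) (lin_End K W) T (\<lambda>\<phi> \<alpha>. h \<phi> \<otimes>\<^sub>p \<alpha> y)"
    have b: "bilinear K (lin_End K V) (lin_End K W) T (\<lambda>\<phi> \<alpha>. h \<phi> \<otimes>\<^sub>p \<alpha> y)"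
    proof (intro bilinearI)
      fix \<phi> assume \<phi>: "\<phi> \<in> carrier (lin_End K V)"
      note ev = lin_End_eval_hom[OF W.module_axioms y]
      show "(\<lambda>\<alpha>. h \<phi> \<otimes>\<^sub>p \<alpha> y) \<in> module_hom K (lin_End K W) T"
        by (rule module_homI)
          (simp_all del: lin_End_simps add: hm[OF \<phi>] module_hom_mem[OF ev] module_hom_add[OF ev]
            module_hom_smult[OF ev] pure_add_right pure_smult_right)
    next
      fix \<alpha> assume \<alpha>: "\<alpha> \<in> carrier (lin_End K W)"
      show "(\<lambda>\<phi>. h \<phi> \<otimes>\<^sub>p \<alpha> y) \<in> module_hom K (lin_End K V) T"
        by (rule module_homI)
          (simp_all del: lin_End_simps add: hm lin_apply'[OF \<alpha> y] module_hom_add[OF H[OF h]]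
            module_hom_smult[OF H[OF h]] pure_add_left pure_smult_left)
    qed
    have e: "?e (\<Oplus>\<^bsub>TE\<^esub>i\<in>S. \<rho> i \<otimes>\<^sub>E \<alpha> i) = (\<Oplus>\<^bsub>T\<^esub>i\<in>S. h (\<rho> i) \<otimes>\<^sub>p \<alpha> i y)"
      if \<rho>: "\<rho> \<in> S \<rightarrow> carrier (lin_End K V)" and \<alpha>: "\<alpha> \<in> S \<rightarrow> carrier (lin_End K W)" for S \<rho>
    proof -
      have m: "\<rho> i \<in> carrier (lin_End K V)" "\<alpha> i \<in> carrier (lin_End K W)" if "i \<in> S" for i
        using \<rho> \<alpha> that by blast+
      have "?e (\<Oplus>\<^bsub>TE\<^esub>i\<in>S. \<rho> i \<otimes>\<^sub>E \<alpha> i) = (\<Oplus>\<^bsub>T\<^esub>i\<in>S. ?e (\<rho> i \<otimes>\<^sub>E \<alpha> i))"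
        using E.pure_mem[OF m]
        by (intro module_hom_finsum[OF E.T.module_axioms T.module_axioms E.tensor_lift_hom[OF T.vectorspace_axioms b]]) blast
      also have "\<dots> = (\<Oplus>\<^bsub>T\<^esub>i\<in>S. h (\<rho> i) \<otimes>\<^sub>p \<alpha> i y)"
        using E.tensor_lift_pure[OF T.vectorspace_axioms b m] pure_mem[OF hm[OF m(1)] lin_apply'[OF m(2) y]]
        by (intro T.M.finsum_cong') blast+
      finally show ?thesis .
    qed
    show "(\<Oplus>\<^bsub>T\<^esub>i\<in>J. h (\<psi> i) \<otimes>\<^sub>p \<alpha> i y) = \<zero>\<^bsub>T\<^esub>"
      using e[OF I(2,3)] e[OF J(2) \<alpha>J] zero[OF h y] unfolding J(4) by simp
  qed
  then show ?thesis using J by blast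
qed

end

section \<open>Hom-Lie structures for a bilinear bracket\<close>

lemma module_hom_comp:
  "\<lbrakk>f \<in> module_hom K V W; g \<in> module_hom K U V\<rbrakk> \<Longrightarrow> (\<lambda>x. f (g x)) \<in> module_hom K U W"
  by (intro module_homI) (simp_all add: module_hom_mem[of f] module_hom_mem[of g] module_hom_add[of f]
      module_hom_add[of g] module_hom_smult[of f] module_hom_smult[of g])

lemma module_hom_add_fun:
  assumes "module K W" "f \<in> module_hom K V W" "g \<in> module_hom K V W"
  shows "(\<lambda>x. f x \<oplus>\<^bsub>W\<^esub> g x) \<in> module_hom K V W"
proof -
  interpret W: module K W by fact
  note m = module_hom_mem[OF assms(2)] module_hom_mem[OF assms(3)]
  show ?thesis
    by (intro module_homI) (simp_all add: m module_hom_add[OF assms(2)] module_hom_add[OF assms(3)]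
      module_hom_smult[OF assms(2)] module_hom_smult[OF assms(3)] W.M.a_ac W.smult_r_distr)
qed

text \<open>The cyclic sum that vanishes for Hom-Lie structures, with the map as last argument because it is
  linear in it: \<open>HomLie(L)\<close> is an intersection of kernels.\<close>

definition HomLie_defect :: "('k, 'l, 'n) lie_scheme \<Rightarrow> 'l \<Rightarrow> 'l \<Rightarrow> 'l \<Rightarrow> ('l \<Rightarrow> 'l) \<Rightarrow> 'l" where
  "HomLie_defect L x y z \<phi> = bracket L (bracket L x y) (\<phi> z) \<oplus>\<^bsub>L\<^esub> bracket L (bracket L z x) (\<phi> y)
        \<oplus>\<^bsub>L\<^esub> bracket L (bracket L y z) (\<phi> x)"

lemma HomLie_iff:
  "\<phi> \<in> HomLie K L \<longleftrightarrow> \<phi> \<in> carrier (lin_End K L) \<and>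
    (\<forall>x\<in>carrier L. \<forall>y\<in>carrier L. \<forall>z\<in>carrier L. HomLie_defect L x y z \<phi> = \<zero>\<^bsub>L\<^esub>)"
  by (simp add: HomLie_def HomLie_defect_def del: lin_End_simps)

context
  fixes K :: "('k, 'm) ring_scheme" and L :: "('k, 'l, 'n) lie_scheme"
  assumes L: "vectorspace K L" and br: "bilinear K L L L (bracket L)"
begin

interpretation L: vectorspace K L by (rule L)

lemma bracket_hom_right: "x \<in> carrier L \<Longrightarrow> f \<in> module_hom K U L \<Longrightarrow> (\<lambda>u. bracket L x (f u)) \<in> module_hom K U L"
  by (rule module_hom_comp[OF bilinear_right[OF br]])

lemma bracket_bracket_hom:
  assumes "x \<in> carrier L" "y \<in> carrier L" "z \<in> carrier L"
  shows "(\<lambda>\<phi>. bracket L (bracket L x y) (\<phi> z)) \<in> module_hom K (lin_End K L) L"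
  using assms by (intro bracket_hom_right bilinear_mem[OF br] lin_End_eval_hom L.module_axioms)

lemma HomLie_defect_hom:
  assumes "x \<in> carrier L" "y \<in> carrier L" "z \<in> carrier L"
  shows "HomLie_defect L x y z \<in> module_hom K (lin_End K L) L"
  unfolding HomLie_defect_def[abs_def]
  using assms by (intro module_hom_add_fun bracket_bracket_hom L.module_axioms)

lemma HomLie_submodule: "submodule K (HomLie K L) (lin_End K L)"
proof -
  interpret E: vectorspace K "lin_End K L" by (rule lin_End_vectorspace) (rule L)
  note hom = HomLie_defect_hom
  show ?thesis
  proof
    show "HomLie K L \<subseteq> carrier (lin_End K L)" unfolding HomLie_def by blast
    show "\<zero>\<^bsub>lin_End K L\<^esub> \<in> HomLie K L"
      unfolding HomLie_iff using module_hom_zero[OF E.module_axioms L.module_axioms hom] E.M.zero_closed by blast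
    fix \<phi> \<psi> assume f: "\<phi> \<in> HomLie K L" and g: "\<psi> \<in> HomLie K L"
    have fc: "\<phi> \<in> carrier (lin_End K L)" and gc: "\<psi> \<in> carrier (lin_End K L)" using f g unfolding HomLie_iff by blast+
    have "HomLie_defect L x y z (\<phi> \<oplus>\<^bsub>lin_End K L\<^esub> \<psi>) = \<zero>\<^bsub>L\<^esub>"
      if "x \<in> carrier L" "y \<in> carrier L" "z \<in> carrier L" for x y z
      using module_hom_add[OF hom[OF that] fc gc] f g that L.M.zero_closed unfolding HomLie_iff by (simp del: lin_End_simps)
    then show "\<phi> \<oplus>\<^bsub>lin_End K L\<^esub> \<psi> \<in> HomLie K L"
      unfolding HomLie_iff using E.M.a_closed[OF fc gc] by blast
  next
    fix c \<phi> assume c: "c \<in> carrier K" and f: "\<phi> \<in> HomLie K L"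
    have fc: "\<phi> \<in> carrier (lin_End K L)" using f unfolding HomLie_iff by blast
    have "HomLie_defect L x y z (c \<odot>\<^bsub>lin_End K L\<^esub> \<phi>) = \<zero>\<^bsub>L\<^esub>"
      if "x \<in> carrier L" "y \<in> carrier L" "z \<in> carrier L" for x y z
      using module_hom_smult[OF hom[OF that] c fc] f that c unfolding HomLie_iff by (simp del: lin_End_simps)
    then show "c \<odot>\<^bsub>lin_End K L\<^esub> \<phi> \<in> HomLie K L"
      unfolding HomLie_iff using E.smult_closed[OF c fc] by blast
  qed
qed

text \<open>For fixed \<open>z\<close>, the elements \<open>d\<close> with \<open>[d, \<phi>(z)] = 0\<close> form a subspace, so vanishing on the brackets
  \<open>[x, y]\<close> carries over to their span \<open>[L, L]\<close>.\<close>

lemma derived_annihilating_iff: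
  "\<phi> \<in> derived_annihilating K L \<longleftrightarrow> \<phi> \<in> carrier (lin_End K L) \<and>
    (\<forall>x\<in>carrier L. \<forall>y\<in>carrier L. \<forall>z\<in>carrier L. bracket L (bracket L x y) (\<phi> z) = \<zero>\<^bsub>L\<^esub>)"
proof (cases "\<phi> \<in> carrier (lin_End K L)")
  case False
  then show ?thesis unfolding derived_annihilating_def by blast
next
  case True
  have \<phi>: "\<phi> z \<in> carrier L" if "z \<in> carrier L" for z using True that by (auto simp: module_hom_mem)
  let ?B = "{bracket L x y | x y. x \<in> carrier L \<and> y \<in> carrier L}"
  have B: "?B \<subseteq> carrier L" using bilinear_mem[OF br] by blast
  let ?D = "L.span ?B"
  let ?C = "{bracket L d w | d w. d \<in> ?D \<and> w \<in> \<phi> ` carrier L}"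
  have D: "?D \<subseteq> carrier L" by (rule L.span_is_subset2[OF B])
  have C: "?C \<subseteq> carrier L" using bilinear_mem[OF br] D \<phi> by blast
  have "L.span ?C = {\<zero>\<^bsub>L\<^esub>} \<longleftrightarrow>
    (\<forall>x\<in>carrier L. \<forall>y\<in>carrier L. \<forall>z\<in>carrier L. bracket L (bracket L x y) (\<phi> z) = \<zero>\<^bsub>L\<^esub>)" (is "?l \<longleftrightarrow> ?r")
  proof
    assume l: ?l
    show ?r
    proof (intro ballI)
      fix x y z assume xyz: "x \<in> carrier L" "y \<in> carrier L" "z \<in> carrier L"
      have "bracket L x y \<in> ?B" using xyz by blast
      then have "bracket L x y \<in> ?D" using L.in_own_span[OF B] by blast
      then have "bracket L (bracket L x y) (\<phi> z) \<in> ?C" using xyz by blast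
      then have "bracket L (bracket L x y) (\<phi> z) \<in> L.span ?C" using L.in_own_span[OF C] by blast
      then show "bracket L (bracket L x y) (\<phi> z) = \<zero>\<^bsub>L\<^esub>" unfolding l by blast
    qed
  next
    assume r: ?r
    have "?D \<subseteq> {d \<in> carrier L. bracket L d (\<phi> z) = \<zero>\<^bsub>L\<^esub>}" if z: "z \<in> carrier L" for z
    proof (rule L.span_is_subset)
      show "submodule K {d \<in> carrier L. bracket L d (\<phi> z) = \<zero>\<^bsub>L\<^esub>} L"
        by (rule ker_submodule[OF L.module_axioms L.module_axioms bilinear_left[OF br \<phi>[OF z]]])
      show "?B \<subseteq> {d \<in> carrier L. bracket L d (\<phi> z) = \<zero>\<^bsub>L\<^esub>}" using r z B by blast
    qed
    then have "?C \<subseteq> {\<zero>\<^bsub>L\<^esub>}" by blast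
    moreover have "submodule K {\<zero>\<^bsub>L\<^esub>} L" by unfold_locales auto
    ultimately have "L.span ?C \<subseteq> {\<zero>\<^bsub>L\<^esub>}" by (rule L.span_is_subset)
    moreover have "\<zero>\<^bsub>L\<^esub> \<in> L.span ?C"
      using submodule.zero_closed[OF L.span_is_submodule[OF C]] .
    ultimately show ?l by blast
  qed
  then show ?thesis unfolding derived_annihilating_def bracket_span_def using True by blast
qed

end

section \<open>The current algebra\<close>

lemma (in lie_algebra) bracket_bilinear: "bilinear K L L L (bracket L)"
  by (intro bilinearI module_homI)
    (simp_all add: bracket_closed bracket_add_left bracket_add_right bracket_smult_left bracket_smult_right)

locale current_pair = Lie: lie_algebra K L + Alg: algebra K A
  for K :: "('k, 'm) ring_scheme" and L :: "('k, 'l, 'n) lie_scheme" and A :: "('k, 'a, 'o) module_scheme"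

sublocale current_pair \<subseteq> tensor_pair K L A
  by (simp add: tensor_pair_def Lie.vectorspace_axioms vectorspaceI Lie.field_axioms Alg.module_axioms)

context current_pair
begin

notation pure (infixl \<open>\<otimes>\<^sub>p\<close> 75)
notation pure_End (infixl \<open>\<otimes>\<^sub>E\<close> 75)

abbreviation C where "C \<equiv> current_lie K L A"

lemma mult_bilinear: "bilinear K A A A (\<otimes>\<^bsub>A\<^esub>)"
proof (intro bilinearI module_homI)
  fix c x y assume "x \<in> carrier A" "c \<in> carrier K" "y \<in> carrier A"
  then show "x \<otimes>\<^bsub>A\<^esub> (c \<odot>\<^bsub>A\<^esub> y) = c \<odot>\<^bsub>A\<^esub> (x \<otimes>\<^bsub>A\<^esub> y)"
    using Alg.smult_assoc2[of c y x] by (simp add: Alg.m_comm)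
qed (simp_all add: Alg.l_distr Alg.r_distr Alg.smult_assoc2)

lemma current_simps [simp]:
  "carrier C = carrier T" "\<zero>\<^bsub>C\<^esub> = \<zero>\<^bsub>T\<^esub>" "x \<oplus>\<^bsub>C\<^esub> y = x \<oplus>\<^bsub>T\<^esub> y" "c \<odot>\<^bsub>C\<^esub> x = c \<odot>\<^bsub>T\<^esub> x"
  by (simp_all add: current_lie_def module.defs)

lemma current_hom_eq: "module_hom K C C = module_hom K T T" "module_hom K C T = module_hom K T T"
  "module_hom K T C = module_hom K T T"
  by (simp_all add: module_hom_def)

lemma lin_End_current: "lin_End K C = lin_End K T"
  by (simp add: lin_End_def current_hom_eq)

lemma bilinear_current: "bilinear K C C C \<beta> \<longleftrightarrow> bilinear K T T T \<beta>"
  by (simp add: bilinear_def current_hom_eq)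

abbreviation pure_bracket where
  "pure_bracket x a \<equiv> tensor_lift K L A T (\<lambda>y b. bracket L x y \<otimes>\<^sub>p (a \<otimes>\<^bsub>A\<^esub> b))"

lemma bracket_current:
  "bracket C s t = tensor_lift K L A T (\<lambda>x a. pure_bracket x a t) s"
  by (simp add: current_lie_def module.defs lie.defs)

lemma pure_bracket:
  assumes "x \<in> carrier L" "a \<in> carrier A"
  shows "pure_bracket x a \<in> module_hom K T T"
    and "\<lbrakk>y \<in> carrier L; b \<in> carrier A\<rbrakk> \<Longrightarrow> pure_bracket x a (y \<otimes>\<^sub>p b) = bracket L x y \<otimes>\<^sub>p (a \<otimes>\<^bsub>A\<^esub> b)"
proof -
  have b: "bilinear K L A T (\<lambda>y b. bracket L x y \<otimes>\<^sub>p (a \<otimes>\<^bsub>A\<^esub> b))"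
  proof (rule bilinearI)
    fix y assume "y \<in> carrier L"
    then have "bracket L x y \<in> carrier L" using assms(1) by (simp add: Lie.bracket_closed)
    from module_hom_comp[OF bilinear_right[OF pure_bilinear this] bilinear_right[OF mult_bilinear assms(2)]]
    show "(\<lambda>b. bracket L x y \<otimes>\<^sub>p (a \<otimes>\<^bsub>A\<^esub> b)) \<in> module_hom K A T" .
  next
    fix b assume "b \<in> carrier A"
    then have "a \<otimes>\<^bsub>A\<^esub> b \<in> carrier A" using assms by simp
    from module_hom_comp[OF bilinear_left[OF pure_bilinear this] bilinear_right[OF Lie.bracket_bilinear assms(1)]]
    show "(\<lambda>y. bracket L x y \<otimes>\<^sub>p (a \<otimes>\<^bsub>A\<^esub> b)) \<in> module_hom K L T" .
  qed
  show "pure_bracket x a \<in> module_hom K T T" by (rule tensor_lift_hom[OF T.vectorspace_axioms b])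
  show "\<lbrakk>y \<in> carrier L; b \<in> carrier A\<rbrakk> \<Longrightarrow> pure_bracket x a (y \<otimes>\<^sub>p b) = bracket L x y \<otimes>\<^sub>p (a \<otimes>\<^bsub>A\<^esub> b)"
    by (rule tensor_lift_pure[OF T.vectorspace_axioms b])
qed

text \<open>For bilinearity in the first argument, compare two linear maps of the second argument on pure
  tensors.\<close>

lemma pure_bracket_bilinear:
  assumes t: "t \<in> carrier T"
  shows "bilinear K L A T (\<lambda>x a. pure_bracket x a t)"
proof (intro bilinearI module_homI)
  fix x a b assume x: "x \<in> carrier L" and a: "a \<in> carrier A" and b: "b \<in> carrier A"
  show "pure_bracket x (a \<oplus>\<^bsub>A\<^esub> b) t = pure_bracket x a t \<oplus>\<^bsub>T\<^esub> pure_bracket x b t"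
    by (rule tensor_hom_eqI[OF T.module_axioms _ _ _ t])
      (use x a b in \<open>simp_all add: pure_bracket module_hom_add_fun[OF T.module_axioms] Lie.bracket_closed
        Alg.l_distr pure_add_right\<close>)
next
  fix x a c assume x: "x \<in> carrier L" and c: "c \<in> carrier K" and a: "a \<in> carrier A"
  show "pure_bracket x (c \<odot>\<^bsub>A\<^esub> a) t = c \<odot>\<^bsub>T\<^esub> pure_bracket x a t"
    by (rule tensor_hom_eqI[OF T.module_axioms _ _ _ t])
      (use x a c in \<open>simp_all add: pure_bracket module_hom_comp[OF smult_hom[OF T.module_axioms]] Lie.bracket_closed
        Alg.smult_assoc2 pure_smult_right\<close>)
next
  fix x y a assume a: "a \<in> carrier A" and x: "x \<in> carrier L" and y: "y \<in> carrier L"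
  show "pure_bracket (x \<oplus>\<^bsub>L\<^esub> y) a t = pure_bracket x a t \<oplus>\<^bsub>T\<^esub> pure_bracket y a t"
    by (rule tensor_hom_eqI[OF T.module_axioms _ _ _ t])
      (use x y a in \<open>simp_all add: pure_bracket module_hom_add_fun[OF T.module_axioms] Lie.bracket_closed
        Lie.bracket_add_left pure_add_left\<close>)
next
  fix x a c assume a: "a \<in> carrier A" and c: "c \<in> carrier K" and x: "x \<in> carrier L"
  show "pure_bracket (c \<odot>\<^bsub>L\<^esub> x) a t = c \<odot>\<^bsub>T\<^esub> pure_bracket x a t"
    by (rule tensor_hom_eqI[OF T.module_axioms _ _ _ t])
      (use x a c in \<open>simp_all add: pure_bracket module_hom_comp[OF smult_hom[OF T.module_axioms]] Lie.bracket_closed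
        Lie.bracket_smult_left pure_smult_left\<close>)
qed (simp_all add: module_hom_mem[OF pure_bracket(1) t])

lemma bracket_current_left: "t \<in> carrier T \<Longrightarrow> (\<lambda>s. bracket C s t) \<in> module_hom K T T"
  unfolding bracket_current[abs_def] by (rule tensor_lift_hom[OF T.vectorspace_axioms pure_bracket_bilinear])

lemma bracket_current_pure_left:
  "\<lbrakk>x \<in> carrier L; a \<in> carrier A; t \<in> carrier T\<rbrakk> \<Longrightarrow> bracket C (x \<otimes>\<^sub>p a) t = pure_bracket x a t"
  unfolding bracket_current by (rule tensor_lift_pure[OF T.vectorspace_axioms pure_bracket_bilinear])

lemma bracket_current_pure:
  "\<lbrakk>x \<in> carrier L; a \<in> carrier A; y \<in> carrier L; b \<in> carrier A\<rbrakk>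
    \<Longrightarrow> bracket C (x \<otimes>\<^sub>p a) (y \<otimes>\<^sub>p b) = bracket L x y \<otimes>\<^sub>p (a \<otimes>\<^bsub>A\<^esub> b)"
  by (simp add: bracket_current_pure_left pure_bracket)

lemma bracket_current_bilinear: "bilinear K T T T (bracket C)"
proof (intro bilinearI)
  fix s assume s: "s \<in> carrier T"
  show "bracket C s \<in> module_hom K T T"
  proof (rule module_homI)
    show "bracket C s t \<in> carrier T" if "t \<in> carrier T" for t
      by (rule module_hom_mem[OF bracket_current_left[OF that] s])
    fix t u assume t: "t \<in> carrier T" and u: "u \<in> carrier T"
    show "bracket C s (t \<oplus>\<^bsub>T\<^esub> u) = bracket C s t \<oplus>\<^bsub>T\<^esub> bracket C s u"
      by (rule tensor_hom_eqI[OF T.module_axioms _ _ _ s, of "\<lambda>s. bracket C s (t \<oplus>\<^bsub>T\<^esub> u)"])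
        (use t u in \<open>simp_all add: bracket_current_left module_hom_add_fun[OF T.module_axioms]
          bracket_current_pure_left module_hom_add[OF pure_bracket(1)]\<close>)
  next
    fix c t assume c: "c \<in> carrier K" and t: "t \<in> carrier T"
    show "bracket C s (c \<odot>\<^bsub>T\<^esub> t) = c \<odot>\<^bsub>T\<^esub> bracket C s t"
      by (rule tensor_hom_eqI[OF T.module_axioms _ _ _ s, of "\<lambda>s. bracket C s (c \<odot>\<^bsub>T\<^esub> t)"])
        (use t c in \<open>simp_all add: bracket_current_left module_hom_comp[OF smult_hom[OF T.module_axioms]]
          bracket_current_pure_left module_hom_smult[OF pure_bracket(1)]\<close>)
  qed
qed (rule bracket_current_left)

lemma current_vectorspace: "vectorspace K C"
proof -
  interpret C: abelian_group C
    by (rule abelian_groupI) (use T.M.add.l_inv_ex in \<open>auto simp: T.M.a_ac\<close>)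
  show ?thesis
    by (intro vectorspaceI moduleI Lie.field_axioms C.abelian_group_axioms Lie.R.cring_axioms)
      (simp_all add: T.smult_l_distr T.smult_r_distr T.smult_assoc1)
qed

lemma HomLie_current_submodule: "submodule K (HomLie K C) (lin_End K T)"
  using HomLie_submodule[OF current_vectorspace] bracket_current_bilinear
  by (simp add: bilinear_current lin_End_current)

section \<open>Decomposable Hom-Lie structures\<close>

lemma mult_op_mem: "u \<in> carrier A \<Longrightarrow> mult_op A u \<in> carrier (lin_End K A)"
  unfolding mult_op_def
  by (rule lin_End_restrict[OF Alg.module_axioms bilinear_left[OF mult_bilinear]])

lemma mult_op_apply: "a \<in> carrier A \<Longrightarrow> mult_op A u a = a \<otimes>\<^bsub>A\<^esub> u"
  by (simp add: mult_op_def)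

text \<open>The cyclic symmetry lets a reduction to pure tensors in the first argument serve for all three.\<close>

lemma HomLie_defect_current_rotate:
  assumes "\<Phi> \<in> module_hom K T T" "s \<in> carrier T" "t \<in> carrier T" "u \<in> carrier T"
  shows "HomLie_defect C s t u \<Phi> = HomLie_defect C u s t \<Phi>"
proof -
  note m = bilinear_mem[OF bracket_current_bilinear] module_hom_mem[OF assms(1)]
  show ?thesis using assms(2-4) by (simp add: HomLie_defect_def m T.M.a_ac)
qed

lemma HomLie_defect_current_extend:
  assumes \<Phi>: "\<Phi> \<in> module_hom K T T" and t: "t \<in> carrier T" and u: "u \<in> carrier T"
    and pure: "\<And>x a. \<lbrakk>x \<in> carrier L; a \<in> carrier A\<rbrakk> \<Longrightarrow> HomLie_defect C (x \<otimes>\<^sub>p a) t u \<Phi> = \<zero>\<^bsub>T\<^esub>"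
    and s: "s \<in> carrier T"
  shows "HomLie_defect C s t u \<Phi> = \<zero>\<^bsub>T\<^esub>"
proof -
  note l = bilinear_left[OF bracket_current_bilinear] and r = bilinear_right[OF bracket_current_bilinear]
    and m = bilinear_mem[OF bracket_current_bilinear] module_hom_mem[OF \<Phi>]
  have hom: "(\<lambda>s. HomLie_defect C s t u \<Phi>) \<in> module_hom K T T"
    unfolding HomLie_defect_def current_simps
  proof (intro module_hom_add_fun[OF T.module_axioms])
    show "(\<lambda>s. bracket C (bracket C s t) (\<Phi> u)) \<in> module_hom K T T"
      by (rule module_hom_comp[OF l[OF m(2)[OF u]] l[OF t]])
    show "(\<lambda>s. bracket C (bracket C u s) (\<Phi> t)) \<in> module_hom K T T"
      by (rule module_hom_comp[OF l[OF m(2)[OF t]] r[OF u]])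
    show "(\<lambda>s. bracket C (bracket C t u) (\<Phi> s)) \<in> module_hom K T T"
      by (rule module_hom_comp[OF r[OF m(1)[OF t u]] \<Phi>])
  qed
  have zero: "(\<lambda>_. \<zero>\<^bsub>T\<^esub>) \<in> module_hom K T T" by (rule module_homI) simp_all
  show ?thesis
    by (rule tensor_hom_eqI[OF T.module_axioms hom zero pure s])
qed

lemma HomLie_currentI:
  assumes \<Phi>: "\<Phi> \<in> carrier (lin_End K T)"
    and pure: "\<And>x y z a b c. \<lbrakk>x \<in> carrier L; y \<in> carrier L; z \<in> carrier L; a \<in> carrier A; b \<in> carrier A; c \<in> carrier A\<rbrakk>
      \<Longrightarrow> HomLie_defect C (x \<otimes>\<^sub>p a) (y \<otimes>\<^sub>p b) (z \<otimes>\<^sub>p c) \<Phi> = \<zero>\<^bsub>T\<^esub>"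
  shows "\<Phi> \<in> HomLie K C"
proof -
  have h: "\<Phi> \<in> module_hom K T T" using \<Phi> by simp
  note ext = HomLie_defect_current_extend[OF h] and rot = HomLie_defect_current_rotate[OF h]
  have 1: "HomLie_defect C s (y \<otimes>\<^sub>p b) (z \<otimes>\<^sub>p c) \<Phi> = \<zero>\<^bsub>T\<^esub>"
    if s: "s \<in> carrier T" and yz: "y \<in> carrier L" "z \<in> carrier L" and bc: "b \<in> carrier A" "c \<in> carrier A"
    for s y z b c
    using pure[OF _ yz _ bc] by (rule ext[OF pure_mem[OF yz(1) bc(1)] pure_mem[OF yz(2) bc(2)] _ s])
  have 2: "HomLie_defect C u s (y \<otimes>\<^sub>p b) \<Phi> = \<zero>\<^bsub>T\<^esub>"
    if s: "s \<in> carrier T" and u: "u \<in> carrier T" and y: "y \<in> carrier L" and b: "b \<in> carrier A" for s u y b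
  proof (rule ext[OF s pure_mem[OF y b] _ u])
    fix x a assume x: "x \<in> carrier L" and a: "a \<in> carrier A"
    show "HomLie_defect C (x \<otimes>\<^sub>p a) s (y \<otimes>\<^sub>p b) \<Phi> = \<zero>\<^bsub>T\<^esub>"
      unfolding rot[OF s pure_mem[OF y b] pure_mem[OF x a], symmetric] by (rule 1[OF s y x b a])
  qed
  have "HomLie_defect C t u s \<Phi> = \<zero>\<^bsub>T\<^esub>" if s: "s \<in> carrier T" and u: "u \<in> carrier T" and t: "t \<in> carrier T" for s u t
  proof (rule ext[OF u s _ t])
    fix x a assume x: "x \<in> carrier L" and a: "a \<in> carrier A"
    show "HomLie_defect C (x \<otimes>\<^sub>p a) u s \<Phi> = \<zero>\<^bsub>T\<^esub>"
      unfolding rot[OF u s pure_mem[OF x a], symmetric] by (rule 2[OF s u x a])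
  qed
  then show ?thesis unfolding HomLie_iff lin_End_current current_simps using \<Phi> by blast
qed

text \<open>On pure tensors the bracket of \<open>L\<close> and the product of \<open>A\<close> separate, so both types of decomposable
  maps can be checked factor by factor.\<close>

lemma bracket_bracket_tensor_map:
  assumes "\<phi> \<in> carrier (lin_End K L)" "\<alpha> \<in> carrier (lin_End K A)"
    and "x \<in> carrier L" "y \<in> carrier L" "z \<in> carrier L" "a \<in> carrier A" "b \<in> carrier A" "c \<in> carrier A"
  shows "bracket C (bracket C (x \<otimes>\<^sub>p a) (y \<otimes>\<^sub>p b)) (tensor_map K L A \<phi> \<alpha> (z \<otimes>\<^sub>p c))
    = bracket L (bracket L x y) (\<phi> z) \<otimes>\<^sub>p (a \<otimes>\<^bsub>A\<^esub> b \<otimes>\<^bsub>A\<^esub> \<alpha> c)"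
  using assms(3-) lin_apply[OF assms(1)] lin_apply'[OF assms(2)]
  by (simp add: bracket_current_pure tensor_map_pure[OF assms(1,2)] Lie.bracket_closed del: lin_End_simps)

lemmas HomLie_L = HomLie_defect_hom[OF Lie.vectorspace_axioms Lie.bracket_bilinear]
lemmas derived_iff = derived_annihilating_iff[OF Lie.vectorspace_axioms Lie.bracket_bilinear]

text \<open>By commutativity of \<open>A\<close> all three cyclic terms have the same second factor \<open>abcu\<close>, and the first
  factors add up to the defect of \<open>\<phi>\<close>.\<close>

lemma HomLie_tensor_mult_op:
  assumes \<phi>: "\<phi> \<in> HomLie K L" and u: "u \<in> carrier A"
  shows "tensor_map K L A \<phi> (mult_op A u) \<in> HomLie K C"
proof (rule HomLie_currentI)
  have \<phi>c: "\<phi> \<in> carrier (lin_End K L)" using \<phi> unfolding HomLie_iff by blast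
  show "tensor_map K L A \<phi> (mult_op A u) \<in> carrier (lin_End K T)"
    by (rule tensor_map_mem[OF \<phi>c mult_op_mem[OF u]])
  fix x y z a b c
  assume xyz: "x \<in> carrier L" "y \<in> carrier L" "z \<in> carrier L" and abc: "a \<in> carrier A" "b \<in> carrier A" "c \<in> carrier A"
  note br = bracket_bracket_tensor_map[OF \<phi>c mult_op_mem[OF u]]
  let ?d = "a \<otimes>\<^bsub>A\<^esub> b \<otimes>\<^bsub>A\<^esub> (c \<otimes>\<^bsub>A\<^esub> u)"
  have d: "c \<otimes>\<^bsub>A\<^esub> a \<otimes>\<^bsub>A\<^esub> (b \<otimes>\<^bsub>A\<^esub> u) = ?d" "b \<otimes>\<^bsub>A\<^esub> c \<otimes>\<^bsub>A\<^esub> (a \<otimes>\<^bsub>A\<^esub> u) = ?d" "?d \<in> carrier A"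
    using abc u by (simp_all add: Alg.m_ac)
  note bc = Lie.bracket_closed lin_apply[OF \<phi>c]
  have "HomLie_defect C (x \<otimes>\<^sub>p a) (y \<otimes>\<^sub>p b) (z \<otimes>\<^sub>p c) (tensor_map K L A \<phi> (mult_op A u))
      = HomLie_defect L x y z \<phi> \<otimes>\<^sub>p ?d"
    unfolding HomLie_defect_def current_simps using xyz abc u d
    by (simp add: br mult_op_apply pure_add_left bc)
  also have "HomLie_defect L x y z \<phi> = \<zero>\<^bsub>L\<^esub>" using \<phi> xyz unfolding HomLie_iff by blast
  also have "\<zero>\<^bsub>L\<^esub> \<otimes>\<^sub>p ?d = \<zero>\<^bsub>T\<^esub>"
    by (rule module_hom_zero[OF Lie.module_axioms T.module_axioms bilinear_left[OF pure_bilinear d(3)]])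
  finally show "HomLie_defect C (x \<otimes>\<^sub>p a) (y \<otimes>\<^sub>p b) (z \<otimes>\<^sub>p c) (tensor_map K L A \<phi> (mult_op A u)) = \<zero>\<^bsub>T\<^esub>" .
qed

text \<open>Here each of the three cyclic terms vanishes separately, because its first factor does.\<close>

lemma HomLie_tensor_derived:
  assumes \<phi>: "\<phi> \<in> derived_annihilating K L" and \<alpha>: "\<alpha> \<in> carrier (lin_End K A)"
  shows "tensor_map K L A \<phi> \<alpha> \<in> HomLie K C"
proof (rule HomLie_currentI)
  have \<phi>c: "\<phi> \<in> carrier (lin_End K L)" using \<phi> unfolding derived_iff by blast
  show "tensor_map K L A \<phi> \<alpha> \<in> carrier (lin_End K T)" by (rule tensor_map_mem[OF \<phi>c \<alpha>])
  have 0: "bracket C (bracket C (x \<otimes>\<^sub>p a) (y \<otimes>\<^sub>p b)) (tensor_map K L A \<phi> \<alpha> (z \<otimes>\<^sub>p c)) = \<zero>\<^bsub>T\<^esub>"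
    if xyz: "x \<in> carrier L" "y \<in> carrier L" "z \<in> carrier L" and abc: "a \<in> carrier A" "b \<in> carrier A" "c \<in> carrier A"
    for x y z a b c
  proof -
    have "bracket L (bracket L x y) (\<phi> z) = \<zero>\<^bsub>L\<^esub>" using \<phi> xyz unfolding derived_iff by blast
    moreover have "a \<otimes>\<^bsub>A\<^esub> b \<otimes>\<^bsub>A\<^esub> \<alpha> c \<in> carrier A" using abc lin_apply'[OF \<alpha>] by simp
    ultimately show ?thesis
      unfolding bracket_bracket_tensor_map[OF \<phi>c \<alpha> that]
      using module_hom_zero[OF Lie.module_axioms T.module_axioms bilinear_left[OF pure_bilinear]] by simp
  qed
  show "HomLie_defect C (x \<otimes>\<^sub>p a) (y \<otimes>\<^sub>p b) (z \<otimes>\<^sub>p c) (tensor_map K L A \<phi> \<alpha>) = \<zero>\<^bsub>T\<^esub>"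
    if "x \<in> carrier L" "y \<in> carrier L" "z \<in> carrier L" "a \<in> carrier A" "b \<in> carrier A" "c \<in> carrier A" for x y z a b c
    using that by (simp add: HomLie_defect_def 0)
qed

section \<open>Decomposition of a Hom-Lie structure\<close>

text \<open>The \<open>A\<close>-module structure of \<open>L \<otimes> A\<close>.\<close>

definition scale where "scale c = tensor_map K L A (\<lambda>x\<in>carrier L. x) (mult_op A c)"

lemma id_mem: "(\<lambda>x\<in>carrier L. x) \<in> carrier (lin_End K L)"
  by (rule lin_End_restrict[OF Lie.module_axioms], rule module_homI) auto

lemma scale_hom: "c \<in> carrier A \<Longrightarrow> scale c \<in> module_hom K T T"
  using tensor_map_mem[OF id_mem mult_op_mem] by (simp add: scale_def)

lemma scale_pure:
  "\<lbrakk>c \<in> carrier A; x \<in> carrier L; a \<in> carrier A\<rbrakk> \<Longrightarrow> scale c (x \<otimes>\<^sub>p a) = x \<otimes>\<^sub>p (a \<otimes>\<^bsub>A\<^esub> c)"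
  using tensor_map_pure[OF id_mem mult_op_mem] by (simp add: scale_def mult_op_apply)

lemma bracket_current_scale:
  assumes w: "w \<in> carrier L" and a: "a \<in> carrier A" and t: "t \<in> carrier T"
  shows "bracket C (w \<otimes>\<^sub>p a) t = scale a (bracket C (w \<otimes>\<^sub>p \<one>\<^bsub>A\<^esub>) t)"
proof (rule tensor_hom_eqI[OF T.module_axioms _ _ _ t])
  note r = bilinear_right[OF bracket_current_bilinear pure_mem]
  show "bracket C (w \<otimes>\<^sub>p a) \<in> module_hom K T T" by (rule r[OF w a])
  show "(\<lambda>t. scale a (bracket C (w \<otimes>\<^sub>p \<one>\<^bsub>A\<^esub>) t)) \<in> module_hom K T T"
    by (rule module_hom_comp[OF scale_hom[OF a] r[OF w Alg.one_closed]])
  fix y b assume "y \<in> carrier L" "b \<in> carrier A"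
  then show "bracket C (w \<otimes>\<^sub>p a) (y \<otimes>\<^sub>p b) = scale a (bracket C (w \<otimes>\<^sub>p \<one>\<^bsub>A\<^esub>) (y \<otimes>\<^sub>p b))"
    using w a by (simp add: bracket_current_pure scale_pure Lie.bracket_closed Alg.m_comm)
qed

text \<open>The Hom-Lie identity at \<open>x \<otimes> 1, y \<otimes> 1, z \<otimes> d\<close> involves \<open>d\<close> in its last two terms only through
  \<open>scale d\<close>. Taking \<open>d = 1\<close> and scaling by \<open>c\<close> gives the first claim; comparing with \<open>d = c\<close>
  cancels these two terms and gives the second.\<close>

lemma HomLie_scale:
  assumes \<Phi>: "\<Phi> \<in> HomLie K C" and xyz: "x \<in> carrier L" "y \<in> carrier L" "z \<in> carrier L" and c: "c \<in> carrier A"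
  defines "g \<equiv> \<lambda>x y z. bracket C (bracket L x y \<otimes>\<^sub>p \<one>\<^bsub>A\<^esub>) (\<Phi> (z \<otimes>\<^sub>p \<one>\<^bsub>A\<^esub>))"
  shows "scale c (g x y z) \<oplus>\<^bsub>T\<^esub> scale c (g z x y) \<oplus>\<^bsub>T\<^esub> scale c (g y z x) = \<zero>\<^bsub>T\<^esub>" (is ?sum)
    and "bracket C (bracket L x y \<otimes>\<^sub>p \<one>\<^bsub>A\<^esub>) (\<Phi> (z \<otimes>\<^sub>p c)) = scale c (g x y z)"
proof -
  have \<Phi>c: "\<Phi> \<in> carrier (lin_End K T)" and cond: "\<And>s t u. \<lbrakk>s \<in> carrier T; t \<in> carrier T; u \<in> carrier T\<rbrakk>
      \<Longrightarrow> HomLie_defect C s t u \<Phi> = \<zero>\<^bsub>T\<^esub>"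
    using \<Phi> unfolding HomLie_iff lin_End_current current_simps by blast+
  have h: "\<Phi> \<in> module_hom K T T" using \<Phi>c by simp
  note hm = module_hom_mem[OF h pure_mem] and brT = bilinear_mem[OF bracket_current_bilinear]
  have g: "g x y z \<in> carrier T" if "x \<in> carrier L" "y \<in> carrier L" "z \<in> carrier L" for x y z
    unfolding g_def using that by (simp add: brT hm Lie.bracket_closed)
  have sg: "scale c (g x y z) \<in> carrier T" if "x \<in> carrier L" "y \<in> carrier L" "z \<in> carrier L" for x y z
    by (rule module_hom_mem[OF scale_hom[OF c] g[OF that]])
  have eq: "bracket C (bracket L x y \<otimes>\<^sub>p \<one>\<^bsub>A\<^esub>) (\<Phi> (z \<otimes>\<^sub>p d)) \<oplus>\<^bsub>T\<^esub> scale d (g z x y) \<oplus>\<^bsub>T\<^esub> scale d (g y z x) = \<zero>\<^bsub>T\<^esub>"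
    if d: "d \<in> carrier A" for d
    using cond[of "x \<otimes>\<^sub>p \<one>\<^bsub>A\<^esub>" "y \<otimes>\<^sub>p \<one>\<^bsub>A\<^esub>" "z \<otimes>\<^sub>p d"] xyz d
    by (simp add: HomLie_defect_def bracket_current_pure g_def hm Lie.bracket_closed
        bracket_current_scale[OF _ d])
  have scale_one: "scale \<one>\<^bsub>A\<^esub> t = t" if t: "t \<in> carrier T" for t
  proof (rule tensor_hom_eqI[OF T.module_axioms scale_hom[OF Alg.one_closed] _ _ t])
    show "(\<lambda>t. t) \<in> module_hom K T T" by (rule module_homI) auto
  qed (simp add: scale_pure)
  have "bracket C (bracket L x y \<otimes>\<^sub>p \<one>\<^bsub>A\<^esub>) (\<Phi> (z \<otimes>\<^sub>p \<one>\<^bsub>A\<^esub>)) = g x y z" by (simp add: g_def)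
  from eq[OF Alg.one_closed, unfolded this]
  have "g x y z \<oplus>\<^bsub>T\<^esub> g z x y \<oplus>\<^bsub>T\<^esub> g y z x = \<zero>\<^bsub>T\<^esub>" by (simp add: scale_one g xyz)
  then have "scale c (g x y z \<oplus>\<^bsub>T\<^esub> g z x y \<oplus>\<^bsub>T\<^esub> g y z x) = \<zero>\<^bsub>T\<^esub>"
    using module_hom_zero[OF T.module_axioms T.module_axioms scale_hom[OF c]] by simp
  then show sum: ?sum
    using xyz g by (simp add: module_hom_add[OF scale_hom[OF c]])
  have G: "bracket C (bracket L x y \<otimes>\<^sub>p \<one>\<^bsub>A\<^esub>) (\<Phi> (z \<otimes>\<^sub>p c)) \<in> carrier T"
    using xyz c by (simp add: brT hm Lie.bracket_closed)
  show "bracket C (bracket L x y \<otimes>\<^sub>p \<one>\<^bsub>A\<^esub>) (\<Phi> (z \<otimes>\<^sub>p c)) = scale c (g x y z)"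
    using eq[OF c] sum G sg xyz
    by (metis T.M.a_assoc T.M.a_closed T.M.minus_equality)
qed

definition decomposables where
  "decomposables = {tensor_map K L A \<phi> \<alpha> | \<phi> \<alpha>. \<phi> \<in> carrier (lin_End K L) \<and> \<alpha> \<in> carrier (lin_End K A)
    \<and> (\<phi> \<in> HomLie K L \<and> (\<exists>u\<in>carrier A. \<alpha> = mult_op A u) \<or> \<phi> \<in> derived_annihilating K L)}"

lemma decomposables_subset: "decomposables \<subseteq> carrier (lin_End K T)"
  unfolding decomposables_def using tensor_map_mem by blast

lemma decomposables_HomLie:
  assumes "\<Phi> \<in> decomposables"
  shows "\<Phi> \<in> HomLie K C"
proof -
  obtain \<phi> \<alpha> where *: "\<Phi> = tensor_map K L A \<phi> \<alpha>" "\<alpha> \<in> carrier (lin_End K A)"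
    "\<phi> \<in> HomLie K L \<and> (\<exists>u\<in>carrier A. \<alpha> = mult_op A u) \<or> \<phi> \<in> derived_annihilating K L"
    using assms unfolding decomposables_def by blast
  from *(3) show ?thesis
  proof (elim disjE conjE bexE)
    fix u assume "\<phi> \<in> HomLie K L" "u \<in> carrier A" "\<alpha> = mult_op A u"
    then show ?thesis unfolding *(1) using HomLie_tensor_mult_op by simp
  next
    assume "\<phi> \<in> derived_annihilating K L"
    then show ?thesis unfolding *(1) using *(2) by (rule HomLie_tensor_derived)
  qed
qed

lemma bracket_current_sum:
  assumes \<phi>: "\<phi> \<in> I \<rightarrow> carrier (lin_End K L)" and \<alpha>: "\<alpha> \<in> I \<rightarrow> carrier (lin_End K A)"
    and w: "w \<in> carrier L" and z: "z \<in> carrier L" and c: "c \<in> carrier A"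
  shows "bracket C (w \<otimes>\<^sub>p \<one>\<^bsub>A\<^esub>) ((\<Oplus>\<^bsub>lin_End K T\<^esub>i\<in>I. tensor_map K L A (\<phi> i) (\<alpha> i)) (z \<otimes>\<^sub>p c))
    = (\<Oplus>\<^bsub>T\<^esub>i\<in>I. bracket L w (\<phi> i z) \<otimes>\<^sub>p \<alpha> i c)"
proof -
  have m: "\<phi> i z \<in> carrier L" "\<alpha> i c \<in> carrier A" if "i \<in> I" for i
    using \<phi> \<alpha> that z c lin_apply lin_apply' by blast+
  have "bracket C (w \<otimes>\<^sub>p \<one>\<^bsub>A\<^esub>) (\<Oplus>\<^bsub>T\<^esub>i\<in>I. \<phi> i z \<otimes>\<^sub>p \<alpha> i c)
      = (\<Oplus>\<^bsub>T\<^esub>i\<in>I. bracket C (w \<otimes>\<^sub>p \<one>\<^bsub>A\<^esub>) (\<phi> i z \<otimes>\<^sub>p \<alpha> i c))"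
    using pure_mem[OF m]
    by (intro module_hom_finsum[OF T.module_axioms T.module_axioms
          bilinear_right[OF bracket_current_bilinear pure_mem[OF w Alg.one_closed]]]) blast
  also have "\<dots> = (\<Oplus>\<^bsub>T\<^esub>i\<in>I. bracket L w (\<phi> i z) \<otimes>\<^sub>p \<alpha> i c)"
    using m w by (intro T.M.finsum_cong') (simp_all add: bracket_current_pure Lie.bracket_closed Pi_iff)
  finally show ?thesis unfolding tensor_map_finsum_pure[OF \<phi> \<alpha> z c] .
qed

text \<open>In a representation \<open>\<Phi> = \<Sum> \<phi>\<^sub>i \<otimes> \<alpha>\<^sub>i\<close> split \<open>\<alpha>\<^sub>i = \<rho>\<^sub>i + \<beta>\<^sub>i\<close>, where \<open>\<rho>\<^sub>i\<close> is multiplication by \<open>\<alpha>\<^sub>i(1)\<close>.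
  By \<open>HomLie_scale\<close> the part with \<open>\<rho>\<^sub>i\<close> accounts for all brackets of \<open>\<Phi>\<close> with \<open>[L, L]\<close>, so the part with
  \<open>\<beta>\<^sub>i\<close> is killed by them; \<open>TE_reduce_kernel\<close> turns both facts into conditions on the first factors.\<close>

lemma HomLie_current_decompose:
  assumes fin: "Lie.fin_dim \<or> W.fin_dim" and \<Phi>: "\<Phi> \<in> HomLie K C"
  shows "\<Phi> \<in> finite_sums (lin_End K T) decomposables"
proof -
  have \<Phi>c: "\<Phi> \<in> carrier (lin_End K T)"
    using \<Phi> unfolding HomLie_iff lin_End_current by blast
  then have "\<Phi> \<in> tensor_End_map K L A ` carrier TE"
    using fin tensor_End_map_surj_left tensor_End_map_surj_right by blast
  then obtain t where t: "t \<in> carrier TE" "\<Phi> = tensor_End_map K L A t" by blast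
  obtain I :: "nat set" and \<phi> \<alpha> where I: "finite I" "\<phi> \<in> I \<rightarrow> carrier (lin_End K L)"
    "\<alpha> \<in> I \<rightarrow> carrier (lin_End K A)" "t = (\<Oplus>\<^bsub>TE\<^esub>i\<in>I. \<phi> i \<otimes>\<^sub>E \<alpha> i)"
    using TE_independent_representation[OF t(1)] by blast
  have \<Phi>_sum: "\<Phi> = (\<Oplus>\<^bsub>lin_End K T\<^esub>i\<in>I. tensor_map K L A (\<phi> i) (\<alpha> i))"
    unfolding t(2) I(4) by (rule tensor_End_map_finsum[OF I(2,3)])
  have \<phi>: "\<phi> i \<in> carrier (lin_End K L)" and \<alpha>: "\<alpha> i \<in> carrier (lin_End K A)" if "i \<in> I" for i
    using I(2,3) that by blast+
  note \<phi>m = lin_apply[OF \<phi>] and \<alpha>m = lin_apply'[OF \<alpha>]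
  define u where "u i = \<alpha> i \<one>\<^bsub>A\<^esub>" for i
  have u: "u i \<in> carrier A" if "i \<in> I" for i unfolding u_def using \<alpha>m[OF that Alg.one_closed] .
  define \<rho> where "\<rho> i = mult_op A (u i)" for i
  have \<rho>: "\<rho> i \<in> carrier (lin_End K A)" if "i \<in> I" for i unfolding \<rho>_def using u[OF that] by (rule mult_op_mem)
  define \<beta> where "\<beta> i = \<alpha> i \<ominus>\<^bsub>lin_End K A\<^esub> \<rho> i" for i
  have \<beta>: "\<beta> i \<in> carrier (lin_End K A)" if "i \<in> I" for i
    unfolding \<beta>_def using \<alpha>[OF that] \<rho>[OF that] by (rule EW.M.minus_closed)
  have \<rho>I: "\<rho> \<in> I \<rightarrow> carrier (lin_End K A)" and \<beta>I: "\<beta> \<in> I \<rightarrow> carrier (lin_End K A)" using \<rho> \<beta> by blast+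
  define \<Phi>1 where "\<Phi>1 = (\<Oplus>\<^bsub>lin_End K T\<^esub>i\<in>I. tensor_map K L A (\<phi> i) (\<rho> i))"
  define \<Phi>2 where "\<Phi>2 = (\<Oplus>\<^bsub>lin_End K T\<^esub>i\<in>I. tensor_map K L A (\<phi> i) (\<beta> i))"
  have t1: "tensor_map K L A (\<phi> i) (\<rho> i) \<in> carrier (lin_End K T)"
    and t2: "tensor_map K L A (\<phi> i) (\<beta> i) \<in> carrier (lin_End K T)" if "i \<in> I" for i
    using tensor_map_mem[OF \<phi>[OF that] \<rho>[OF that]] tensor_map_mem[OF \<phi>[OF that] \<beta>[OF that]] .
  have \<Phi>1c: "\<Phi>1 \<in> carrier (lin_End K T)" and \<Phi>2c: "\<Phi>2 \<in> carrier (lin_End K T)"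
    unfolding \<Phi>1_def \<Phi>2_def using t1 t2 by (intro ET.M.finsum_closed; blast)+
  have split: "\<Phi> = \<Phi>1 \<oplus>\<^bsub>lin_End K T\<^esub> \<Phi>2"
  proof -
    have "tensor_map K L A (\<phi> i) (\<alpha> i)
        = tensor_map K L A (\<phi> i) (\<rho> i) \<oplus>\<^bsub>lin_End K T\<^esub> tensor_map K L A (\<phi> i) (\<beta> i)" if i: "i \<in> I" for i
    proof -
      have "\<alpha> i = \<rho> i \<oplus>\<^bsub>lin_End K A\<^esub> \<beta> i"
        unfolding \<beta>_def EW.M.minus_eq using \<alpha>[OF i] \<rho>[OF i]
        by (metis EW.M.a_comm EW.M.a_inv_closed EW.M.r_neg2 EW.M.a_closed EW.M.a_lcomm EW.M.r_neg EW.M.r_zero)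
      then show ?thesis
        using module_hom_add[OF bilinear_right[OF tensor_map_End_bilinear \<phi>[OF i]] \<rho>[OF i] \<beta>[OF i]] by metis
    qed
    then have "\<Phi> = (\<Oplus>\<^bsub>lin_End K T\<^esub>i\<in>I. tensor_map K L A (\<phi> i) (\<rho> i) \<oplus>\<^bsub>lin_End K T\<^esub> tensor_map K L A (\<phi> i) (\<beta> i))"
      unfolding \<Phi>_sum using t1 t2 by (intro ET.M.finsum_cong' ET.M.a_closed funcsetI) blast+
    also have "\<dots> = \<Phi>1 \<oplus>\<^bsub>lin_End K T\<^esub> \<Phi>2"
      unfolding \<Phi>1_def \<Phi>2_def using t1 t2 by (intro ET.M.finsum_addf) blast+
    finally show ?thesis .
  qed
  have scale_sum: "scale c (\<Oplus>\<^bsub>T\<^esub>i\<in>I. v i \<otimes>\<^sub>p \<alpha> i \<one>\<^bsub>A\<^esub>) = (\<Oplus>\<^bsub>T\<^esub>i\<in>I. v i \<otimes>\<^sub>p \<rho> i c)"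
    if c: "c \<in> carrier A" and v: "\<And>i. i \<in> I \<Longrightarrow> v i \<in> carrier L" for c v
  proof -
    have "scale c (\<Oplus>\<^bsub>T\<^esub>i\<in>I. v i \<otimes>\<^sub>p \<alpha> i \<one>\<^bsub>A\<^esub>) = (\<Oplus>\<^bsub>T\<^esub>i\<in>I. scale c (v i \<otimes>\<^sub>p u i))"
      unfolding u_def[symmetric] using pure_mem[OF v u]
      by (intro module_hom_finsum[OF T.module_axioms T.module_axioms scale_hom[OF c]]) blast
    also have "\<dots> = (\<Oplus>\<^bsub>T\<^esub>i\<in>I. v i \<otimes>\<^sub>p \<rho> i c)"
      using c u v by (intro T.M.finsum_cong') (simp_all add: scale_pure \<rho>_def mult_op_apply Alg.m_comm Pi_iff)
    finally show ?thesis .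
  qed
  have bv: "bracket L (bracket L x y) (\<phi> i z) \<in> carrier L"
    if "x \<in> carrier L" "y \<in> carrier L" "z \<in> carrier L" "i \<in> I" for x y z i
    using that \<phi>m by (simp add: Lie.bracket_closed del: lin_End_simps)
  have scale_g: "scale c (bracket C (bracket L x y \<otimes>\<^sub>p \<one>\<^bsub>A\<^esub>) (\<Phi> (z \<otimes>\<^sub>p \<one>\<^bsub>A\<^esub>)))
      = (\<Oplus>\<^bsub>T\<^esub>i\<in>I. bracket L (bracket L x y) (\<phi> i z) \<otimes>\<^sub>p \<rho> i c)"
    if xyz: "x \<in> carrier L" "y \<in> carrier L" "z \<in> carrier L" and c: "c \<in> carrier A" for x y z c
    unfolding \<Phi>_sum bracket_current_sum[OF I(2,3) Lie.bracket_closed[OF xyz(1,2)] xyz(3) Alg.one_closed]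
    by (rule scale_sum[OF c bv[OF xyz]])
  \<comment> \<open>The part with \<open>\<rho>\<close> satisfies the cyclic identity, which yields first factors in \<open>HomLie(L)\<close>.\<close>
  let ?H1 = "{HomLie_defect L x y z | x y z. x \<in> carrier L \<and> y \<in> carrier L \<and> z \<in> carrier L}"
  have zero1: "(\<Oplus>\<^bsub>T\<^esub>i\<in>I. h (\<phi> i) \<otimes>\<^sub>p \<rho> i c) = \<zero>\<^bsub>T\<^esub>" if h: "h \<in> ?H1" and c: "c \<in> carrier A" for h c
  proof -
    obtain x y z where xyz: "x \<in> carrier L" "y \<in> carrier L" "z \<in> carrier L" and h: "h = HomLie_defect L x y z"
      using h by blast
    have m: "bracket L (bracket L x' y') (\<phi> i z') \<otimes>\<^sub>p \<rho> i c \<in> carrier T"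
      if "x' \<in> carrier L" "y' \<in> carrier L" "z' \<in> carrier L" "i \<in> I" for x' y' z' i
      using pure_mem[OF bv[OF that] lin_apply'[OF \<rho>[OF that(4)] c]] .
    have "(\<Oplus>\<^bsub>T\<^esub>i\<in>I. h (\<phi> i) \<otimes>\<^sub>p \<rho> i c) =
      (\<Oplus>\<^bsub>T\<^esub>i\<in>I. bracket L (bracket L x y) (\<phi> i z) \<otimes>\<^sub>p \<rho> i c \<oplus>\<^bsub>T\<^esub> bracket L (bracket L z x) (\<phi> i y) \<otimes>\<^sub>p \<rho> i c
        \<oplus>\<^bsub>T\<^esub> bracket L (bracket L y z) (\<phi> i x) \<otimes>\<^sub>p \<rho> i c)"
      using xyz c lin_apply'[OF \<rho>] bv m
      by (intro T.M.finsum_cong') (simp_all add: h HomLie_defect_def pure_add_left Pi_iff del: lin_End_simps)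
    also have "\<dots> = (\<Oplus>\<^bsub>T\<^esub>i\<in>I. bracket L (bracket L x y) (\<phi> i z) \<otimes>\<^sub>p \<rho> i c)
        \<oplus>\<^bsub>T\<^esub> (\<Oplus>\<^bsub>T\<^esub>i\<in>I. bracket L (bracket L z x) (\<phi> i y) \<otimes>\<^sub>p \<rho> i c)
        \<oplus>\<^bsub>T\<^esub> (\<Oplus>\<^bsub>T\<^esub>i\<in>I. bracket L (bracket L y z) (\<phi> i x) \<otimes>\<^sub>p \<rho> i c)"
      using m xyz by (simp add: T.M.finsum_addf Pi_iff)
    also have "\<dots> = \<zero>\<^bsub>T\<^esub>"
      using HomLie_scale(1)[OF \<Phi> xyz c] by (simp add: scale_g xyz c)
    finally show ?thesis .
  qed
  \<comment> \<open>The part with \<open>\<beta>\<close> is what \<open>\<Phi>\<close> has beyond \<open>\<Phi>1\<close>, and brackets with \<open>[L, L]\<close> do not see it.\<close>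
  let ?H2 = "{\<lambda>\<phi>. bracket L (bracket L x y) (\<phi> z) | x y z. x \<in> carrier L \<and> y \<in> carrier L \<and> z \<in> carrier L}"
  have zero2: "(\<Oplus>\<^bsub>T\<^esub>i\<in>I. h (\<phi> i) \<otimes>\<^sub>p \<beta> i c) = \<zero>\<^bsub>T\<^esub>" if h: "h \<in> ?H2" and c: "c \<in> carrier A" for h c
  proof -
    obtain x y z where xyz: "x \<in> carrier L" "y \<in> carrier L" "z \<in> carrier L"
      and h: "h = (\<lambda>\<phi>. bracket L (bracket L x y) (\<phi> z))"
      using h by blast
    let ?w = "bracket L x y"
    have w: "?w \<in> carrier L" using xyz by (simp add: Lie.bracket_closed)
    note sums = bracket_current_sum[OF I(2) _ w xyz(3) c]
    have zc: "z \<otimes>\<^sub>p c \<in> carrier T" using xyz(3) c by (rule pure_mem)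
    have app: "\<Phi>1 (z \<otimes>\<^sub>p c) \<in> carrier T" "\<Phi>2 (z \<otimes>\<^sub>p c) \<in> carrier T"
      using \<Phi>1c \<Phi>2c zc by (auto simp: module_hom_mem)
    note ad = bilinear_right[OF bracket_current_bilinear pure_mem[OF w Alg.one_closed]]
    let ?b1 = "bracket C (?w \<otimes>\<^sub>p \<one>\<^bsub>A\<^esub>) (\<Phi>1 (z \<otimes>\<^sub>p c))"
    let ?b2 = "bracket C (?w \<otimes>\<^sub>p \<one>\<^bsub>A\<^esub>) (\<Phi>2 (z \<otimes>\<^sub>p c))"
    have b: "?b1 \<in> carrier T" "?b2 \<in> carrier T" using module_hom_mem[OF ad] app by blast+
    have "?b1 \<oplus>\<^bsub>T\<^esub> ?b2 = bracket C (?w \<otimes>\<^sub>p \<one>\<^bsub>A\<^esub>) (\<Phi> (z \<otimes>\<^sub>p c))"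
      unfolding split using zc module_hom_add[OF ad app] by simp
    also have "\<dots> = ?b1"
      unfolding HomLie_scale(2)[OF \<Phi> xyz c] scale_g[OF xyz c] \<Phi>1_def sums[OF \<rho>I] ..
    finally have "?b2 = \<zero>\<^bsub>T\<^esub>" using b by simp
    then show ?thesis unfolding h \<Phi>2_def sums[OF \<beta>I] .
  qed
  have H1: "h \<in> module_hom K (lin_End K L) L" if "h \<in> ?H1" for h using that HomLie_L by blast
  have H2: "h \<in> module_hom K (lin_End K L) L" if "h \<in> ?H2" for h
    using that bracket_bracket_hom[OF Lie.vectorspace_axioms Lie.bracket_bilinear] by blast
  note fs = finite_sums_finsum[OF ET.module_axioms decomposables_subset]
  have "\<Phi>1 \<in> finite_sums (lin_End K T) decomposables"
  proof -
    obtain J \<psi> where J: "J \<subseteq> I" "\<psi> \<in> J \<rightarrow> carrier (lin_End K L)" "\<forall>j\<in>J. \<forall>h\<in>?H1. h (\<psi> j) = \<zero>\<^bsub>L\<^esub>"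
      "(\<Oplus>\<^bsub>TE\<^esub>i\<in>I. \<phi> i \<otimes>\<^sub>E \<rho> i) = (\<Oplus>\<^bsub>TE\<^esub>i\<in>J. \<psi> i \<otimes>\<^sub>E \<rho> i)"
      using TE_reduce_kernel[of ?H1, OF H1 I(1,2) \<rho>I zero1] by blast
    have \<rho>J: "\<rho> \<in> J \<rightarrow> carrier (lin_End K A)" using \<rho>I J(1) by blast
    have eq: "\<Phi>1 = (\<Oplus>\<^bsub>lin_End K T\<^esub>i\<in>J. tensor_map K L A (\<psi> i) (\<rho> i))"
      unfolding \<Phi>1_def tensor_End_map_finsum[OF I(2) \<rho>I, symmetric] J(4) by (rule tensor_End_map_finsum[OF J(2) \<rho>J])
    have "tensor_map K L A (\<psi> j) (\<rho> j) \<in> decomposables" if j: "j \<in> J" for j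
    proof -
      have jI: "j \<in> I" using j J(1) by blast
      have \<psi>: "\<psi> j \<in> carrier (lin_End K L)" using j J(2) by blast
      then have "\<psi> j \<in> HomLie K L" unfolding HomLie_iff using J(3) j by blast
      then show ?thesis unfolding decomposables_def using \<psi> \<rho>[OF jI] u[OF jI] \<rho>_def by blast
    qed
    then show ?thesis unfolding eq by (intro fs funcsetI)
  qed
  moreover have "\<Phi>2 \<in> finite_sums (lin_End K T) decomposables"
  proof -
    obtain J \<psi> where J: "J \<subseteq> I" "\<psi> \<in> J \<rightarrow> carrier (lin_End K L)" "\<forall>j\<in>J. \<forall>h\<in>?H2. h (\<psi> j) = \<zero>\<^bsub>L\<^esub>"
      "(\<Oplus>\<^bsub>TE\<^esub>i\<in>I. \<phi> i \<otimes>\<^sub>E \<beta> i) = (\<Oplus>\<^bsub>TE\<^esub>i\<in>J. \<psi> i \<otimes>\<^sub>E \<beta> i)"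
      using TE_reduce_kernel[of ?H2, OF H2 I(1,2) \<beta>I zero2] by blast
    have \<beta>J: "\<beta> \<in> J \<rightarrow> carrier (lin_End K A)" using \<beta>I J(1) by blast
    have eq: "\<Phi>2 = (\<Oplus>\<^bsub>lin_End K T\<^esub>i\<in>J. tensor_map K L A (\<psi> i) (\<beta> i))"
      unfolding \<Phi>2_def tensor_End_map_finsum[OF I(2) \<beta>I, symmetric] J(4) by (rule tensor_End_map_finsum[OF J(2) \<beta>J])
    have "tensor_map K L A (\<psi> j) (\<beta> j) \<in> decomposables" if j: "j \<in> J" for j
    proof -
      have jI: "j \<in> I" using j J(1) by blast
      have \<psi>: "\<psi> j \<in> carrier (lin_End K L)" using j J(2) by blast
      have "bracket L (bracket L x y) (\<psi> j z) = \<zero>\<^bsub>L\<^esub>"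
        if "x \<in> carrier L" "y \<in> carrier L" "z \<in> carrier L" for x y z
        using J(3)[rule_format, OF j, of "\<lambda>\<phi>. bracket L (bracket L x y) (\<phi> z)"] that by blast
      then have "\<psi> j \<in> derived_annihilating K L" unfolding derived_iff using \<psi> by blast
      then show ?thesis unfolding decomposables_def using \<psi> \<beta>[OF jI] by blast
    qed
    then show ?thesis unfolding eq by (intro fs funcsetI)
  qed
  ultimately show ?thesis
    unfolding split by (rule finite_sums_add[OF ET.module_axioms decomposables_subset])
qed

section \<open>The isomorphism\<close>

text \<open>Generators of the two summands \<open>HomLie(L) \<otimes> A\<close> and \<open>{\<phi> | [[L, L], \<phi>(L)] = 0} \<otimes> End(A)\<close>.\<close>

abbreviation mult_generators where "mult_generators \<equiv> {\<phi> \<otimes>\<^sub>E \<alpha> | \<phi> \<alpha>. \<phi> \<in> HomLie K L \<and> \<alpha> \<in> mult_op A ` carrier A}"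
abbreviation derived_generators where "derived_generators \<equiv> {\<phi> \<otimes>\<^sub>E \<alpha> | \<phi> \<alpha>. \<phi> \<in> derived_annihilating K L \<and> \<alpha> \<in> carrier (lin_End K A)}"

lemma HomLie_tensor_sum: "HomLie_tensor K L A = module.submodule_sum TE (module.span K TE mult_generators) (module.span K TE derived_generators)"
proof -
  interpret E: vectorspace K TE by (rule TE_vectorspace)
  show ?thesis
    by (auto simp: HomLie_tensor_def tensor_sub_def set_add_def' E.submodule_sum_def image_iff)
qed

lemma generators_carrier: "mult_generators \<subseteq> carrier TE" "derived_generators \<subseteq> carrier TE"
proof -
  interpret E: tensor_pair K "lin_End K L" "lin_End K A" by (rule End_pair)
  show "mult_generators \<subseteq> carrier TE"
  proof
    fix t assume "t \<in> mult_generators"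
    then obtain \<phi> u where "\<phi> \<in> HomLie K L" "u \<in> carrier A" "t = \<phi> \<otimes>\<^sub>E mult_op A u" by blast
    then show "t \<in> carrier TE" using E.pure_mem[OF _ mult_op_mem] unfolding HomLie_iff by blast
  qed
  show "derived_generators \<subseteq> carrier TE" using E.pure_mem derived_iff by blast
qed

lemma HomLie_tensor_submodule: "submodule K (HomLie_tensor K L A) TE"
proof -
  interpret E: vectorspace K TE by (rule TE_vectorspace)
  show ?thesis unfolding HomLie_tensor_sum
    by (intro E.sum_is_submodule E.span_is_submodule generators_carrier)
qed

lemma generators_in_HomLie_tensor: "mult_generators \<union> derived_generators \<subseteq> HomLie_tensor K L A"
proof -
  interpret E: vectorspace K TE by (rule TE_vectorspace)
  note s = E.span_is_submodule[OF generators_carrier(1)] E.span_is_submodule[OF generators_carrier(2)]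
  have "E.span mult_generators \<union> E.span derived_generators \<subseteq> HomLie_tensor K L A"
    unfolding HomLie_tensor_sum using E.in_sum[OF s] E.in_sum[OF s(2,1)] E.msum_comm[OF s] by blast
  then show ?thesis using E.in_own_span[OF generators_carrier(1)] E.in_own_span[OF generators_carrier(2)] by blast
qed

lemma tensor_End_map_HomLie_tensor:
  assumes "t \<in> HomLie_tensor K L A"
  shows "tensor_End_map K L A t \<in> HomLie K C"
proof -
  interpret E: vectorspace K TE by (rule TE_vectorspace)
  let ?P = "{t \<in> carrier TE. tensor_End_map K L A t \<in> HomLie K C}"
  have P: "submodule K ?P TE"
    by (rule vimage_submodule[OF E.module_axioms ET.module_axioms tensor_End_map_hom HomLie_current_submodule])
  have mult_P: "mult_generators \<subseteq> ?P"
  proof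
    fix t assume t: "t \<in> mult_generators"
    then obtain \<phi> u where *: "\<phi> \<in> HomLie K L" "u \<in> carrier A" "t = \<phi> \<otimes>\<^sub>E mult_op A u" by blast
    then have "\<phi> \<in> carrier (lin_End K L)" unfolding HomLie_iff by blast
    then have "tensor_End_map K L A t = tensor_map K L A \<phi> (mult_op A u)"
      unfolding *(3) using mult_op_mem[OF *(2)] by (rule tensor_End_map_pure)
    then show "t \<in> ?P" using HomLie_tensor_mult_op[OF *(1,2)] t generators_carrier(1) by auto
  qed
  have derived_P: "derived_generators \<subseteq> ?P"
  proof
    fix t assume t: "t \<in> derived_generators"
    then obtain \<phi> \<alpha> where *: "\<phi> \<in> derived_annihilating K L" "\<alpha> \<in> carrier (lin_End K A)" "t = \<phi> \<otimes>\<^sub>E \<alpha>" by blast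
    then have "\<phi> \<in> carrier (lin_End K L)" unfolding derived_iff by blast
    then have "tensor_End_map K L A t = tensor_map K L A \<phi> \<alpha>"
      unfolding *(3) using *(2) by (rule tensor_End_map_pure)
    then show "t \<in> ?P" using HomLie_tensor_derived[OF *(1,2)] t generators_carrier(2) by auto
  qed
  note spans = E.span_is_subset[OF mult_P P] E.span_is_subset[OF derived_P P]
  have "HomLie_tensor K L A \<subseteq> ?P"
    unfolding HomLie_tensor_sum
    using E.sum_is_minimal[OF E.span_is_submodule[OF generators_carrier(1)] E.span_is_submodule[OF generators_carrier(2)] P]
      spans by simp
  then show ?thesis using assms by blast
qed

lemma decomposable_in_image:
  assumes "\<Phi> \<in> decomposables"
  shows "\<exists>t \<in> HomLie_tensor K L A. tensor_End_map K L A t = \<Phi>"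
proof -
  obtain \<phi> \<alpha> where *: "\<Phi> = tensor_map K L A \<phi> \<alpha>" "\<phi> \<in> carrier (lin_End K L)" "\<alpha> \<in> carrier (lin_End K A)"
    "\<phi> \<in> HomLie K L \<and> (\<exists>u\<in>carrier A. \<alpha> = mult_op A u) \<or> \<phi> \<in> derived_annihilating K L"
    using assms unfolding decomposables_def by blast
  have "\<phi> \<otimes>\<^sub>E \<alpha> \<in> mult_generators \<union> derived_generators" using *(3,4) by blast
  then show ?thesis using generators_in_HomLie_tensor tensor_End_map_pure[OF *(2,3)] *(1) by blast
qed

text \<open>Surjectivity onto \<open>HomLie(L \<otimes> A)\<close> follows from the decomposition: a sum of images of generators is the
  image of the sum.\<close>

lemma finite_sum_of_decomposables_in_image:
  assumes "\<Phi> \<in> finite_sums (lin_End K T) decomposables"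
  shows "\<Phi> \<in> tensor_End_map K L A ` HomLie_tensor K L A"
proof -
  interpret E: vectorspace K TE by (rule TE_vectorspace)
  obtain n :: nat and s where s: "\<forall>i<n. s i \<in> decomposables" "\<Phi> = (\<Oplus>\<^bsub>lin_End K T\<^esub>i\<in>{..<n}. s i)"
    using assms unfolding finite_sums_def by blast
  have "\<forall>i. \<exists>t. i < n \<longrightarrow> t \<in> HomLie_tensor K L A \<and> tensor_End_map K L A t = s i"
    using s(1) decomposable_in_image by blast
  then obtain t where t: "\<And>i. i < n \<Longrightarrow> t i \<in> HomLie_tensor K L A" "\<And>i. i < n \<Longrightarrow> tensor_End_map K L A (t i) = s i"
    by metis
  have tc: "t i \<in> carrier TE" if "i < n" for i
    using t(1)[OF that] submodule.subset[OF HomLie_tensor_submodule] by blast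
  have "tensor_End_map K L A (\<Oplus>\<^bsub>TE\<^esub>i\<in>{..<n}. t i) = (\<Oplus>\<^bsub>lin_End K T\<^esub>i\<in>{..<n}. tensor_End_map K L A (t i))"
    using tc by (intro module_hom_finsum[OF E.module_axioms ET.module_axioms tensor_End_map_hom]) blast
  also have "\<dots> = \<Phi>" unfolding s(2)
    using t(2) s(1) decomposables_subset by (intro ET.M.finsum_cong') blast+
  finally have "tensor_End_map K L A (\<Oplus>\<^bsub>TE\<^esub>i\<in>{..<n}. t i) = \<Phi>" .
  moreover have "(\<Oplus>\<^bsub>TE\<^esub>i\<in>{..<n}. t i) \<in> HomLie_tensor K L A"
    using t(1) by (intro submodule_finsum_closed[OF HomLie_tensor_submodule]) blast
  ultimately show ?thesis by blast
qed

lemma tensor_End_map_linear: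
  "linear_map K (TE\<lparr>carrier := HomLie_tensor K L A\<rparr>) ((lin_End K C)\<lparr>carrier := HomLie K C\<rparr>) (tensor_End_map K L A)"
proof -
  interpret E: vectorspace K TE by (rule TE_vectorspace)
  have "vectorspace K (TE\<lparr>carrier := HomLie_tensor K L A\<rparr>)"
    by (intro vectorspaceI Lie.field_axioms E.submodule_is_module HomLie_tensor_submodule)
  moreover have "vectorspace K ((lin_End K T)\<lparr>carrier := HomLie K C\<rparr>)"
    by (intro vectorspaceI Lie.field_axioms ET.submodule_is_module HomLie_current_submodule)
  moreover have "tensor_End_map K L A \<in> module_hom K (TE\<lparr>carrier := HomLie_tensor K L A\<rparr>) ((lin_End K T)\<lparr>carrier := HomLie K C\<rparr>)"
  proof (rule module_homI)
    note sub = subsetD[OF submodule.subset[OF HomLie_tensor_submodule]]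
    fix s assume "s \<in> carrier (TE\<lparr>carrier := HomLie_tensor K L A\<rparr>)"
    then have s: "s \<in> HomLie_tensor K L A" by simp
    show "tensor_End_map K L A s \<in> carrier ((lin_End K T)\<lparr>carrier := HomLie K C\<rparr>)"
      using tensor_End_map_HomLie_tensor[OF s] by simp
    show "tensor_End_map K L A (c \<odot>\<^bsub>TE\<lparr>carrier := HomLie_tensor K L A\<rparr>\<^esub> s)
        = c \<odot>\<^bsub>(lin_End K T)\<lparr>carrier := HomLie K C\<rparr>\<^esub> tensor_End_map K L A s" if "c \<in> carrier K" for c
      using module_hom_smult[OF tensor_End_map_hom that sub[OF s]] by simp
    fix t assume "t \<in> carrier (TE\<lparr>carrier := HomLie_tensor K L A\<rparr>)"
    then have t: "t \<in> HomLie_tensor K L A" by simp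
    show "tensor_End_map K L A (s \<oplus>\<^bsub>TE\<lparr>carrier := HomLie_tensor K L A\<rparr>\<^esub> t)
        = tensor_End_map K L A s \<oplus>\<^bsub>(lin_End K T)\<lparr>carrier := HomLie K C\<rparr>\<^esub> tensor_End_map K L A t"
      using module_hom_add[OF tensor_End_map_hom sub[OF s] sub[OF t]] by simp
  qed
  ultimately show ?thesis
    unfolding lin_End_current linear_map_def mod_hom_def mod_hom_axioms_def by (simp add: vectorspace_module)
qed

lemma tensor_End_map_bij:
  assumes "Lie.fin_dim \<or> W.fin_dim"
  shows "bij_betw (tensor_End_map K L A) (HomLie_tensor K L A) (HomLie K C)"
  unfolding bij_betw_def
proof
  show "inj_on (tensor_End_map K L A) (HomLie_tensor K L A)"
    using tensor_End_map_inj submodule.subset[OF HomLie_tensor_submodule] by (rule inj_on_subset)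
  show "tensor_End_map K L A ` HomLie_tensor K L A = HomLie K C"
    using tensor_End_map_HomLie_tensor finite_sum_of_decomposables_in_image HomLie_current_decompose[OF assms] by blast
qed

lemma HomLie_current_representation:
  assumes "Lie.fin_dim \<or> W.fin_dim" and "\<Phi> \<in> HomLie K C"
  shows "\<exists>(n::nat) \<phi> \<alpha>.
           (\<forall>i<n. \<phi> i \<in> carrier (lin_End K L) \<and> \<alpha> i \<in> carrier (lin_End K A)
             \<and> tensor_map K L A (\<phi> i) (\<alpha> i) \<in> HomLie K C
             \<and> ((\<phi> i \<in> HomLie K L \<and> (\<exists>u\<in>carrier A. \<alpha> i = mult_op A u))
                \<or> \<phi> i \<in> derived_annihilating K L))
           \<and> \<Phi> = (\<Oplus>\<^bsub>lin_End K C\<^esub> i\<in>{..<n}. tensor_map K L A (\<phi> i) (\<alpha> i))"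
proof -
  obtain n :: nat and s where s: "\<forall>i<n. s i \<in> decomposables" "\<Phi> = (\<Oplus>\<^bsub>lin_End K T\<^esub>i\<in>{..<n}. s i)"
    using HomLie_current_decompose[OF assms] unfolding finite_sums_def by blast
  have "\<forall>i. \<exists>\<phi> \<alpha>. i < n \<longrightarrow> s i = tensor_map K L A \<phi> \<alpha> \<and> \<phi> \<in> carrier (lin_End K L) \<and> \<alpha> \<in> carrier (lin_End K A)
    \<and> (\<phi> \<in> HomLie K L \<and> (\<exists>u\<in>carrier A. \<alpha> = mult_op A u) \<or> \<phi> \<in> derived_annihilating K L)"
    using s(1) unfolding decomposables_def by blast
  then obtain \<phi> \<alpha> where r: "\<And>i. i < n \<Longrightarrow> s i = tensor_map K L A (\<phi> i) (\<alpha> i) \<and> \<phi> i \<in> carrier (lin_End K L) \<and> \<alpha> i \<in> carrier (lin_End K A)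
    \<and> (\<phi> i \<in> HomLie K L \<and> (\<exists>u\<in>carrier A. \<alpha> i = mult_op A u) \<or> \<phi> i \<in> derived_annihilating K L)"
    by metis
  have "tensor_map K L A (\<phi> i) (\<alpha> i) \<in> HomLie K C" if "i < n" for i
    using decomposables_HomLie[of "s i"] s(1) r[OF that] that by metis
  moreover have "\<Phi> = (\<Oplus>\<^bsub>lin_End K C\<^esub> i\<in>{..<n}. tensor_map K L A (\<phi> i) (\<alpha> i))"
    unfolding s(2) lin_End_current using r by (intro ET.M.finsum_cong' funcsetI tensor_map_mem) simp_all
  ultimately show ?thesis
    using r by (intro exI[of _ n] exI[of _ \<phi>] exI[of _ \<alpha>] conjI allI impI) simp_all
qed

end

theorem theorem4:
  fixes K :: "('k, 'm) ring_scheme"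
    and L :: "('k, 'l, 'n) lie_scheme"
    and A :: "('k, 'a, 'o) module_scheme"
  assumes "field K" and "characteristic K \<noteq> 2" and "characteristic K \<noteq> 3"
    and "lie_algebra K L"
    and "algebra K A"
    and "vectorspace.fin_dim K L \<or> vectorspace.fin_dim K A"
  shows
    "linear_map K
       ((tensor_space K (lin_End K L) (lin_End K A))\<lparr>carrier := HomLie_tensor K L A\<rparr>)
       ((lin_End K (current_lie K L A))\<lparr>carrier := HomLie K (current_lie K L A)\<rparr>)
       (tensor_End_map K L A)
     \<and> bij_betw (tensor_End_map K L A) (HomLie_tensor K L A) (HomLie K (current_lie K L A))
     \<and> (\<forall>\<Phi> \<in> HomLie K (current_lie K L A).
         \<exists>(n::nat) \<phi> \<alpha>.
           (\<forall>i<n. \<phi> i \<in> carrier (lin_End K L) \<and> \<alpha> i \<in> carrier (lin_End K A)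
             \<and> tensor_map K L A (\<phi> i) (\<alpha> i) \<in> HomLie K (current_lie K L A)
             \<and> ((\<phi> i \<in> HomLie K L \<and> (\<exists>u\<in>carrier A. \<alpha> i = mult_op A u))
                \<or> \<phi> i \<in> derived_annihilating K L))
           \<and> \<Phi> = (\<Oplus>\<^bsub>lin_End K (current_lie K L A)\<^esub> i\<in>{..<n}.
                     tensor_map K L A (\<phi> i) (\<alpha> i)))"
proof -
  interpret current_pair K L A using assms by (simp add: current_pair_def)
  show ?thesis
    by (intro conjI ballI tensor_End_map_linear tensor_End_map_bij[OF assms(6)]
        HomLie_current_representation[OF assms(6)])
qed

end
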